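(* Assume that $F$ satisfies the strong separation property, i.e. $S_i(F)\cap S_j(F)=\emptyset$ for all distinct $i,j\in\mathcal I$. Let $s\in(0,2)$ and let $\mu=\mu^s$ be the corresponding K\"aenm\"aki measure on $F$. If $$\dim\pi_1(\mu_1)=\min\left\{\frac{h(\mu)}{\chi_1(\mu)},1\right\},$$ then $$\dim\mu=\begin{cases}\dfrac{h(\mu)}{\chi_1(\mu)}&\text{if }h(\mu)\le\chi_1(\mu),\\[2mm]1+\dfrac{h(\mu)-\chi_1(\mu)}{\chi_2(\mu)}&\text{if }h(\mu)>\chi_1(\mu).\end{cases}$$
   Context: **Iterated function system.** Let $\mathcal I=\{1,\dots,d\}$, let $1<l\le d$, and let $a_i,b_i\in(0,1)$ for $i\in\mathcal I$. Put $A_i=\begin{bmatrix} a_i & 0 \\ 0 & b_i \end{bmatrix}$ for $i<l$ and $A_i=\begin{bmatrix} 0 & a_i \\ b_i & 0 \end{bmatrix}$ for $i\ge l$. Assume $a_i\ne b_i$ for some $1\le i\le l-1$. Let $t_i\in\mathbb R^2$ and $S_i(x)=A_ix+t_i$, and assume each $S_i$ maps $[0,1]^2$ into itself. $F\subseteq[0,1]^2$ is the unique non-empty compact set with $F=\bigcup_{i\in\mathcal I}S_i(F)$. **Symbolic notation.** $\mathcal I^*=\bigcup_{k\ge1}\mathcal I^k$; $\Sigma=\mathcal I^{\mathbb N}$ with the product topology and left shift $\sigma$. For $\mathbf i=(i_1,i_2,\dots)\in\Sigma$, $\mathbf i|_k=(i_1,\dots,i_k)$. For a finite word $\mathbf i=(i_1,\dots,i_k)$,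 $|\mathbf i|=k$, $S_{\mathbf i}=S_{i_1}\circ\cdots\circ S_{i_k}$, $[\mathbf i]$ is the cylinder of sequences beginning with $\mathbf i$, and $\alpha_1(\mathbf i)\ge\alpha_2(\mathbf i)>0$ are the singular values of $A_{i_1}\cdots A_{i_k}$. The coding map is $\Pi:\Sigma\to\mathbb R^2$, $\{\Pi(\mathbf i)\}=\bigcap_{k\ge1}S_{\mathbf i|_k}([0,1]^2)$. **K\"aenm\"aki measure.** For $s\in(0,2]$ let $\phi^s(\mathbf i)=\alpha_1(\mathbf i)^s$ if $s<1$ and $\phi^s(\mathbf i)=\alpha_1(\mathbf i)\alpha_2(\mathbf i)^{s-1}$ if $s\in[1,2]$, and $P(s)=\lim_{n\to\infty}\frac1n\log\sum_{\mathbf i\in\mathcal I^n}\phi^s(\mathbf i)$. For $s\in(0,2)$, $m=m^s$ denotes the (unique) $\sigma$-invariant ergodic Borel probability measure on $\Sigma$ for which there is $C_0\ge1$ with $C_0^{-1}e^{-P(s)|\mathbf i|}\phi^s(\mathbf i)\le m([\mathbf i])\le C_0e^{-P(s)|\mathbf i|}\phi^s(\mathbf i)$ for all $\mathbf i\in\mathcal I^*$; and $\mu=\mu^s=m\circ\Pi^{-1}$. Both $m$ and $\mu$ are called K\"aenm\"aki measures. **Exponents and entropy.** $\chi_1(\mu)\le\chi_2(\mu)$ are the constants with $\chi_r(\mu)=-\lim_n\frac1n\log\alpha_r(\mathbf i|_n)$ for $m$-a.e. $\mathbf i$ ($r=1,2$), and $h(\mu)=-\lim_n\frac1n\log m([\mathbf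 i|_n])$ for $m$-a.e. $\mathbf i$. **Associated subshift.** $\Sigma_A\subset\{1,\dots,2d\}^{\mathbb N}$ is the (one-sided) subshift of finite type with transition matrix $A(i,j)=1$ if $i\in\{1,\dots,l-1\}\cup\{d+l,\dots,2d\}$ and $j\le d$; $A(i,j)=1$ if $i\in\{l,\dots,d+l-1\}$ and $j>d$; $A(i,j)=0$ otherwise. The injection $\tau:\Sigma\to\Sigma_A$ is given by $\tau(\mathbf i)=(\tau_1(\mathbf i),\tau_2(\mathbf i),\dots)$ with $\tau_m(\mathbf i)=i_m$ if $\#\{1\le j\le m-1:i_j\ge l\}$ is even and $\tau_m(\mathbf i)=i_m+d$ if it is odd. Define $f_{1,s}:\Sigma_A\to\mathbb R$, depending only on the first symbol $i_1$: for $s\in(0,1)$: $f_{1,s}=s\log a_{i_1}$ if $i_1\le d$ and $f_{1,s}=s\log b_{i_1-d}$ if $i_1\ge d+1$; for $s\in[1,2]$: $f_{1,s}=\log a_{i_1}+(s-1)\log b_{i_1}$ if $i_1\le d$ and $f_{1,s}=\log b_{i_1-d}+(s-1)\log a_{i_1-d}$ if $i_1\ge d+1$. $m_1$ is the unique shift-invariant Gibbs probability measure on the (mixing) subshift $\Sigma_A$ for the potential $f_{1,s}$. Put $\mu_1=m_1\circ\tau\circ\Pi^{-1}$, i.e. $\mu_1(E)=m_1(\tau(\Pi^{-1}(E)))$, a finite nonzero Borel measure on $F$. **Projections and dimension.** $\pi_1(x,y)=x$ and $\pi_1(\lambda)$ is the pushforward of a measure $\lambda$ under $\pi_1$. A finite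 nonzero Borel measure $\lambda$ is exact dimensional with exact dimension $\dim\lambda=\alpha$ if $\lim_{r\to0}\frac{\log\lambda(B(x,r))}{\log r}=\alpha$ for $\lambda$-a.e. $x$. It is known that $\mu$ (under strong separation) and $\pi_1(\mu_1)$ are exact dimensional, and $\dim$ denotes their exact dimensions. *)

theory Defs
  imports "HOL-Probability.Probability"
begin

section \<open>Box-like self-affine iterated function systems\<close>

text \<open>
  The alphabet is \<open>{1..d}\<close>; the maps with index below \<open>l\<close> are diagonal, the remaining ones
  antidiagonal. Finite words are lists and infinite words are functions on the naturals, so the
  letter written \<open>i\<^sub>k\<close> on paper (\<open>k \<ge> 1\<close>) is \<open>w (k - 1)\<close>.
\<close>

definition ifs_matrix :: "nat \<Rightarrow> (nat \<Rightarrow> real) \<Rightarrow> (nat \<Rightarrow> real) \<Rightarrow> nat \<Rightarrow> real^2^2" where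
  "ifs_matrix l a b i =
     (if i < l then vector [vector [a i, 0], vector [0, b i]]
      else vector [vector [0, a i], vector [b i, 0]])"

definition ifs_map ::
  "nat \<Rightarrow> (nat \<Rightarrow> real) \<Rightarrow> (nat \<Rightarrow> real) \<Rightarrow> (nat \<Rightarrow> real^2) \<Rightarrow> nat \<Rightarrow> real^2 \<Rightarrow> real^2" where
  "ifs_map l a b t i x = ifs_matrix l a b i *v x + t i"

definition unit_square :: "(real^2) set" where
  "unit_square = cbox 0 1"

definition box_like_ifs ::
  "nat \<Rightarrow> nat \<Rightarrow> (nat \<Rightarrow> real) \<Rightarrow> (nat \<Rightarrow> real) \<Rightarrow> (nat \<Rightarrow> real^2) \<Rightarrow> bool" where
  "box_like_ifs d l a b t \<longleftrightarrow>
     1 < l \<and> l \<le> d \<and>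
     (\<forall>i\<in>{1..d}. 0 < a i \<and> a i < 1 \<and> 0 < b i \<and> b i < 1) \<and>
     (\<exists>i\<in>{1..l - 1}. a i \<noteq> b i) \<and>
     (\<forall>i\<in>{1..d}. ifs_map l a b t i ` unit_square \<subseteq> unit_square)"

definition attractor ::
  "nat \<Rightarrow> nat \<Rightarrow> (nat \<Rightarrow> real) \<Rightarrow> (nat \<Rightarrow> real) \<Rightarrow> (nat \<Rightarrow> real^2) \<Rightarrow> (real^2) set \<Rightarrow> bool" where
  "attractor d l a b t F \<longleftrightarrow>
     F \<noteq> {} \<and> compact F \<and> F \<subseteq> unit_square \<and> F = (\<Union>i\<in>{1..d}. ifs_map l a b t i ` F)"

definition strong_separation ::
  "nat \<Rightarrow> nat \<Rightarrow> (nat \<Rightarrow> real) \<Rightarrow> (nat \<Rightarrow> real) \<Rightarrow> (nat \<Rightarrow> real^2) \<Rightarrow> (real^2) set \<Rightarrow> bool" where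
  "strong_separation d l a b t F \<longleftrightarrow>
     (\<forall>i\<in>{1..d}. \<forall>j\<in>{1..d}. i \<noteq> j \<longrightarrow> ifs_map l a b t i ` F \<inter> ifs_map l a b t j ` F = {})"


section \<open>Symbolic space and coding map\<close>

definition full_shift :: "nat \<Rightarrow> (nat \<Rightarrow> nat) set" where
  "full_shift d = {w. \<forall>n. w n \<in> {1..d}}"

definition shift :: "(nat \<Rightarrow> nat) \<Rightarrow> nat \<Rightarrow> nat" where
  "shift w = (\<lambda>n. w (Suc n))"

definition prefix :: "(nat \<Rightarrow> nat) \<Rightarrow> nat \<Rightarrow> nat list" where
  "prefix w k = map w [0..<k]"

definition cylinder :: "(nat \<Rightarrow> nat) set \<Rightarrow> nat list \<Rightarrow> (nat \<Rightarrow> nat) set" where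
  "cylinder X u = {w \<in> X. prefix w (length u) = u}"

definition words :: "nat \<Rightarrow> nat \<Rightarrow> nat list set" where
  "words d n = {u. length u = n \<and> set u \<subseteq> {1..d}}"

definition word_map ::
  "nat \<Rightarrow> (nat \<Rightarrow> real) \<Rightarrow> (nat \<Rightarrow> real) \<Rightarrow> (nat \<Rightarrow> real^2) \<Rightarrow> nat list \<Rightarrow> real^2 \<Rightarrow> real^2" where
  "word_map l a b t u = foldr (\<lambda>i g. ifs_map l a b t i \<circ> g) u id"

definition word_matrix ::
  "nat \<Rightarrow> (nat \<Rightarrow> real) \<Rightarrow> (nat \<Rightarrow> real) \<Rightarrow> nat list \<Rightarrow> real^2^2" where
  "word_matrix l a b u = foldr (\<lambda>i M. ifs_matrix l a b i ** M) u (mat 1)"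

definition coding_map ::
  "nat \<Rightarrow> (nat \<Rightarrow> real) \<Rightarrow> (nat \<Rightarrow> real) \<Rightarrow> (nat \<Rightarrow> real^2) \<Rightarrow> (nat \<Rightarrow> nat) \<Rightarrow> real^2" where
  "coding_map l a b t w =
     the_elem (\<Inter>k\<in>{1..}. word_map l a b t (prefix w k) ` unit_square)"

text \<open>Borel probability measures on a subset \<open>X\<close> of the sequence space. The Borel sets come from
  the product of the discrete topologies on the naturals.\<close>

definition borel_prob_on :: "(nat \<Rightarrow> nat) set \<Rightarrow> (nat \<Rightarrow> nat) measure \<Rightarrow> bool" where
  "borel_prob_on X m \<longleftrightarrow> prob_space m \<and> space m = X \<and> sets m = sets (restrict_space borel X)"

definition shift_invariant :: "(nat \<Rightarrow> nat) measure \<Rightarrow> bool" where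
  "shift_invariant m \<longleftrightarrow>
     (\<forall>E\<in>sets m. shift -` E \<inter> space m \<in> sets m \<and>
                 emeasure m (shift -` E \<inter> space m) = emeasure m E)"

definition shift_ergodic :: "(nat \<Rightarrow> nat) measure \<Rightarrow> bool" where
  "shift_ergodic m \<longleftrightarrow>
     shift_invariant m \<and>
     (\<forall>E\<in>sets m. shift -` E \<inter> space m = E \<longrightarrow> measure m E = 0 \<or> measure m E = 1)"


section \<open>Singular values, pressure and Kaenmaki measures\<close>

definition singular_values :: "real^2^2 \<Rightarrow> real set" where
  "singular_values M =
     {\<sigma>. 0 \<le> \<sigma> \<and> (\<exists>v. v \<noteq> 0 \<and> (transpose M ** M) *v v = \<sigma>\<^sup>2 *\<^sub>R v)}"

text \<open>The larger and the smaller singular value of a 2x2 matrix; they coincide if the set of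
  singular values is a singleton.\<close>

definition alpha :: "nat \<Rightarrow> (nat \<Rightarrow> real) \<Rightarrow> (nat \<Rightarrow> real) \<Rightarrow> nat \<Rightarrow> nat list \<Rightarrow> real" where
  "alpha l a b r u =
     (if r = 1 then Max (singular_values (word_matrix l a b u))
      else Min (singular_values (word_matrix l a b u)))"

definition sv_function ::
  "nat \<Rightarrow> (nat \<Rightarrow> real) \<Rightarrow> (nat \<Rightarrow> real) \<Rightarrow> real \<Rightarrow> nat list \<Rightarrow> real" where
  "sv_function l a b s u =
     (if s < 1 then alpha l a b 1 u powr s
      else alpha l a b 1 u * alpha l a b 2 u powr (s - 1))"

definition pressure ::
  "nat \<Rightarrow> nat \<Rightarrow> (nat \<Rightarrow> real) \<Rightarrow> (nat \<Rightarrow> real) \<Rightarrow> real \<Rightarrow> real" where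
  "pressure d l a b s = lim (\<lambda>n. ln (\<Sum>u\<in>words d n. sv_function l a b s u) / real n)"

definition kaenmaki_measure ::
  "nat \<Rightarrow> nat \<Rightarrow> (nat \<Rightarrow> real) \<Rightarrow> (nat \<Rightarrow> real) \<Rightarrow> real \<Rightarrow> (nat \<Rightarrow> nat) measure \<Rightarrow> bool" where
  "kaenmaki_measure d l a b s m \<longleftrightarrow>
     borel_prob_on (full_shift d) m \<and> shift_ergodic m \<and>
     (\<exists>C\<ge>1. \<forall>n\<ge>1. \<forall>u\<in>words d n.
        inverse C * exp (- pressure d l a b s * real n) * sv_function l a b s u
          \<le> measure m (cylinder (full_shift d) u) \<and>
        measure m (cylinder (full_shift d) u)
          \<le> C * exp (- pressure d l a b s * real n) * sv_function l a b s u)"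

definition kaenmaki_projection ::
  "nat \<Rightarrow> (nat \<Rightarrow> real) \<Rightarrow> (nat \<Rightarrow> real) \<Rightarrow> (nat \<Rightarrow> real^2) \<Rightarrow> (nat \<Rightarrow> nat) measure \<Rightarrow>
     (real^2) measure" where
  "kaenmaki_projection l a b t m = distr m borel (coding_map l a b t)"

definition lyapunov_exponent ::
  "nat \<Rightarrow> (nat \<Rightarrow> real) \<Rightarrow> (nat \<Rightarrow> real) \<Rightarrow> (nat \<Rightarrow> nat) measure \<Rightarrow> nat \<Rightarrow> real \<Rightarrow> bool" where
  "lyapunov_exponent l a b m r c \<longleftrightarrow>
     (AE w in m. (\<lambda>n. - (ln (alpha l a b r (prefix w n)) / real n)) \<longlonglongrightarrow> c)"

definition has_entropy :: "(nat \<Rightarrow> nat) measure \<Rightarrow> real \<Rightarrow> bool" where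
  "has_entropy m h \<longleftrightarrow>
     (AE w in m. (\<lambda>n. - (ln (measure m (cylinder (space m) (prefix w n))) / real n))
        \<longlonglongrightarrow> h)"


section \<open>The associated subshift of finite type\<close>

definition transition_matrix :: "nat \<Rightarrow> nat \<Rightarrow> nat \<Rightarrow> nat \<Rightarrow> nat" where
  "transition_matrix d l i j =
     (if i \<in> {1..l - 1} \<union> {d + l..2 * d} \<and> j \<in> {1..d} then 1
      else if i \<in> {l..d + l - 1} \<and> j \<in> {d + 1..2 * d} then 1
      else 0)"

definition subshift :: "nat \<Rightarrow> nat \<Rightarrow> (nat \<Rightarrow> nat) set" where
  "subshift d l = {w \<in> full_shift (2 * d). \<forall>n. transition_matrix d l (w n) (w (Suc n)) = 1}"

definition tau :: "nat \<Rightarrow> nat \<Rightarrow> (nat \<Rightarrow> nat) \<Rightarrow> nat \<Rightarrow> nat" where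
  "tau d l w n = (if even (card {j. j < n \<and> l \<le> w j}) then w n else w n + d)"

definition potential1 ::
  "nat \<Rightarrow> (nat \<Rightarrow> real) \<Rightarrow> (nat \<Rightarrow> real) \<Rightarrow> real \<Rightarrow> (nat \<Rightarrow> nat) \<Rightarrow> real" where
  "potential1 d a b s w =
     (let i = w 0 in
      if s < 1 then
        (if i \<le> d then s * ln (a i) else s * ln (b (i - d)))
      else
        (if i \<le> d then ln (a i) + (s - 1) * ln (b i)
         else ln (b (i - d)) + (s - 1) * ln (a (i - d))))"

text \<open>Gibbs measures in the sense of Bowen. The constant \<open>P\<close> is determined by the inequalities:
  it is the topological pressure of \<open>f\<close>.\<close>

definition gibbs_measure ::
  "(nat \<Rightarrow> nat) set \<Rightarrow> ((nat \<Rightarrow> nat) \<Rightarrow> real) \<Rightarrow> (nat \<Rightarrow> nat) measure \<Rightarrow> bool" where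
  "gibbs_measure X f m \<longleftrightarrow>
     borel_prob_on X m \<and> shift_invariant m \<and>
     (\<exists>P. \<exists>C\<ge>1. \<forall>w\<in>X. \<forall>n\<ge>1.
        inverse C * exp (- P * real n + (\<Sum>k<n. f ((shift ^^ k) w)))
          \<le> measure m (cylinder X (prefix w n)) \<and>
        measure m (cylinder X (prefix w n))
          \<le> C * exp (- P * real n + (\<Sum>k<n. f ((shift ^^ k) w))))"

definition mu1 ::
  "nat \<Rightarrow> nat \<Rightarrow> (nat \<Rightarrow> real) \<Rightarrow> (nat \<Rightarrow> real) \<Rightarrow> (nat \<Rightarrow> real^2) \<Rightarrow> (nat \<Rightarrow> nat) measure \<Rightarrow>
     (real^2) measure" where
  "mu1 d l a b t m1 =
     measure_of UNIV (sets borel)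
       (\<lambda>E. emeasure m1 (tau d l ` (coding_map l a b t -` E \<inter> full_shift d)))"


section \<open>Exact dimension\<close>

text \<open>Almost every centre lies in the support of \<open>M\<close>, so the convention \<open>ln 0 = 0\<close> plays no role.\<close>

definition has_exact_dimension :: "'a::metric_space measure \<Rightarrow> real \<Rightarrow> bool" where
  "has_exact_dimension M \<delta> \<longleftrightarrow>
     sets M = sets borel \<and> finite_measure M \<and> emeasure M (space M) \<noteq> 0 \<and>
     (AE x in M. ((\<lambda>r. ln (measure M (ball x r)) / ln r) \<longlongrightarrow> \<delta>) (at_right 0))"

end

theory Submission
  imports Defs
begin

text \<open>
  The local dimension is computed along the rectangles \<open>S\<^sub>u([0,1]\<^sup>2)\<close>, where \<open>u\<close> runs through the prefixes
  of a typical sequence. After \<open>n\<close> letters the sides are about \<open>exp (- n chi1)\<close> and \<open>exp (- n chi2)\<close>,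
  and the cylinder has mass about \<open>exp (- n h)\<close>. By strong separation, a ball whose radius is a small
  multiple of the short side meets \<open>F\<close> only inside its own rectangle, and the inverse of \<open>S\<^sub>u\<close> turns it
  into a strip of relative width \<open>exp (- n (chi2 - chi1))\<close>. If the strip is vertical and the measure is
  a product up to constants, then the mass of the ball is about \<open>exp (- n h)\<close> times the mass of an
  interval of that width under the projection to the first axis. With \<open>D\<close> the dimension of the
  projection this gives the Ledrappier-Young formula \<open>dim \<mu> = (h + D (chi2 - chi1)) / chi2\<close>,
  which is proved for every value of \<open>D\<close> (\<open>ledrappier_young\<close>). Inserting \<open>D = min {h / chi1, 1}\<close>
  yields the two cases.

  Three points make this rigorous.

  First, antidiagonal maps exchange the axes, so the Kaenmaki measure \<open>m\<close> is not a product up to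
  constants. The pullback of \<open>m\<^sub>1\<close> under \<open>\<tau>\<close> is, provided that the first word has an even number
  of antidiagonal letters (\<open>Gibbs_product_le\<close>, \<open>Gibbs_product_ge\<close>); for such a word \<open>S\<^sub>u\<close> is
  diagonal, and the strip is vertical. The computation is therefore done for \<open>\<mu>\<^sub>1\<close>, and only at times
  with an even prefix.

  Secondly, the dimension of the projection is applied at the moving point \<open>\<sigma>\<^sup>n w\<close> and at a scale that
  shrinks with \<open>n\<close>. It can be applied when \<open>\<sigma>\<^sup>n w\<close> lies in a set \<open>K\<close> on which the local asymptotics
  are uniform. Visits to \<open>K\<close> occur without long gaps: a gap that starts at time \<open>k\<close> is shorter than
  any fixed fraction of \<open>k\<close>, up to finitely many exceptions (\<open>AE_return_gaps\<close>). Hence the scales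
  seen at visits determine the limit (\<open>limit_along_sparse_scales\<close>).

  Thirdly, \<open>\<mu>\<^sub>1\<close> is dominated by a multiple of \<open>\<mu>\<close> but need not be equivalent to it. Counting cells of
  a grid shows that the masses of balls under \<open>\<mu>\<close> and \<open>\<mu>\<^sub>1\<close> agree up to subexponential factors at
  \<open>\<mu>\<^sub>1\<close>-almost every centre (\<open>AE_ball_ratio\<close>), and the same holds for cylinders. This yields the local
  dimension of \<open>\<mu>\<close> on a set of positive measure. Since the local dimension at the point coded by
  \<open>\<sigma> w\<close> is inherited by the point coded by \<open>w\<close>, ergodicity extends it to almost every point
  (\<open>ergodic_backward_closed\<close>).
\<close>

section \<open>Comparing finite measures on the cells of a partition\<close>

text \<open>
  Cells on which \<open>N\<close> is smaller than \<open>exp (- \<epsilon> n)\<close> times the \<open>M\<close>-mass of the enlarged cell have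
  total \<open>N\<close>-mass at most \<open>exp (- \<epsilon> n) B\<close>, because the enlarged cells have total \<open>M\<close>-mass
  at most \<open>B\<close>. These bounds are summable, and Borel-Cantelli applies.
\<close>

lemma AE_countable_cells:
  fixes M N :: "'a measure" and g :: "nat \<Rightarrow> 'a \<Rightarrow> 'c::countable" and fat :: "nat \<Rightarrow> 'c \<Rightarrow> 'a set"
  assumes "finite_measure M" "finite_measure N"
    and g [measurable]: "\<And>n. g n \<in> measurable N (count_space UNIV)"
    and fat: "\<And>n. (\<integral>\<^sup>+c. emeasure M (fat n c) \<partial>count_space UNIV) \<le> ennreal B"
    and eps: "0 < \<epsilon>"
  shows "AE x in N. eventually (\<lambda>n. exp (- \<epsilon> * real n) * measure M (fat n (g n x))
            \<le> measure N {y \<in> space N. g n y = g n x}) sequentially"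
proof -
  interpret M: finite_measure M by fact
  interpret N: finite_measure N by fact
  let ?cell = "\<lambda>n c. {y \<in> space N. g n y = c}"
  define bc where "bc n = {c. measure N (?cell n c) < exp (- \<epsilon> * real n) * measure M (fat n c)}" for n
  define bad where "bad n = (\<Union>c\<in>bc n. ?cell n c)" for n
  have bad_alt: "bad n = {y \<in> space N. g n y \<in> bc n}" for n
    unfolding bad_def by auto
  have bad_sets [measurable]: "bad n \<in> sets N" for n
    unfolding bad_alt by measurable
  have bad_le: "measure N (bad n) \<le> exp (- \<epsilon> * real n) * max B 0" for n
  proof -
    have "emeasure N (bad n) = (\<integral>\<^sup>+c. emeasure N (?cell n c) \<partial>count_space (bc n))"
      unfolding bad_def by (rule emeasure_UN_countable) (auto simp: disjoint_family_on_def)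
    also have "\<dots> \<le> (\<integral>\<^sup>+c. ennreal (exp (- \<epsilon> * real n)) * emeasure M (fat n c) \<partial>count_space (bc n))"
      by (intro nn_integral_mono)
         (auto simp: bc_def N.emeasure_eq_measure M.emeasure_eq_measure ennreal_mult[symmetric] intro!: ennreal_leI)
    also have "\<dots> \<le> (\<integral>\<^sup>+c. ennreal (exp (- \<epsilon> * real n)) * emeasure M (fat n c) \<partial>count_space UNIV)"
      by (subst nn_integral_count_space_indicator) (auto intro!: nn_integral_mono split: split_indicator simp: nn_integral_count_space_indicator)
    also have "\<dots> \<le> ennreal (exp (- \<epsilon> * real n)) * ennreal B"
      by (subst nn_integral_cmult) (auto intro!: mult_left_mono fat)
    also have "\<dots> = ennreal (exp (- \<epsilon> * real n) * max B 0)"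
      by (simp add: ennreal_mult')
    finally show ?thesis
      by (simp add: N.emeasure_eq_measure)
  qed
  have "summable (\<lambda>n. exp (- \<epsilon>) ^ n * max B 0)"
    using eps by (intro summable_mult2 summable_geometric) auto
  then have "summable (\<lambda>n. measure N (bad n))"
    by (rule summable_comparison_test'[where N = 0])
       (use bad_le in \<open>auto simp: exp_of_nat_mult[symmetric] mult.commute\<close>)
  then have "AE x in N. eventually (\<lambda>n. x \<in> space N - bad n) sequentially"
    by (intro borel_cantelli_AE1) (auto simp: less_top[symmetric])
  then show ?thesis
    by eventually_elim (auto elim!: eventually_mono simp: bad_alt bc_def)
qed

text \<open>
  Cylinders of the space of all sequences of naturals. Measures that live on a subshift are regarded
  as measures on this space, so that all cylinders are Borel sets of one type.
\<close>

definition cyl :: "nat list \<Rightarrow> (nat \<Rightarrow> nat) set" where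
  "cyl u = {w. prefix w (length u) = u}"

lemma letter_measurable [measurable]: "(\<lambda>w::nat \<Rightarrow> nat. w i) \<in> measurable borel (count_space UNIV)"
proof -
  have "(\<lambda>w::nat \<Rightarrow> nat. w i) \<in> borel_measurable borel"
    by (rule measurable_product_coordinates[unfolded comp_def])
  then show ?thesis
    using sets_borel_eq_count_space[where 'a=nat] by (metis measurable_cong_sets sets_borel_eq_count_space)
qed

lemma prefix_measurable [measurable]: "(\<lambda>w. prefix w n) \<in> measurable borel (count_space UNIV)"
proof (induction n)
  case (Suc n)
  have "(\<lambda>w. prefix w (Suc n)) = (\<lambda>w. prefix w n @ [w n])"
    by (simp add: prefix_def fun_eq_iff)
  then show ?case
    using Suc by simp
qed (simp add: prefix_def)

lemma letterwise_measurable: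
  "(\<lambda>(w::nat \<Rightarrow> nat) (n::nat). f n (w (k n)) :: nat) \<in> borel_measurable borel"
  by (rule measurable_coordinatewise_then_product) (rule measurable_compose[OF letter_measurable], simp)


lemma nn_integral_cells:
  fixes g :: "'a \<Rightarrow> 'c::countable"
  assumes [measurable]: "g \<in> measurable N (count_space UNIV)"
  shows "(\<integral>\<^sup>+c. emeasure N {y \<in> space N. g y = c} \<partial>count_space UNIV) = emeasure N (space N)"
proof -
  have "emeasure N (\<Union>c\<in>UNIV. {y \<in> space N. g y = c}) = (\<integral>\<^sup>+c. emeasure N {y \<in> space N. g y = c} \<partial>count_space UNIV)"
    by (rule emeasure_UN_countable) (auto simp: disjoint_family_on_def)
  moreover have "(\<Union>c\<in>UNIV. {y \<in> space N. g y = c}) = space N"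
    by auto
  ultimately show ?thesis by simp
qed

lemma AE_cylinder_ratio:
  fixes M N :: "(nat \<Rightarrow> nat) measure"
  assumes M: "finite_measure M" "sets M = sets borel" and N: "finite_measure N" "sets N = sets borel"
    and eps: "0 < \<epsilon>"
  shows "AE w in N. eventually (\<lambda>n. exp (- \<epsilon> * real n) * measure M (cyl (prefix w n))
            \<le> measure N (cyl (prefix w n))) sequentially"
proof -
  interpret M: finite_measure M by fact
  have sp: "space M = UNIV" "space N = UNIV"
    using sets_eq_imp_space_eq[OF M(2)] sets_eq_imp_space_eq[OF N(2)] by auto
  have meas: "(\<lambda>w. prefix w n) \<in> measurable M (count_space UNIV)" "(\<lambda>w. prefix w n) \<in> measurable N (count_space UNIV)" for n
    by (simp_all add: measurable_cong_sets[OF M(2) refl] measurable_cong_sets[OF N(2) refl])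
  have "AE w in N. eventually (\<lambda>n. exp (- \<epsilon> * real n) * measure M {v \<in> space M. prefix v n = prefix w n}
            \<le> measure N {v \<in> space N. prefix v n = prefix w n}) sequentially"
    by (rule AE_countable_cells[OF M(1) N(1) meas(2) _ eps, where B = "measure M (space M)"])
       (subst nn_integral_cells[OF meas(1)], simp add: M.emeasure_eq_measure)
  moreover have "{v. prefix v n = prefix w n} = cyl (prefix w n)" for w :: "nat \<Rightarrow> nat" and n
    by (auto simp: cyl_def prefix_def)
  ultimately show ?thesis by (simp add: sp)
qed

lemma cyl_prefix_iff: "v \<in> cyl (prefix w n) \<longleftrightarrow> (\<forall>i<n. v i = w i)"
  by (auto simp: cyl_def prefix_def)

lemma cyl_sets [measurable]: "cyl u \<in> sets borel"
proof -
  have "cyl u = (\<lambda>w. prefix w (length u)) -` {u} \<inter> space borel"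
    by (auto simp: cyl_def)
  then show ?thesis
    using measurable_sets[OF prefix_measurable, of "{u}"] by simp
qed

lemma open_contains_cyl:
  assumes "open U" "w \<in> U"
  shows "\<exists>n\<ge>1. \<forall>k\<ge>n. cyl (prefix w k) \<subseteq> U"
proof -
  obtain X where X: "w \<in> Pi\<^sub>E UNIV X" "\<And>i. openin euclidean (X i)" "finite {i. X i \<noteq> topspace euclidean}" "Pi\<^sub>E UNIV X \<subseteq> U"
    using product_topology_open_contains_basis[of "\<lambda>i. euclidean" UNIV U w] assms
    unfolding open_fun_def by auto
  then obtain n where n: "\<And>i. X i \<noteq> UNIV \<Longrightarrow> i < n"
    using finite_nat_set_iff_bounded by auto
  have "v \<in> U" if k: "k \<ge> Suc n" and v: "v \<in> cyl (prefix w k)" for k v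
  proof -
    have "v i \<in> X i" for i
      using n[of i] v k X(1) by (cases "X i = UNIV") (auto simp: cyl_prefix_iff PiE_iff)
    then show ?thesis using X(4) by auto
  qed
  then show ?thesis by (intro exI[of _ "Suc n"]) auto
qed

text \<open>
  Increasing unions of cylinders of one length are convenient because cylinders of equal length are
  disjoint.
\<close>

lemma open_as_cylinders:
  assumes "open U"
  shows "\<exists>I. incseq (\<lambda>n. \<Union>u\<in>I n. cyl u) \<and> (\<Union>n. \<Union>u\<in>I n. cyl u) = U \<and> (\<forall>n. \<forall>u\<in>I n. length u = Suc n)"
proof -
  let ?I = "\<lambda>n. {u. length u = Suc n \<and> cyl u \<subseteq> U}"
  have "incseq (\<lambda>n. \<Union>u\<in>?I n. cyl u)"
  proof (rule incseq_SucI, safe)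
    fix n w u assume w: "w \<in> cyl u" "length u = Suc n" "cyl u \<subseteq> U"
    then have "cyl (prefix w (Suc (Suc n))) \<subseteq> cyl u"
      by (auto simp: cyl_def prefix_def)
    with w show "w \<in> (\<Union>u\<in>?I (Suc n). cyl u)"
      by (intro UN_I[of "prefix w (Suc (Suc n))"]) (auto simp: cyl_prefix_iff, simp add: prefix_def)
  qed
  moreover have "(\<Union>n. \<Union>u\<in>?I n. cyl u) = U"
  proof (intro equalityI subsetI)
    fix w assume "w \<in> U"
    from open_contains_cyl[OF assms this] obtain n where "n \<ge> 1" "cyl (prefix w n) \<subseteq> U" by auto
    then show "w \<in> (\<Union>n. \<Union>u\<in>?I n. cyl u)"
      by (intro UN_I[of "n - 1"] UN_I[of "prefix w n"]) (auto simp: cyl_prefix_iff, simp add: prefix_def)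
  qed auto
  ultimately show ?thesis by (intro exI[of _ ?I]) auto
qed

text \<open>
  An inequality between measures does not define a Dynkin system, so the usual uniqueness argument is
  not available. Open sets are exhausted by disjoint cylinders, and outer regularity passes from open
  sets to Borel sets.
\<close>

lemma emeasure_le_of_cylinders:
  fixes M N :: "(nat \<Rightarrow> nat) measure"
  assumes M: "finite_measure M" "sets M = sets borel" and N: "finite_measure N" "sets N = sets borel"
    and C: "0 \<le> C" and le: "\<And>u. u \<noteq> [] \<Longrightarrow> measure M (cyl u) \<le> C * measure N (cyl u)"
    and E: "E \<in> sets borel"
  shows "emeasure M E \<le> ennreal C * emeasure N E"
proof -
  interpret M: finite_measure M by fact
  interpret N: finite_measure N by fact
  note [measurable_cong] = M(2) N(2)
  have le': "emeasure M (cyl u) \<le> ennreal C * emeasure N (cyl u)" if "u \<noteq> []" for u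
    using le[OF that] C by (simp add: M.emeasure_eq_measure N.emeasure_eq_measure ennreal_mult[symmetric])
  have opn: "emeasure M U \<le> ennreal C * emeasure N U" if "open U" for U
  proof -
    obtain I where I: "incseq (\<lambda>n. \<Union>u\<in>I n. cyl u)" "(\<Union>n. \<Union>u\<in>I n. cyl u) = U"
      "\<And>n u. u \<in> I n \<Longrightarrow> length u = Suc n"
      using open_as_cylinders[OF \<open>open U\<close>] by blast
    have sets: "(\<Union>u\<in>I n. cyl u) \<in> sets borel" for n
      by (rule sets.countable_UN'') auto
    have disj: "disjoint_family_on cyl (I n)" for n
      using I(3) by (auto simp: disjoint_family_on_def cyl_def)
    have "emeasure M (\<Union>u\<in>I n. cyl u) \<le> ennreal C * emeasure N (\<Union>u\<in>I n. cyl u)" for n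
    proof -
      have "emeasure M (\<Union>u\<in>I n. cyl u) = (\<integral>\<^sup>+u. emeasure M (cyl u) \<partial>count_space (I n))"
        by (rule emeasure_UN_countable) (auto simp: M(2) disj)
      also have "\<dots> \<le> (\<integral>\<^sup>+u. ennreal C * emeasure N (cyl u) \<partial>count_space (I n))"
        using I(3) by (intro nn_integral_mono le') fastforce
      also have "\<dots> = ennreal C * (\<integral>\<^sup>+u. emeasure N (cyl u) \<partial>count_space (I n))"
        by (rule nn_integral_cmult) auto
      also have "(\<integral>\<^sup>+u. emeasure N (cyl u) \<partial>count_space (I n)) = emeasure N (\<Union>u\<in>I n. cyl u)"
        by (rule emeasure_UN_countable[symmetric]) (auto simp: N(2) disj)
      finally show ?thesis .
    qed
    also have "ennreal C * emeasure N (\<Union>u\<in>I n. cyl u) \<le> ennreal C * emeasure N U" for n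
      using I(2) that by (intro mult_left_mono emeasure_mono) (auto simp: N(2))
    finally have "(SUP n. emeasure M (\<Union>u\<in>I n. cyl u)) \<le> ennreal C * emeasure N U"
      by (intro SUP_least)
    moreover have "(SUP n. emeasure M (\<Union>u\<in>I n. cyl u)) = emeasure M U"
      by (subst SUP_emeasure_incseq) (use I(1,2) sets in \<open>auto simp: M(2)\<close>)
    ultimately show ?thesis by simp
  qed
  \<comment> \<open>Outer regularity is a theorem about complete metric spaces; sequences of naturals are therefore
     regarded as sequences of reals.\<close>
  define emb :: "(nat \<Rightarrow> nat) \<Rightarrow> nat \<Rightarrow> real" where "emb = (\<lambda>w i. real (w i))"
  have "continuous_on UNIV (\<lambda>w::nat \<Rightarrow> nat. real (w i))" for i
    by (rule continuous_on_compose2[OF _ continuous_on_product_coordinates, of UNIV real]) (auto intro: continuous_on_discrete)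
  then have cont: "continuous_on UNIV emb"
    unfolding emb_def by (intro continuous_on_coordinatewise_then_product) auto
  then have emb [measurable]: "emb \<in> borel_measurable borel"
    by (rule borel_measurable_continuous_onI)
  define E' :: "(nat \<Rightarrow> real) set" where "E' = (\<lambda>v i. nat \<lfloor>v i\<rfloor>) -` E"
  have "(\<lambda>(v::nat \<Rightarrow> real) i. nat \<lfloor>v i\<rfloor>) \<in> borel_measurable borel"
    by (rule measurable_coordinatewise_then_product) measurable
  from measurable_sets[OF this E] have E': "E' \<in> sets borel"
    by (simp add: E'_def)
  have emb_E: "emb -` E' = E"
    by (simp add: emb_def E'_def vimage_def)
  define N' where "N' = distr N borel emb"
  have setsN': "sets N' = sets borel" by (simp add: N'_def)
  have N': "emeasure N' B = emeasure N (emb -` B)" if "B \<in> sets borel" for B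
    using that sets_eq_imp_space_eq[OF N(2)] by (simp add: N'_def emeasure_distr)
  have "measure M E \<le> C * measure N E + \<delta>" if "0 < \<delta>" for \<delta>
  proof -
    have fin: "emeasure N' (space N') \<noteq> \<infinity>"
      by (simp add: N'_def emeasure_distr)
    have "(INF U\<in>{U. E' \<subseteq> U \<and> open U}. emeasure N' U) = emeasure N E"
      using outer_regular[OF setsN' fin E'] N'[OF E'] emb_E by simp
    also have "\<dots> < ennreal (measure N E + \<delta> / (C + 1))"
      using C that by (simp add: N.emeasure_eq_measure ennreal_less_iff)
    finally obtain U' where U': "E' \<subseteq> U'" "open U'" "emeasure N' U' < ennreal (measure N E + \<delta> / (C + 1))"
      by (auto simp: INF_less_iff)
    define U where "U = emb -` U'"
    have U: "E \<subseteq> U" "open U" "emeasure N U < ennreal (measure N E + \<delta> / (C + 1))"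
      using U' emb_E N'[of U'] open_vimage[OF U'(2) cont] by (auto simp: U_def)
    have "measure M E \<le> measure M U"
      using U by (intro M.finite_measure_mono) (auto simp: M(2))
    also have "\<dots> \<le> C * measure N U"
      using opn[OF U(2)] C by (simp add: M.emeasure_eq_measure N.emeasure_eq_measure ennreal_mult[symmetric])
    also have "\<dots> \<le> C * (measure N E + \<delta> / (C + 1))"
      using U(3) C by (intro mult_left_mono) (auto simp: N.emeasure_eq_measure ennreal_less_iff)
    also have "\<dots> = C * measure N E + \<delta> * (C / (C + 1))"
      by (simp add: algebra_simps)
    also have "\<delta> * (C / (C + 1)) \<le> \<delta> * 1"
      using C that by (intro mult_left_mono) auto
    finally show ?thesis by simp
  qed
  then have "measure M E \<le> C * measure N E"
    by (rule field_le_epsilon)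
  then show ?thesis
    using C by (simp add: M.emeasure_eq_measure N.emeasure_eq_measure ennreal_mult[symmetric])
qed

text \<open>
  The mesh is a quarter of the radius \<open>2 (1/2)\<^sup>n\<close> of the balls with which the cells are compared: a cell
  then lies in the ball around any of its points, and the ball meets at most \<open>9\<^sup>2\<close> cells.
\<close>

definition grid :: "nat \<Rightarrow> real^2 \<Rightarrow> int \<times> int" where
  "grid n x = (\<lfloor>2 ^ Suc n * x $ 1\<rfloor>, \<lfloor>2 ^ Suc n * x $ 2\<rfloor>)"

lemma grid_measurable [measurable]: "grid n \<in> measurable borel (count_space UNIV)"
proof -
  have "(\<lambda>x::real^2. \<lfloor>2 ^ Suc n * x $ i\<rfloor>) \<in> measurable borel (count_space UNIV)" for i
    by measurable
  then show ?thesis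
    unfolding grid_def by measurable
qed

lemma norm2_le: "norm (x::real^2) \<le> \<bar>x $ 1\<bar> + \<bar>x $ 2\<bar>"
  using norm_le_l1_cart[of x] by (simp add: sum_2)

lemma grid_cell_subset_ball: "grid n y = grid n x \<Longrightarrow> y \<in> ball x (2 * (1/2) ^ n)"
proof -
  assume *: "grid n y = grid n x"
  have "\<bar>y $ i - x $ i\<bar> < (1/2) ^ Suc n" if "\<lfloor>2 ^ Suc n * y $ i\<rfloor> = \<lfloor>2 ^ Suc n * x $ i\<rfloor>" for i
  proof -
    have "\<bar>2 ^ Suc n * y $ i - 2 ^ Suc n * x $ i\<bar> < 1"
      using that by linarith
    also have "\<bar>2 ^ Suc n * y $ i - 2 ^ Suc n * x $ i\<bar> = 2 ^ Suc n * \<bar>y $ i - x $ i\<bar>"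
      by (simp add: right_diff_distrib[symmetric] abs_mult)
    finally show ?thesis by (simp add: power_one_over field_simps)
  qed
  from this[of 1] this[of 2] * have "\<bar>y $ 1 - x $ 1\<bar> < (1/2) ^ Suc n" "\<bar>y $ 2 - x $ 2\<bar> < (1/2) ^ Suc n"
    by (auto simp: grid_def)
  moreover have "dist x y \<le> \<bar>y $ 1 - x $ 1\<bar> + \<bar>y $ 2 - x $ 2\<bar>"
    using norm2_le[of "y - x"] by (simp add: dist_norm norm_minus_commute)
  moreover have "0 < (1/2::real) ^ n" "(1/2::real) ^ Suc n = (1/2) ^ n / 2" by simp_all
  ultimately have "dist x y < 2 * (1/2) ^ n" by linarith
  then show ?thesis by simp
qed

lemma floor_diff_le_4:
  fixes x y :: real
  assumes "\<bar>y - x\<bar> < 4" shows "\<lfloor>y\<rfloor> - \<lfloor>x\<rfloor> \<in> {-4..4}"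
  using assms by (auto simp: ) linarith+

lemma ball_subset_grid_cells:
  assumes "y \<in> ball x (2 * (1/2) ^ n)"
  shows "grid n y - grid n x \<in> {-4..4} \<times> {-4..4}"
proof -
  have "\<lfloor>2 ^ Suc n * y $ i\<rfloor> - \<lfloor>2 ^ Suc n * x $ i\<rfloor> \<in> {-4..4}" for i
  proof (rule floor_diff_le_4)
    have "\<bar>y $ i - x $ i\<bar> \<le> dist x y"
      using component_le_norm_cart[of "y - x" i] by (simp add: dist_norm norm_minus_commute)
    also have "\<dots> < 2 * (1/2) ^ n" using assms by simp
    finally have "2 ^ Suc n * \<bar>y $ i - x $ i\<bar> < 2 ^ Suc n * (2 * (1/2) ^ n)"
      by (intro mult_strict_left_mono) auto
    also have "\<dots> = 4" by (simp add: power_one_over)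
    finally show "\<bar>2 ^ Suc n * y $ i - 2 ^ Suc n * x $ i\<bar> < 4"
      by (simp add: right_diff_distrib[symmetric] abs_mult)
  qed
  from this[of 1] this[of 2] show ?thesis
    unfolding grid_def by (auto simp: minus_prod_def)
qed

text \<open>
  Together with the trivial bound coming from domination, this says that two measures have the same
  local dimension almost everywhere for the smaller one. Counting cells replaces the Besicovitch
  covering theorem, at the price of the subexponential factor.
\<close>

lemma AE_ball_ratio:
  fixes M N :: "(real^2) measure"
  assumes M: "finite_measure M" "sets M = sets borel" and N: "finite_measure N" "sets N = sets borel"
    and eps: "0 < \<epsilon>"
  shows "AE x in N. eventually (\<lambda>n. exp (- \<epsilon> * real n) * measure M (ball x (2 * (1/2) ^ n))
            \<le> measure N (ball x (2 * (1/2) ^ n))) sequentially"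
proof -
  interpret M: finite_measure M by fact
  interpret N: finite_measure N by fact
  have sp: "space M = UNIV" "space N = UNIV"
    using sets_eq_imp_space_eq[OF M(2)] sets_eq_imp_space_eq[OF N(2)] by auto
  note [measurable_cong] = M(2) N(2)
  have meas: "grid n \<in> measurable M (count_space UNIV)" "grid n \<in> measurable N (count_space UNIV)" for n
    by measurable
  define J where "J = {-4..4::int} \<times> {-4..4::int}"
  define fat where "fat n c = {y. grid n y - c \<in> J}" for n c
  have cell: "{y. grid n y = c} \<in> sets borel" for n c
    using measurable_sets[OF grid_measurable[of n], of "{c}"] by (simp add: vimage_def)
  have fat: "(\<integral>\<^sup>+c. emeasure M (fat n c) \<partial>count_space UNIV) \<le> ennreal (real (card J) * measure M UNIV)" for n
  proof -
    have "emeasure M (fat n c) \<le> (\<Sum>j\<in>J. emeasure M {y. grid n y = c + j})" for c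
    proof -
      have "fat n c = (\<Union>j\<in>J. {y. grid n y = c + j})"
        by (auto simp: fat_def)
      moreover have "(\<lambda>j. {y. grid n y = c + j}) ` J \<subseteq> sets M" "finite J"
        using cell by (auto simp: M(2) J_def)
      ultimately show ?thesis
        using emeasure_subadditive_finite[of J "\<lambda>j. {y. grid n y = c + j}" M] by simp
    qed
    then have "(\<integral>\<^sup>+c. emeasure M (fat n c) \<partial>count_space UNIV)
        \<le> (\<integral>\<^sup>+c. (\<Sum>j\<in>J. emeasure M {y. grid n y = c + j}) \<partial>count_space UNIV)"
      by (intro nn_integral_mono) auto
    also have "\<dots> = (\<Sum>j\<in>J. (\<integral>\<^sup>+c. emeasure M {y. grid n y = c + j} \<partial>count_space UNIV))"
      by (rule nn_integral_sum) auto
    also have "\<dots> = (\<Sum>j\<in>J. emeasure M UNIV)"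
    proof (rule sum.cong[OF refl])
      fix j
      have "bij_betw (\<lambda>c::int \<times> int. c + j) UNIV UNIV"
        by (rule bij_betwI[where g = "\<lambda>c. c - j"]) auto
      then have "(\<integral>\<^sup>+c. emeasure M {y. grid n y = c + j} \<partial>count_space UNIV)
            = (\<integral>\<^sup>+c. emeasure M {y. grid n y = c} \<partial>count_space UNIV)"
        by (rule nn_integral_bij_count_space)
      also have "\<dots> = emeasure M UNIV"
        using nn_integral_cells[OF meas(1), of n] by (simp add: sp)
      finally show "(\<integral>\<^sup>+c. emeasure M {y. grid n y = c + j} \<partial>count_space UNIV) = emeasure M UNIV" .
    qed
    also have "\<dots> = ennreal (real (card J) * measure M UNIV)"
      by (simp add: M.emeasure_eq_measure ennreal_mult ennreal_of_nat_eq_real_of_nat)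
    finally show ?thesis .
  qed
  have "AE x in N. eventually (\<lambda>n. exp (- \<epsilon> * real n) * measure M (fat n (grid n x))
            \<le> measure N {y \<in> space N. grid n y = grid n x}) sequentially"
    by (rule AE_countable_cells[OF M(1) N(1) meas(2) fat eps])
  then show ?thesis
  proof eventually_elim
    case (elim x)
    then show ?case
    proof eventually_elim
      case (elim n)
      have "exp (- \<epsilon> * real n) * measure M (ball x (2 * (1/2) ^ n)) \<le> exp (- \<epsilon> * real n) * measure M (fat n (grid n x))"
      proof (intro mult_left_mono M.finite_measure_mono)
        show "ball x (2 * (1/2) ^ n) \<subseteq> fat n (grid n x)"
          using ball_subset_grid_cells by (auto simp: fat_def J_def)
        have "fat n (grid n x) = grid n -` {c. c - grid n x \<in> J} \<inter> space borel"
          by (auto simp: fat_def)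
        then show "fat n (grid n x) \<in> sets M"
          using measurable_sets[OF grid_measurable, of "{c. c - grid n x \<in> J}" n] by (simp add: M(2))
      qed auto
      also note elim
      also have "measure N {y \<in> space N. grid n y = grid n x} \<le> measure N (ball x (2 * (1/2) ^ n))"
        by (intro N.finite_measure_mono) (use grid_cell_subset_ball in \<open>auto simp: N(2)\<close>)
      finally show ?case .
    qed
  qed
qed

section \<open>Words and shifts\<close>

lemma prefix_Suc: "prefix w (Suc n) = prefix w n @ [w n]"
  by (simp add: prefix_def)

lemma prefix_Cons: "prefix w (Suc n) = w 0 # prefix (shift w) n"
  by (simp add: prefix_def shift_def map_upt_Suc del: upt_Suc)

lemma length_prefix [simp]: "length (prefix w n) = n"
  by (simp add: prefix_def)

lemma prefix_0 [simp]: "prefix w 0 = []"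
  by (simp add: prefix_def)

lemma shift_funpow: "(shift ^^ n) w = (\<lambda>k. w (n + k))"
  by (induction n arbitrary: w) (auto simp: shift_def)

lemma prefix_add: "prefix w (n + k) = prefix w n @ prefix ((shift ^^ n) w) k"
  by (rule nth_equalityI) (auto simp: prefix_def nth_append shift_funpow)


lemma shift_funpow_measurable [measurable]: "(shift ^^ n) \<in> borel_measurable borel"
proof -
  have "(shift ^^ n) = (\<lambda>w k. w (n + k))" by (auto simp: shift_funpow)
  then show ?thesis using letterwise_measurable[of "\<lambda>n i. i" "\<lambda>k. n + k"] by simp
qed

lemma cyl_append: "cyl u \<inter> (shift ^^ length u) -` cyl v = cyl (u @ v)"
  by (auto simp: cyl_def prefix_add)

text \<open>
  Comparability of a measure with its image under prepending \<open>u\<close> need only be checked on cylinders.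
\<close>

lemma
  fixes Q :: "(nat \<Rightarrow> nat) measure"
  assumes Q: "finite_measure Q" "sets Q = sets borel" and c: "0 \<le> c" and E: "E \<in> sets borel"
  shows measure_after_prefix_le:
      "(\<And>v. v \<noteq> [] \<Longrightarrow> measure Q (cyl (u @ v)) \<le> c * measure Q (cyl v)) \<Longrightarrow>
        measure Q (cyl u \<inter> (shift ^^ length u) -` E) \<le> c * measure Q E"
    and measure_after_prefix_ge:
      "(\<And>v. v \<noteq> [] \<Longrightarrow> measure Q (cyl v) \<le> c * measure Q (cyl (u @ v))) \<Longrightarrow>
        measure Q E \<le> c * measure Q (cyl u \<inter> (shift ^^ length u) -` E)"
proof -
  interpret Q: finite_measure Q by fact
  note [measurable_cong] = Q(2)
  have sp: "space Q = UNIV" using sets_eq_imp_space_eq[OF Q(2)] by simp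
  have cylQ: "cyl u \<in> sets Q" by (simp add: Q(2))
  define A where "A = distr (restrict_space Q (cyl u)) borel (shift ^^ length u)"
  have meas: "(shift ^^ length u) \<in> measurable (restrict_space Q (cyl u)) borel"
    by (rule measurable_restrict_space1) measurable
  have A: "finite_measure A" "sets A = sets borel"
  proof -
    have "finite_measure (restrict_space Q (cyl u))"
      using cylQ sp by (intro finite_measureI) (simp add: emeasure_restrict_space space_restrict_space)
    then show "finite_measure A" unfolding A_def by (rule finite_measure.finite_measure_distr[OF _ meas])
  qed (simp add: A_def)
  have A_eq: "measure A B = measure Q (cyl u \<inter> (shift ^^ length u) -` B)" if "B \<in> sets borel" for B
  proof -
    have "measure A B = measure (restrict_space Q (cyl u)) ((shift ^^ length u) -` B \<inter> cyl u)"
      unfolding A_def using that meas by (subst measure_distr) (auto simp: space_restrict_space sp)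
    also have "\<dots> = measure Q ((shift ^^ length u) -` B \<inter> cyl u)"
      using cylQ sp by (intro measure_restrict_space) auto
    finally show ?thesis by (simp add: Int_commute)
  qed
  have to_real: "measure M1 E \<le> c * measure M2 E" if "emeasure M1 E \<le> ennreal c * emeasure M2 E"
    "finite_measure M1" "finite_measure M2" for M1 M2 :: "(nat \<Rightarrow> nat) measure"
    using that c by (simp add: finite_measure.emeasure_eq_measure ennreal_mult[symmetric])
  show "measure Q (cyl u \<inter> (shift ^^ length u) -` E) \<le> c * measure Q E"
    if "\<And>v. v \<noteq> [] \<Longrightarrow> measure Q (cyl (u @ v)) \<le> c * measure Q (cyl v)"
    using to_real[OF emeasure_le_of_cylinders[OF A Q c _ E] A(1) Q(1)] that
    by (simp add: A_eq E cyl_append)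
  show "measure Q E \<le> c * measure Q (cyl u \<inter> (shift ^^ length u) -` E)"
    if "\<And>v. v \<noteq> [] \<Longrightarrow> measure Q (cyl v) \<le> c * measure Q (cyl (u @ v))"
    using to_real[OF emeasure_le_of_cylinders[OF Q A c _ E] Q(1) A(1)] that
    by (simp add: A_eq E cyl_append)
qed


section \<open>Recurrence without long gaps\<close>

text \<open>
  Write \<open>D i\<close> for the points of \<open>K\<close> that do not return within \<open>i\<close> steps. Splitting the space according to
  the last visit before time \<open>N\<close> shows that the measures of the \<open>D i\<close> have sum at most the total mass. So
  the measures of \<open>T\<^sup>-\<^sup>k (D (k div q))\<close> are summable as well, and by Borel-Cantelli only finitely many
  gaps that start at time \<open>k\<close> exceed \<open>k / q\<close>.
\<close>

lemma AE_return_gaps: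
  fixes M :: "'a measure"
  assumes M: "finite_measure M" and T [measurable]: "T \<in> measurable M M"
    and inv: "\<And>E. E \<in> sets M \<Longrightarrow> emeasure M (T -` E \<inter> space M) = emeasure M E"
    and K [measurable]: "K \<in> sets M" and q: "0 < q"
  shows "AE x in M. x \<in> K \<longrightarrow> eventually (\<lambda>n. \<exists>k k'. k \<le> n \<and> n < k' \<and> k' \<le> k + k div q \<and>
            (T ^^ k) x \<in> K \<and> (T ^^ k') x \<in> K) sequentially"
proof -
  interpret finite_measure M by fact
  have Tn [measurable]: "(T ^^ n) \<in> measurable M M" for n
    by (rule measurable_compose_n) (rule T)
  have invn: "emeasure M ((T ^^ n) -` E \<inter> space M) = emeasure M E" if [measurable]: "E \<in> sets M" for n E
  proof (induction n)
    case (Suc n)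
    have "(T ^^ Suc n) -` E \<inter> space M = T -` ((T ^^ n) -` E \<inter> space M) \<inter> space M"
      using measurable_space[OF T] by (auto simp: funpow_Suc_right simp del: funpow.simps)
    moreover have "(T ^^ n) -` E \<inter> space M \<in> sets M" by measurable
    ultimately show ?case using Suc inv[of "(T ^^ n) -` E \<inter> space M"] by (simp only:)
  qed (use sets.sets_into_space[OF that] in \<open>auto intro!: arg_cong[where f = "emeasure M"]\<close>)
  define D where "D i = {x \<in> space M. x \<in> K \<and> (\<forall>j\<in>{1..i}. (T ^^ j) x \<notin> K)}" for i
  have D [measurable]: "D i \<in> sets M" for i
    unfolding D_def by measurable
  \<comment> \<open>The set with index \<open>i\<close> below consists of the points whose last visit up to time \<open>N\<close> is at \<open>N - i\<close>.\<close>
  have sum_D: "(\<Sum>i<N. measure M (D i)) \<le> measure M (space M)" for N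
  proof -
    let ?B = "\<lambda>i. (T ^^ (N - i)) -` D i \<inter> space M"
    have ne: "?B i \<inter> ?B i' = {}" if "i < i'" "i' < N" for i i'
    proof (rule equals0I)
      fix x assume x: "x \<in> ?B i \<inter> ?B i'"
      have "(T ^^ (i' - i)) ((T ^^ (N - i')) x) = (T ^^ (N - i)) x"
        using that by (simp add: funpow_add[symmetric, unfolded comp_def, THEN fun_cong])
      moreover have "(T ^^ (N - i)) x \<in> K" and none: "\<forall>j\<in>{1..i'}. (T ^^ j) ((T ^^ (N - i')) x) \<notin> K"
        using x by (simp_all add: D_def)
      ultimately have "(T ^^ (i' - i)) ((T ^^ (N - i')) x) \<in> K" by (simp only:)
      moreover have "i' - i \<in> {1..i'}" using that by auto
      ultimately show False using none by blast
    qed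
    have disj: "disjoint_family_on ?B {..<N}"
      unfolding disjoint_family_on_def using ne by (metis Int_commute lessThan_iff linorder_neqE_nat)
    have "(\<Sum>i<N. measure M (D i)) = (\<Sum>i<N. measure M (?B i))"
      by (intro sum.cong refl) (simp add: measure_def invn)
    also have "\<dots> = measure M (\<Union>i<N. ?B i)"
      by (rule finite_measure_finite_Union[symmetric]) (use disj in auto)
    also have "\<dots> \<le> measure M (space M)"
      by (rule bounded_measure)
    finally show ?thesis .
  qed
  have summ: "summable (\<lambda>i. measure M (D i))"
    by (rule summableI_nonneg_bounded[OF _ sum_D]) simp
  have "(\<Sum>k<N. measure M (D (k div q))) \<le> real q * measure M (space M)" for N
  proof -
    have "(\<Sum>k<N. measure M (D (k div q))) \<le> (\<Sum>k<N * q. measure M (D (k div q)))"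
      using q by (intro sum_mono2) auto
    also have "\<dots> = (\<Sum>m<N. \<Sum>k=m*q..<m*q+q. measure M (D (k div q)))"
      by (rule sum.nat_group[symmetric])
    also have "\<dots> = (\<Sum>m<N. \<Sum>k=m*q..<m*q+q. measure M (D m))"
    proof (intro sum.cong refl)
      fix m k assume "k \<in> {m*q..<m*q+q}"
      then have "k div q = m" by (intro div_nat_eqI) (auto simp: mult.commute)
      then show "measure M (D (k div q)) = measure M (D m)" by simp
    qed
    also have "\<dots> = real q * (\<Sum>m<N. measure M (D m))"
      by (simp add: sum_distrib_left)
    also have "\<dots> \<le> real q * measure M (space M)"
      by (intro mult_left_mono sum_D) auto
    finally show ?thesis .
  qed
  then have "summable (\<lambda>k. measure M (D (k div q)))"
    by (intro summableI_nonneg_bounded) auto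
  then have "summable (\<lambda>k. measure M ((T ^^ k) -` D (k div q) \<inter> space M))"
    by (simp add: measure_def invn)
  then have AE1: "AE x in M. eventually (\<lambda>k. x \<in> space M - ((T ^^ k) -` D (k div q) \<inter> space M)) sequentially"
    by (intro borel_cantelli_AE1) (auto simp: less_top[symmetric])
  \<comment> \<open>Poincare recurrence: it guarantees that there are visits after the last exceptional gap.\<close>
  have AE2: "AE x in M. \<forall>k. (T ^^ k) x \<notin> (\<Inter>i. D i)"
  proof (subst AE_all_countable, intro allI)
    fix k
    have "emeasure M (\<Inter>i. D i) \<le> ennreal \<delta>" if "0 < \<delta>" for \<delta>
    proof -
      have "eventually (\<lambda>i. measure M (D i) < \<delta>) sequentially"
        using order_tendstoD(2)[OF summable_LIMSEQ_zero[OF summ] that] .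
      then obtain i where "measure M (D i) < \<delta>" by (auto simp: eventually_sequentially)
      moreover have "emeasure M (\<Inter>i. D i) \<le> emeasure M (D i)"
        by (intro emeasure_mono) auto
      ultimately show ?thesis
        by (metis emeasure_eq_measure ennreal_leI less_imp_le order_trans)
    qed
    then have "emeasure M (\<Inter>i. D i) \<le> 0 + ennreal \<delta>" if "0 < \<delta>" for \<delta>
      using that by simp
    then have "emeasure M (\<Inter>i. D i) \<le> 0"
      by (rule ennreal_le_epsilon)
    then have "(T ^^ k) -` (\<Inter>i. D i) \<inter> space M \<in> null_sets M"
      by (auto simp: null_sets_def invn)
    then show "AE x in M. (T ^^ k) x \<notin> (\<Inter>i. D i)"
      by (rule AE_I'[OF _ ]) auto
  qed
  from AE1 AE2 AE_space show ?thesis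
  proof eventually_elim
    case (elim x)
    show ?case
    proof
      assume xK: "x \<in> K"
      have sp: "(T ^^ n) x \<in> space M" for n
        using measurable_space[OF Tn elim(3)] .
      obtain k0 where k0: "\<And>k. k \<ge> k0 \<Longrightarrow> (T ^^ k) x \<notin> D (k div q)"
        using elim(1,3) by (auto simp: eventually_sequentially)
      have ret: "\<exists>k'>k. (T ^^ k') x \<in> K" if kK: "(T ^^ k) x \<in> K" for k
      proof -
        obtain i where "(T ^^ k) x \<notin> D i" using elim(2) by auto
        then obtain j where "j \<ge> 1" "(T ^^ j) ((T ^^ k) x) \<in> K"
          using kK sp by (auto simp: D_def)
        then show ?thesis
          by (intro exI[of _ "j + k"]) (auto simp: funpow_add)
      qed
      have "\<exists>k\<ge>n. (T ^^ k) x \<in> K" for n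
      proof (induction n)
        case 0
        show ?case using xK by (intro exI[of _ 0]) auto
      next
        case (Suc n)
        then show ?case using ret by (metis Suc_leI le_less_trans)
      qed
      then obtain k1 where k1: "k1 \<ge> k0" "(T ^^ k1) x \<in> K" by blast
      have "\<exists>k k'. k \<le> n \<and> n < k' \<and> k' \<le> k + k div q \<and> (T ^^ k) x \<in> K \<and> (T ^^ k') x \<in> K" if n: "n \<ge> k1" for n
      proof -
        define k where "k = Max {k. k \<le> n \<and> (T ^^ k) x \<in> K}"
        have fin: "finite {k. k \<le> n \<and> (T ^^ k) x \<in> K}" by simp
        have k: "k \<le> n" "(T ^^ k) x \<in> K"
        proof -
          have "k \<in> {k. k \<le> n \<and> (T ^^ k) x \<in> K}"
            unfolding k_def using k1 n by (intro Max_in fin) blast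
          then show "k \<le> n" "(T ^^ k) x \<in> K" by auto
        qed
        have kmax: "k' \<le> k" if "k' \<le> n" "(T ^^ k') x \<in> K" for k'
          using that by (auto simp: k_def)
        have "k \<ge> k0" using kmax[OF n k1(2)] k1(1) by simp
        then have "(T ^^ k) x \<notin> D (k div q)" by (rule k0)
        then obtain j where j: "1 \<le> j" "j \<le> k div q" "(T ^^ j) ((T ^^ k) x) \<in> K"
          using k(2) sp by (auto simp: D_def)
        have "(T ^^ (j + k)) x \<in> K" using j(3) by (simp add: funpow_add)
        moreover from this have "n < j + k" using kmax[of "j + k"] j(1) by force
        ultimately show ?thesis
          using j k by (intro exI[of _ k] exI[of _ "j + k"]) auto
      qed
      then show "eventually (\<lambda>n. \<exists>k k'. k \<le> n \<and> n < k' \<and> k' \<le> k + k div q \<and>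
            (T ^^ k) x \<in> K \<and> (T ^^ k') x \<in> K) sequentially"
        by (auto simp: eventually_sequentially)
    qed
  qed
qed

section \<open>Limits along sparse scales and local dimension\<close>

text \<open>
  A monotone function is controlled at all scales by its values at the times in \<open>V\<close>, since consecutive
  times have ratio at most \<open>1 + \<epsilon>\<close>. Lower bounds are taken at the scales \<open>R1 n\<close> and upper bounds at
  the scales \<open>R2 n\<close>; both have the same exponential rate. The set \<open>V\<close> may depend on \<open>\<epsilon>\<close>, because the
  set of good points whose visits it records does.
\<close>

lemma limit_along_sparse_scales:
  fixes g :: "real \<Rightarrow> real" and R1 R2 :: "nat \<Rightarrow> real"
  assumes mono: "\<And>r r'. 0 < r \<Longrightarrow> r \<le> r' \<Longrightarrow> g r' \<le> g r"
    and pos: "\<And>n. 0 < R1 n" "\<And>n. 0 < R2 n"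
    and lim1: "(\<lambda>n. - ln (R1 n) / real n) \<longlonglongrightarrow> \<theta>"
    and lim2: "(\<lambda>n. - ln (R2 n) / real n) \<longlonglongrightarrow> \<theta>"
    and chi: "0 < \<theta>" and kappa: "0 \<le> \<kappa>"
    and sparse: "\<And>\<epsilon>. 0 < \<epsilon> \<Longrightarrow> \<exists>V.
        eventually (\<lambda>n. \<exists>k\<in>V. \<exists>k'\<in>V. k \<le> n \<and> n < k' \<and> real k' \<le> (1 + \<epsilon>) * real k) sequentially \<and>
        eventually (\<lambda>n. n \<in> V \<longrightarrow> (\<kappa> - \<epsilon>) * real n \<le> g (R1 n) \<and> g (R2 n) \<le> (\<kappa> + \<epsilon>) * real n) sequentially"
  shows "((\<lambda>r. g r / (- ln r)) \<longlongrightarrow> \<kappa> / \<theta>) (at_right 0)"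
proof -
  have L_top: "filterlim (\<lambda>r::real. - ln r) at_top (at_right 0)"
    using ln_at_0 by (simp add: filterlim_uminus_at_top)
  define lo where "lo \<epsilon> L = \<kappa> / (1 + \<epsilon>) * (1 / (\<theta> + \<epsilon>) - 1 / L) - \<epsilon> / (\<theta> + \<epsilon>)" for \<epsilon> L :: real
  define up where "up \<epsilon> L = (\<kappa> + \<epsilon>) * (1 + \<epsilon>) * (1 / (\<theta> - \<epsilon>) + 1 / L)" for \<epsilon> L :: real
  have main: "eventually (\<lambda>r. lo \<epsilon> (- ln r) \<le> g r / (- ln r) \<and> g r / (- ln r) \<le> up \<epsilon> (- ln r)) (at_right 0)"
    if eps: "0 < \<epsilon>" "\<epsilon> < \<theta>" for \<epsilon>
  proof -
    obtain V where V: "eventually (\<lambda>n. \<exists>k\<in>V. \<exists>k'\<in>V. k \<le> n \<and> n < k' \<and> real k' \<le> (1 + \<epsilon>) * real k) sequentially"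
      "eventually (\<lambda>n. n \<in> V \<longrightarrow> (\<kappa> - \<epsilon>) * real n \<le> g (R1 n) \<and> g (R2 n) \<le> (\<kappa> + \<epsilon>) * real n) sequentially"
      using sparse[OF eps(1)] by blast
    have e1: "eventually (\<lambda>n. - ln (R1 n) / real n < \<theta> + \<epsilon>) sequentially"
      using eps by (intro order_tendstoD(2)[OF lim1]) auto
    have e2: "eventually (\<lambda>n. \<theta> - \<epsilon> < - ln (R2 n) / real n) sequentially"
      using eps by (intro order_tendstoD(1)[OF lim2]) auto
    have "eventually (\<lambda>n. 0 < n \<and> - ln (R1 n) / real n < \<theta> + \<epsilon> \<and> \<theta> - \<epsilon> < - ln (R2 n) / real n \<and>
       (n \<in> V \<longrightarrow> (\<kappa> - \<epsilon>) * real n \<le> g (R1 n) \<and> g (R2 n) \<le> (\<kappa> + \<epsilon>) * real n)) sequentially"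
      by (intro eventually_conj e1 e2 V(2) eventually_gt_at_top)
    then obtain N1 where N1: "\<And>n. n \<ge> N1 \<Longrightarrow> 0 < n" "\<And>n. n \<ge> N1 \<Longrightarrow> - ln (R1 n) / real n < \<theta> + \<epsilon>"
      "\<And>n. n \<ge> N1 \<Longrightarrow> \<theta> - \<epsilon> < - ln (R2 n) / real n"
      "\<And>n. n \<ge> N1 \<Longrightarrow> n \<in> V \<Longrightarrow> (\<kappa> - \<epsilon>) * real n \<le> g (R1 n)"
      "\<And>n. n \<ge> N1 \<Longrightarrow> n \<in> V \<Longrightarrow> g (R2 n) \<le> (\<kappa> + \<epsilon>) * real n"
      unfolding eventually_sequentially by blast
    obtain N0 where N0: "\<And>n. n \<ge> N0 \<Longrightarrow> \<exists>k\<in>V. \<exists>k'\<in>V. k \<le> n \<and> n < k' \<and> real k' \<le> (1 + \<epsilon>) * real k"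
      using V(1) unfolding eventually_sequentially by blast
    define N where "N = max (real N0) ((1 + \<epsilon>) * real N1) + 1"
    have NN: "N \<ge> real N0 + 1" "N \<ge> (1 + \<epsilon>) * real N1 + 1" by (auto simp: N_def)
    have visits: "\<exists>k k'. k \<in> V \<and> k' \<in> V \<and> k \<le> n \<and> n < k' \<and> real k' \<le> (1 + \<epsilon>) * real k \<and> N1 \<le> k"
      if n: "real n \<ge> N - 1" for n
    proof -
      have "n \<ge> N0" using n NN(1) by simp
      from N0[OF this] obtain k k' where k: "k \<in> V" "k' \<in> V" "k \<le> n" "n < k'" "real k' \<le> (1 + \<epsilon>) * real k" by blast
      have "(1 + \<epsilon>) * real N1 \<le> real n" using n NN(2) by simp
      also have "real n \<le> (1 + \<epsilon>) * real k" using k(4,5) by linarith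
      finally have "N1 \<le> k" using eps by simp
      with k show ?thesis by blast
    qed
    have "eventually (\<lambda>r. - ln r \<ge> (\<theta> + \<epsilon>) * (N + 1)) (at_right 0)"
      using L_top by (auto simp: filterlim_at_top)
    moreover have "eventually (\<lambda>r::real. 0 < r) (at_right 0)"
      by (simp add: eventually_at_filter)
    ultimately show ?thesis
    proof eventually_elim
      case (elim r)
      define L where "L = - ln r"
      have N_pos: "N \<ge> 1" using NN(1) by linarith
      have Lge: "L \<ge> (\<theta> + \<epsilon>) * (N + 1)" using elim by (simp add: L_def)
      then have LN: "L / (\<theta> + \<epsilon>) \<ge> N + 1" using eps chi by (simp add: field_simps)
      have Lpos: "0 < L"
        using Lge eps chi N_pos by (smt (verit) mult_pos_pos)
      have "lo \<epsilon> L \<le> g r / L"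
      proof -
        \<comment> \<open>the last time at which the scale \<open>R1\<close> is certainly not below \<open>r\<close>\<close>
        define n where "n = nat \<lfloor>L / (\<theta> + \<epsilon>)\<rfloor>"
        have n: "real n \<le> L / (\<theta> + \<epsilon>)" "real n \<ge> L / (\<theta> + \<epsilon>) - 1"
          unfolding n_def using LN N_pos by linarith+
        obtain k k' where k: "k \<in> V" "k' \<in> V" "k \<le> n" "n < k'" "real k' \<le> (1 + \<epsilon>) * real k" "N1 \<le> k"
          using visits[of n] n LN by force
        have "- ln (R1 k) < (\<theta> + \<epsilon>) * real k"
          using N1(1,2)[OF k(6)] by (simp add: field_simps)
        also have "\<dots> \<le> (\<theta> + \<epsilon>) * real n" using k(3) eps chi by (intro mult_left_mono) auto
        also have "\<dots> \<le> L" using n(1) eps chi by (simp add: field_simps)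
        finally have "r \<le> R1 k"
          using elim pos(1)[of k] by (simp add: L_def)
        then have "g (R1 k) \<le> g r" using mono elim by blast
        with N1(4)[OF k(6) k(1)] have "(\<kappa> - \<epsilon>) * real k \<le> g r" by linarith
        moreover have "\<kappa> / (1 + \<epsilon>) * real n - \<epsilon> * real n \<le> (\<kappa> - \<epsilon>) * real k"
        proof -
          have "real n / (1 + \<epsilon>) \<le> real k" using k(4,5) eps by (simp add: field_simps) 
          then have "\<kappa> * (real n / (1 + \<epsilon>)) \<le> \<kappa> * real k" using kappa by (rule mult_left_mono)
          moreover have "\<epsilon> * real k \<le> \<epsilon> * real n" using k(3) eps by (intro mult_left_mono) auto
          ultimately show ?thesis by (simp add: algebra_simps)
        qed
        moreover have "lo \<epsilon> L * L \<le> \<kappa> / (1 + \<epsilon>) * real n - \<epsilon> * real n"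
        proof -
          have "\<kappa> / (1 + \<epsilon>) * (L / (\<theta> + \<epsilon>) - 1) \<le> \<kappa> / (1 + \<epsilon>) * real n"
            using n kappa eps by (intro mult_left_mono) auto
          moreover have "\<epsilon> * real n \<le> \<epsilon> * (L / (\<theta> + \<epsilon>))" using n eps by (intro mult_left_mono) auto
          moreover have "lo \<epsilon> L * L = \<kappa> / (1 + \<epsilon>) * (L / (\<theta> + \<epsilon>) - 1) - \<epsilon> * (L / (\<theta> + \<epsilon>))"
          proof -
            have "(1 / (\<theta> + \<epsilon>) - 1 / L) * L = L / (\<theta> + \<epsilon>) - 1"
              using Lpos by (simp add: left_diff_distrib)
            then show ?thesis
              by (simp add: lo_def left_diff_distrib mult.assoc)
          qed
          ultimately show ?thesis by linarith
        qed
        ultimately show ?thesis using Lpos by (simp add: pos_le_divide_eq)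
      qed
      moreover have "g r / L \<le> up \<epsilon> L"
      proof -
        \<comment> \<open>the first time from which the scale \<open>R2\<close> is certainly not above \<open>r\<close>\<close>
        define n where "n = nat \<lceil>L / (\<theta> - \<epsilon>)\<rceil>"
        have "L / (\<theta> + \<epsilon>) \<le> L / (\<theta> - \<epsilon>)" using eps chi Lpos by (intro divide_left_mono) auto
        then have n: "real n \<ge> L / (\<theta> - \<epsilon>)" "real n \<le> L / (\<theta> - \<epsilon>) + 1" "real n \<ge> N"
          unfolding n_def using LN N_pos by linarith+
        obtain k k' where k: "k \<in> V" "k' \<in> V" "k \<le> n" "n < k'" "real k' \<le> (1 + \<epsilon>) * real k" "N1 \<le> k"
          using visits[of n] n LN by force
        have k'N: "N1 \<le> k'" using k by simp
        have "L \<le> (\<theta> - \<epsilon>) * real n" using n(1) eps by (simp add: field_simps)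
        also have "\<dots> \<le> (\<theta> - \<epsilon>) * real k'" using k(4) eps by (intro mult_left_mono) auto
        also have "\<dots> < - ln (R2 k')"
          using N1(1,3)[OF k'N] by (simp add: field_simps)
        finally have "R2 k' \<le> r"
          using elim pos(2)[of k'] by (simp add: L_def)
        then have "g r \<le> g (R2 k')" using mono pos by blast
        with N1(5)[OF k'N k(2)] have "g r \<le> (\<kappa> + \<epsilon>) * real k'" by linarith
        also have "\<dots> \<le> (\<kappa> + \<epsilon>) * ((1 + \<epsilon>) * real n)"
        proof (intro mult_left_mono)
          show "real k' \<le> (1 + \<epsilon>) * real n"
            using k(5) mult_left_mono[of "real k" "real n" "1 + \<epsilon>"] k(3) eps by linarith
        qed (use kappa eps in auto)
        also have "\<dots> \<le> (\<kappa> + \<epsilon>) * ((1 + \<epsilon>) * (L / (\<theta> - \<epsilon>) + 1))"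
          using n kappa eps by (intro mult_left_mono) auto
        also have "\<dots> = up \<epsilon> L * L"
        proof -
          have "(1 / (\<theta> - \<epsilon>) + 1 / L) * L = L / (\<theta> - \<epsilon>) + 1"
            using Lpos by (simp add: distrib_right)
          then show ?thesis
            by (simp add: up_def mult.assoc)
        qed
        finally show ?thesis using Lpos by (simp add: pos_divide_le_eq)
      qed
      ultimately show ?case by (simp add: L_def)
    qed
  qed
  have inv0: "((\<lambda>r::real. 1 / - ln r) \<longlongrightarrow> 0) (at_right 0)"
    by (rule tendsto_divide_0[OF tendsto_const]) (use L_top filterlim_at_top_imp_at_infinity in blast)
  show ?thesis
  proof (rule order_tendstoI)
    fix c assume c: "c < \<kappa> / \<theta>"
    have "((\<lambda>\<epsilon>. \<kappa> / (1 + \<epsilon>) * (1 / (\<theta> + \<epsilon>) - 0) - \<epsilon> / (\<theta> + \<epsilon>)) \<longlongrightarrow> \<kappa> / (1 + 0) * (1 / (\<theta> + 0) - 0) - 0 / (\<theta> + 0)) (at_right 0)"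
      by (intro tendsto_intros) (use chi in auto)
    then have "eventually (\<lambda>\<epsilon>. c < \<kappa> / (1 + \<epsilon>) * (1 / (\<theta> + \<epsilon>) - 0) - \<epsilon> / (\<theta> + \<epsilon>)) (at_right 0)"
      by (rule order_tendstoD(1)) (use c in simp)
    moreover have "eventually (\<lambda>\<epsilon>. 0 < \<epsilon> \<and> \<epsilon> < \<theta>) (at_right 0)"
      using eventually_at_right_real[OF chi] by (simp add: greaterThanLessThan_iff)
    ultimately obtain \<epsilon> where eps: "c < \<kappa> / (1 + \<epsilon>) * (1 / (\<theta> + \<epsilon>) - 0) - \<epsilon> / (\<theta> + \<epsilon>)" "0 < \<epsilon>" "\<epsilon> < \<theta>"
      using eventually_happens[OF eventually_conj] by (metis (mono_tags, lifting) trivial_limit_at_right_real)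
    have "((\<lambda>r. lo \<epsilon> (- ln r)) \<longlongrightarrow> \<kappa> / (1 + \<epsilon>) * (1 / (\<theta> + \<epsilon>) - 0) - \<epsilon> / (\<theta> + \<epsilon>)) (at_right 0)"
      unfolding lo_def by (intro tendsto_intros inv0)
    from order_tendstoD(1)[OF this eps(1)] main[OF eps(2,3)]
    show "eventually (\<lambda>r. c < g r / (- ln r)) (at_right 0)"
      by eventually_elim linarith
  next
    fix c assume c: "\<kappa> / \<theta> < c"
    have "((\<lambda>\<epsilon>. (\<kappa> + \<epsilon>) * (1 + \<epsilon>) * (1 / (\<theta> - \<epsilon>) + 0)) \<longlongrightarrow> (\<kappa> + 0) * (1 + 0) * (1 / (\<theta> - 0) + 0)) (at_right 0)"
      by (intro tendsto_intros) (use chi in auto)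
    then have "eventually (\<lambda>\<epsilon>. (\<kappa> + \<epsilon>) * (1 + \<epsilon>) * (1 / (\<theta> - \<epsilon>) + 0) < c) (at_right 0)"
      by (rule order_tendstoD(2)) (use c in simp)
    moreover have "eventually (\<lambda>\<epsilon>. 0 < \<epsilon> \<and> \<epsilon> < \<theta>) (at_right 0)"
      using eventually_at_right_real[OF chi] by (simp add: greaterThanLessThan_iff)
    ultimately obtain \<epsilon> where eps: "(\<kappa> + \<epsilon>) * (1 + \<epsilon>) * (1 / (\<theta> - \<epsilon>) + 0) < c" "0 < \<epsilon>" "\<epsilon> < \<theta>"
      using eventually_happens[OF eventually_conj] by (metis (mono_tags, lifting) trivial_limit_at_right_real)
    have "((\<lambda>r. up \<epsilon> (- ln r)) \<longlongrightarrow> (\<kappa> + \<epsilon>) * (1 + \<epsilon>) * (1 / (\<theta> - \<epsilon>) + 0)) (at_right 0)"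
      unfolding up_def by (intro tendsto_intros inv0)
    from order_tendstoD(2)[OF this eps(1)] main[OF eps(2,3)]
    show "eventually (\<lambda>r. g r / (- ln r) < c) (at_right 0)"
      by eventually_elim linarith
  qed
qed

lemma dyadic_radius_rate: "(\<lambda>n. - ln (2 * (1/2) ^ n) / real n) \<longlonglongrightarrow> ln 2"
proof -
  have eq: "- ln (2 * (1/2) ^ n) / real n = ln 2 - ln 2 / real n" if "n > 0" for n :: nat
    using that by (simp add: ln_mult ln_realpow ln_div field_simps)
  have "(\<lambda>n. ln 2 - ln 2 / real n) \<longlonglongrightarrow> ln 2 - 0"
    by (intro tendsto_intros lim_const_over_n)
  then have "(\<lambda>n. ln 2 - ln 2 / real n) \<longlonglongrightarrow> ln 2" by simp
  then show ?thesis
    by (rule Lim_transform_eventually) (rule eventually_mono[OF eventually_gt_at_top[of 0] eq[symmetric]])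
qed

lemma limit_along_dyadic_radii:
  fixes g :: "real \<Rightarrow> real"
  assumes mono: "\<And>r r'. 0 < r \<Longrightarrow> r \<le> r' \<Longrightarrow> g r' \<le> g r"
    and lim: "(\<lambda>n. g (2 * (1/2) ^ n) / real n) \<longlonglongrightarrow> \<delta> * ln 2"
  shows "((\<lambda>r. g r / (- ln r)) \<longlongrightarrow> \<delta>) (at_right 0)"
proof -
  have "(\<lambda>n. g 2 / real n) \<longlonglongrightarrow> 0" by (rule lim_const_over_n)
  then have nonneg: "0 \<le> \<delta> * ln 2"
    by (rule LIMSEQ_le[OF _ lim]) (auto intro!: exI[of _ 0] divide_right_mono mono simp: power_le_one)
  have "((\<lambda>r. g r / (- ln r)) \<longlongrightarrow> \<delta> * ln 2 / ln 2) (at_right 0)"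
  proof (rule limit_along_sparse_scales[OF mono _ _ dyadic_radius_rate dyadic_radius_rate _ nonneg])
    fix \<epsilon> :: real assume eps: "0 < \<epsilon>"
    have 1: "eventually (\<lambda>n. \<delta> * ln 2 - \<epsilon> < g (2 * (1/2) ^ n) / real n) sequentially"
      using eps by (intro order_tendstoD(1)[OF lim]) auto
    have 2: "eventually (\<lambda>n. g (2 * (1/2) ^ n) / real n < \<delta> * ln 2 + \<epsilon>) sequentially"
      using eps by (intro order_tendstoD(2)[OF lim]) auto
    have "eventually (\<lambda>n. (\<delta> * ln 2 - \<epsilon>) * real n \<le> g (2 * (1/2) ^ n) \<and> g (2 * (1/2) ^ n) \<le> (\<delta> * ln 2 + \<epsilon>) * real n) sequentially"
      using 1 2 eventually_gt_at_top[of 0]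
      by eventually_elim (auto simp: pos_less_divide_eq pos_divide_less_eq)
    moreover have "eventually (\<lambda>n. \<exists>k\<in>UNIV. \<exists>k'\<in>UNIV. k \<le> n \<and> n < k' \<and> real k' \<le> (1 + \<epsilon>) * real k) sequentially"
    proof -
      have "eventually (\<lambda>n. 1 / \<epsilon> < real n) sequentially"
        using filterlim_real_sequentially by (auto simp: filterlim_at_top_dense)
      then show ?thesis
      proof eventually_elim
        case (elim n)
        then have "1 \<le> \<epsilon> * real n" using eps by (simp add: field_simps)
        then show ?case
          by (intro bexI[of _ n] bexI[of _ "Suc n"]) (auto simp: algebra_simps)
      qed
    qed
    ultimately show "\<exists>V. eventually (\<lambda>n. \<exists>k\<in>V. \<exists>k'\<in>V. k \<le> n \<and> n < k' \<and> real k' \<le> (1 + \<epsilon>) * real k) sequentially \<and>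
        eventually (\<lambda>n. n \<in> V \<longrightarrow> (\<delta> * ln 2 - \<epsilon>) * real n \<le> g (2 * (1/2) ^ n) \<and> g (2 * (1/2) ^ n) \<le> (\<delta> * ln 2 + \<epsilon>) * real n) sequentially"
      by (intro exI[of _ UNIV] conjI) auto
  qed auto
  then show ?thesis by simp
qed

lemma dyadic_limit_of_local_limit:
  fixes g :: "real \<Rightarrow> real"
  assumes "((\<lambda>r. g r / (- ln r)) \<longlongrightarrow> \<delta>) (at_right 0)"
  shows "(\<lambda>n. g (2 * (1/2) ^ n) / real n) \<longlonglongrightarrow> \<delta> * ln 2"
proof -
  have "filterlim (\<lambda>n::nat. 2 * (1/2::real) ^ n) (at_right 0) sequentially"
  proof (rule tendsto_imp_filterlim_at_right)
    have "(\<lambda>n::nat. 2 * (1/2::real) ^ n) \<longlonglongrightarrow> 2 * 0"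
      by (intro tendsto_intros LIMSEQ_power_zero) auto
    then show "(\<lambda>n::nat. 2 * (1/2::real) ^ n) \<longlonglongrightarrow> 0" by simp
  qed auto
  note filterlim_compose[OF assms this]
  then have lim: "(\<lambda>n. g (2 * (1/2) ^ n) / (- ln (2 * (1/2) ^ n)) * (- ln (2 * (1/2) ^ n) / real n)) \<longlonglongrightarrow> \<delta> * ln 2"
    by (intro tendsto_mult dyadic_radius_rate)
  have eq: "g (2 * (1/2) ^ n) / (- ln (2 * (1/2) ^ n)) * (- ln (2 * (1/2) ^ n) / real n) = g (2 * (1/2) ^ n) / real n" if "n > 1" for n
  proof -
    have "ln (2 * (1/2::real) ^ n) = - (real n - 1) * ln 2"
      using that by (simp add: ln_mult ln_realpow ln_div algebra_simps)
    then have "ln (2 * (1/2::real) ^ n) \<noteq> 0" using that by auto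
    then show ?thesis by simp
  qed
  show ?thesis
    by (rule Lim_transform_eventually[OF lim]) (rule eventually_mono[OF eventually_gt_at_top[of 1] eq])
qed



lemma sublinear_limit:
  fixes f :: "nat \<Rightarrow> real"
  assumes up: "\<And>n. f n \<le> c"
    and low: "\<And>j::nat. eventually (\<lambda>n. - (1 / real (Suc j) * real n) \<le> f n) sequentially"
  shows "(\<lambda>n. f n / real n) \<longlonglongrightarrow> 0"
proof (rule LIMSEQ_I)
  fix e :: real assume e: "0 < e"
  obtain j where j: "1 / real (Suc j) < e" using nat_approx_posE[OF e] by (auto simp: inverse_eq_divide)
  have "(\<lambda>n. \<bar>c\<bar> / real n) \<longlonglongrightarrow> 0" by (rule lim_const_over_n)
  from order_tendstoD(2)[OF this e] low[of j] eventually_gt_at_top[of 0]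
  have "eventually (\<lambda>n. norm (f n / real n - 0) < e) sequentially"
  proof eventually_elim
    case (elim n)
    have "1 / real (Suc j) * real n < e * real n" using j elim(3) by (intro mult_strict_right_mono) auto
    moreover have "\<bar>c\<bar> < e * real n" using elim(1,3) by (simp add: pos_divide_less_eq)
    ultimately have "\<bar>f n\<bar> < e * real n" using up[of n] elim(2) by linarith
    then show ?case using elim(3) by (simp add: pos_divide_less_eq abs_divide)
  qed
  then show "\<exists>n0. \<forall>n\<ge>n0. norm (f n / real n - 0) < e"
    by (simp add: eventually_sequentially)
qed

lemma LIMSEQ_iff_nat:
  fixes X :: "nat \<Rightarrow> real"
  shows "X \<longlonglongrightarrow> L \<longleftrightarrow> (\<forall>i::nat. \<exists>N. \<forall>n\<ge>N. \<bar>X n - L\<bar> < 1 / real (Suc i))"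
proof
  assume *: "\<forall>i::nat. \<exists>N. \<forall>n\<ge>N. \<bar>X n - L\<bar> < 1 / real (Suc i)"
  show "X \<longlonglongrightarrow> L"
  proof (rule LIMSEQ_I)
    fix e :: real assume "0 < e"
    then obtain i where "1 / real (Suc i) < e" using nat_approx_posE by (auto simp: inverse_eq_divide)
    with * show "\<exists>N. \<forall>n\<ge>N. norm (X n - L) < e" by (force intro: less_trans)
  qed
next
  assume "X \<longlonglongrightarrow> L"
  then show "\<forall>i::nat. \<exists>N. \<forall>n\<ge>N. \<bar>X n - L\<bar> < 1 / real (Suc i)"
    using LIMSEQ_D[of X L] by (simp add: real_norm_def)
qed

lemma measure_ball_measurable:
  fixes M :: "'a::{second_countable_topology, metric_space} measure"
  assumes "finite_measure M" "sets M = sets borel"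
  shows "(\<lambda>x. measure M (ball x r)) \<in> borel_measurable borel"
proof -
  interpret finite_measure M by fact
  have "open {(x, y::'a). dist x y < r}"
    unfolding case_prod_beta by (intro open_Collect_less continuous_intros)
  then have "{(x, y). dist x y < r} \<in> sets (borel \<Otimes>\<^sub>M (borel :: 'a measure))"
    unfolding borel_prod by simp
  also have "sets (borel \<Otimes>\<^sub>M (borel :: 'a measure)) = sets ((borel :: 'a measure) \<Otimes>\<^sub>M M)"
    by (rule sets_pair_measure_cong) (simp_all add: assms(2))
  finally have "(\<lambda>x. emeasure M (Pair x -` {(x, y). dist x y < r})) \<in> borel_measurable (borel :: 'a measure)"
    by (rule measurable_emeasure_Pair)
  moreover have "Pair x -` {(x, y). dist x y < r} = ball x r" for x :: 'a
    by auto
  ultimately have "(\<lambda>x. emeasure M (ball x r)) \<in> borel_measurable borel"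
    by (simp only:)
  then show ?thesis
    unfolding measure_def by measurable
qed

text \<open>
  Positivity of all balls belongs to the definition: since \<open>ln 0 = 0\<close>, the limit alone would hold with
  \<open>\<delta> = 0\<close> outside the support, and the logarithm of the mass would not be monotone in the radius.
\<close>

definition local_dim :: "'a::metric_space measure \<Rightarrow> 'a \<Rightarrow> real \<Rightarrow> bool" where
  "local_dim M x \<delta> \<longleftrightarrow> (\<forall>r>0. 0 < measure M (ball x r)) \<and>
     ((\<lambda>r. ln (measure M (ball x r)) / ln r) \<longlongrightarrow> \<delta>) (at_right 0)"

lemma ln_measure_ball_antimono:
  assumes "finite_measure M" "sets M = sets borel" "0 < measure M (ball x r)" "r \<le> r'"
  shows "- ln (measure M (ball x r')) \<le> - ln (measure M (ball x r))"
proof -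
  interpret finite_measure M by fact
  have "measure M (ball x r) \<le> measure M (ball x r')"
    using assms by (intro finite_measure_mono subset_ball) auto
  then show ?thesis using assms(3) by simp
qed

text \<open>
  The dyadic form involves only countably many radii, which makes the set of points with a given local
  dimension measurable.
\<close>

lemma local_dim_iff_dyadic:
  assumes M: "finite_measure M" "sets M = sets borel"
  shows "local_dim M x \<delta> \<longleftrightarrow> (\<forall>n. 0 < measure M (ball x (2 * (1/2) ^ n))) \<and>
     (\<lambda>n. - ln (measure M (ball x (2 * (1/2) ^ n))) / real n) \<longlonglongrightarrow> \<delta> * ln 2"
proof -
  interpret finite_measure M by fact
  let ?g = "\<lambda>r. - ln (measure M (ball x r))"
  have pos: "(\<forall>r>0. 0 < measure M (ball x r)) \<longleftrightarrow> (\<forall>n. 0 < measure M (ball x (2 * (1/2) ^ n)))"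
  proof (intro iffI allI impI)
    fix r :: real assume *: "\<forall>n. 0 < measure M (ball x (2 * (1/2) ^ n))" and r: "0 < r"
    obtain n where "(1/2) ^ n < r / 2" using real_arch_pow_inv[of "r / 2" "1/2"] r by auto
    then have "measure M (ball x (2 * (1/2) ^ n)) \<le> measure M (ball x r)"
      by (intro finite_measure_mono subset_ball) (auto simp: M(2))
    then show "0 < measure M (ball x r)" using * by (meson less_le_trans)
  qed auto
  show ?thesis
  proof (intro iffI conjI)
    assume "local_dim M x \<delta>"
    then show "\<forall>n. 0 < measure M (ball x (2 * (1/2) ^ n))" using pos by (simp add: local_dim_def)
    have "((\<lambda>r. ?g r / (- ln r)) \<longlongrightarrow> \<delta>) (at_right 0)" using \<open>local_dim M x \<delta>\<close> by (simp add: local_dim_def)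
    then show "(\<lambda>n. ?g (2 * (1/2) ^ n) / real n) \<longlonglongrightarrow> \<delta> * ln 2"
      by (rule dyadic_limit_of_local_limit)
  next
    assume *: "(\<forall>n. 0 < measure M (ball x (2 * (1/2) ^ n))) \<and>
      (\<lambda>n. ?g (2 * (1/2) ^ n) / real n) \<longlonglongrightarrow> \<delta> * ln 2"
    then have p: "\<forall>r>0. 0 < measure M (ball x r)" using pos by blast
    have "((\<lambda>r. ?g r / (- ln r)) \<longlongrightarrow> \<delta>) (at_right 0)"
      by (rule limit_along_dyadic_radii[OF ln_measure_ball_antimono[OF M] *[THEN conjunct2]]) (use p in auto)
    then show "local_dim M x \<delta>" using p by (simp add: local_dim_def)
  qed
qed

lemma local_dim_sets:
  fixes M :: "'a::{second_countable_topology, metric_space} measure"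
  assumes M: "finite_measure M" "sets M = sets borel"
  shows "{x. local_dim M x \<delta>} \<in> sets borel"
proof -
  note [measurable] = measure_ball_measurable[OF M]
  have "{x. local_dim M x \<delta>} = {x \<in> space borel. (\<forall>n::nat. 0 < measure M (ball x (2 * (1/2) ^ n))) \<and>
     (\<forall>i::nat. \<exists>N. \<forall>n\<ge>N. \<bar>- ln (measure M (ball x (2 * (1/2) ^ n))) / real n - \<delta> * ln 2\<bar> < 1 / real (Suc i))}"
    unfolding local_dim_iff_dyadic[OF M] LIMSEQ_iff_nat by simp
  also have "\<dots> \<in> sets borel"
    by measurable
  finally show ?thesis .
qed

lemma AE_local_dim_dominated:
  fixes M N :: "(real^2) measure"
  assumes M: "finite_measure M" "sets M = sets borel" and N: "finite_measure N" "sets N = sets borel"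
    and C: "0 < C" and le: "\<And>x r. measure N (ball x r) \<le> C * measure M (ball x r)"
    and dim: "AE x in N. local_dim N x \<delta>"
  shows "AE x in N. local_dim M x \<delta>"
proof -
  have "AE x in N. \<forall>j::nat. eventually (\<lambda>n. exp (- (1 / real (Suc j)) * real n) * measure M (ball x (2 * (1/2) ^ n))
            \<le> measure N (ball x (2 * (1/2) ^ n))) sequentially"
    by (subst AE_all_countable, intro allI AE_ball_ratio[OF M N]) simp
  with dim show ?thesis
  proof eventually_elim
    case (elim x)
    let ?R = "\<lambda>n::nat. 2 * (1/2::real) ^ n"
    define gM where "gM n = - ln (measure M (ball x (?R n)))" for n
    define gN where "gN n = - ln (measure N (ball x (?R n)))" for n
    have Npos: "0 < measure N (ball x (?R n))" for n
      using elim(1) unfolding local_dim_iff_dyadic[OF N] by blast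
    have limN: "(\<lambda>n. gN n / real n) \<longlonglongrightarrow> \<delta> * ln 2"
      using elim(1) unfolding local_dim_iff_dyadic[OF N] gN_def by blast
    have Mpos: "0 < measure M (ball x (?R n))" for n
    proof -
      have "0 < C * measure M (ball x (?R n))" using Npos[of n] le[of x "?R n"] by linarith
      then show ?thesis using C by (simp add: zero_less_mult_iff)
    qed
    have "(\<lambda>n. (gM n - gN n) / real n) \<longlonglongrightarrow> 0"
    proof (rule sublinear_limit)
      show "gM n - gN n \<le> ln C" for n
      proof -
        have "ln (measure N (ball x (?R n))) \<le> ln (C * measure M (ball x (?R n)))"
          using le[of x "?R n"] Npos[of n] Mpos[of n] C by (subst ln_le_cancel_iff) auto
        then show ?thesis using Mpos[of n] C by (simp add: ln_mult gM_def gN_def)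
      qed
      show "eventually (\<lambda>n. - (1 / real (Suc j) * real n) \<le> gM n - gN n) sequentially" for j
        using elim(2)[rule_format, of j]
      proof eventually_elim
        case (elim n)
        have "ln (exp (- (1 / real (Suc j)) * real n) * measure M (ball x (?R n))) \<le> ln (measure N (ball x (?R n)))"
          using elim Npos[of n] Mpos[of n] by (subst ln_le_cancel_iff) auto
        then show ?case using Mpos[of n] by (simp add: ln_mult gM_def gN_def)
      qed
    qed
    from tendsto_add[OF this limN] have "(\<lambda>n. gM n / real n) \<longlonglongrightarrow> \<delta> * ln 2"
      by (simp add: diff_divide_distrib)
    then show ?case
      unfolding local_dim_iff_dyadic[OF M] gM_def using Mpos by auto
  qed
qed


text \<open>
  Bounded factors of the mass and of the radius become additive constants, which are negligible
  against \<open>- ln r\<close>.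
\<close>

lemma local_dim_of_comparison:
  fixes f g :: "real \<Rightarrow> real"
  assumes up: "\<And>r. 0 < r \<Longrightarrow> f r \<le> g r + c" and low: "\<And>r. 0 < r \<Longrightarrow> r < r0 \<Longrightarrow> g (r / \<rho>) - c \<le> f r"
    and r0: "0 < r0" and \<rho>: "0 < \<rho>"
    and lim: "((\<lambda>r. g r / (- ln r)) \<longlongrightarrow> \<delta>) (at_right 0)"
  shows "((\<lambda>r. f r / (- ln r)) \<longlongrightarrow> \<delta>) (at_right 0)"
proof -
  have L_top: "filterlim (\<lambda>r::real. - ln r) at_top (at_right 0)"
    using ln_at_0 by (simp add: filterlim_uminus_at_top)
  have inv0: "((\<lambda>r::real. k / - ln r) \<longlongrightarrow> 0) (at_right 0)" for k
    by (rule tendsto_divide_0[OF tendsto_const]) (use L_top filterlim_at_top_imp_at_infinity in blast)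
  have small: "eventually (\<lambda>r::real. 0 < r \<and> r < r1) (at_right 0)" if "0 < r1" for r1
    using eventually_at_right_real[OF that] by (simp add: greaterThanLessThan_iff)
  have scale: "filterlim (\<lambda>r. r / \<rho>) (at_right 0) (at_right 0)"
  proof (rule tendsto_imp_filterlim_at_right)
    have "((\<lambda>r. r / \<rho>) \<longlongrightarrow> 0 / \<rho>) (at_right 0)" using \<rho> by (intro tendsto_intros) auto
    then show "((\<lambda>r. r / \<rho>) \<longlongrightarrow> 0) (at_right 0)" by simp
    show "eventually (\<lambda>r. r / \<rho> > 0) (at_right 0)" using small[of 1, OF zero_less_one] by (rule eventually_mono) (use \<rho> in auto)
  qed
  have lo: "((\<lambda>r. g (r / \<rho>) / (- ln (r / \<rho>)) * (1 + ln \<rho> / (- ln r)) - c / (- ln r)) \<longlongrightarrow> \<delta> * (1 + 0) - 0) (at_right 0)"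
    by (intro tendsto_diff tendsto_mult tendsto_add tendsto_const inv0 filterlim_compose[OF lim scale])
  have hi: "((\<lambda>r. g r / (- ln r) + c / (- ln r)) \<longlongrightarrow> \<delta> + 0) (at_right 0)"
    by (intro tendsto_add lim inv0)
  show ?thesis
  proof (rule tendsto_sandwich[OF _ _ tendsto_eq_rhs[OF lo] tendsto_eq_rhs[OF hi]])
    have "eventually (\<lambda>r. 0 < r \<and> r < Min {1, r0, \<rho>}) (at_right 0)" using r0 \<rho> by (intro small) auto
    then show "eventually (\<lambda>r. g (r / \<rho>) / (- ln (r / \<rho>)) * (1 + ln \<rho> / (- ln r)) - c / (- ln r) \<le> f r / (- ln r)) (at_right 0)"
    proof eventually_elim
      case (elim r)
      then have r: "0 < r" "r < 1" "r < r0" "r < \<rho>" by auto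
      have neg: "ln (r / \<rho>) < 0" "ln r < 0" using r \<rho> by simp_all
      have "1 + ln \<rho> / (- ln r) = (- ln (r / \<rho>)) / (- ln r)"
        using r \<rho> neg by (simp add: ln_div field_simps)
      then have "g (r / \<rho>) / (- ln (r / \<rho>)) * (1 + ln \<rho> / (- ln r)) = g (r / \<rho>) / (- ln r)"
        using neg by simp
      moreover have "(g (r / \<rho>) - c) / (- ln r) \<le> f r / (- ln r)"
        using low[OF r(1,3)] neg by (intro divide_right_mono) auto
      ultimately show ?case by (simp add: diff_divide_distrib)
    qed
    show "eventually (\<lambda>r. f r / (- ln r) \<le> g r / (- ln r) + c / (- ln r)) (at_right 0)"
      using small[of 1, OF zero_less_one]
    proof eventually_elim
      case (elim r)
      then have "f r / (- ln r) \<le> (g r + c) / (- ln r)"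
        using up[of r] by (intro divide_right_mono) auto
      then show ?case by (simp add: add_divide_distrib)
    qed
  qed simp_all
qed


section \<open>Rectangles and the coding map\<close>

locale box_like =
  fixes d l :: nat and a b :: "nat \<Rightarrow> real" and t :: "nat \<Rightarrow> real^2"
  assumes ifs: "box_like_ifs d l a b t"
begin

lemma l_bounds: "1 < l" "l \<le> d"
  using ifs by (auto simp: box_like_ifs_def)

lemma ab_bounds: "i \<in> {1..d} \<Longrightarrow> 0 < a i" "i \<in> {1..d} \<Longrightarrow> a i < 1" "i \<in> {1..d} \<Longrightarrow> 0 < b i" "i \<in> {1..d} \<Longrightarrow> b i < 1"
  using ifs by (auto simp: box_like_ifs_def)

lemma ifs_map_square: "i \<in> {1..d} \<Longrightarrow> x \<in> unit_square \<Longrightarrow> ifs_map l a b t i x \<in> unit_square"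
  using ifs unfolding box_like_ifs_def image_subset_iff by blast

text \<open>
  The sides of the rectangle \<open>S\<^sub>u([0,1]\<^sup>2)\<close>; an antidiagonal letter in front exchanges the roles of the
  sides of the remaining word.
\<close>

fun width height :: "nat list \<Rightarrow> real" where
  "width [] = 1"
| "width (i # u) = a i * (if i < l then width u else height u)"
| "height [] = 1"
| "height (i # u) = b i * (if i < l then height u else width u)"

text \<open>
  These are the words whose matrix is diagonal.
\<close>

definition upright :: "nat list \<Rightarrow> bool" where
  "upright u \<longleftrightarrow> even (length (filter (\<lambda>i. l \<le> i) u))"

lemma upright_simps [simp]: "upright []" "upright (i # u) \<longleftrightarrow> (i < l \<longleftrightarrow> upright u)"
  by (auto simp: upright_def)

lemma width_height_pos: "set u \<subseteq> {1..d} \<Longrightarrow> 0 < width u \<and> 0 < height u"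
  by (induction u) (use ab_bounds in auto)

lemma word_matrix_eq:
  "word_matrix l a b u = (if upright u then vector [vector [width u, 0], vector [0, height u]]
                          else vector [vector [0, width u], vector [height u, 0]])"
proof (induction u)
  case Nil
  show ?case by (simp add: word_matrix_def mat_def vec_eq_iff forall_2)
next
  case (Cons i u)
  have "word_matrix l a b (i # u) = ifs_matrix l a b i ** word_matrix l a b u"
    by (simp add: word_matrix_def)
  then show ?case
    by (simp add: Cons.IH ifs_matrix_def vec_eq_iff forall_2 matrix_matrix_mult_def sum_2)
qed

lemma singular_values_box:
  assumes "0 < x" "0 < y"
  shows "singular_values (vector [vector [x, 0], vector [0, y]] :: real^2^2) = {x, y}"
    and "singular_values (vector [vector [0, x], vector [y, 0]] :: real^2^2) = {x, y}"
proof -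
  have ex: "(\<exists>v::real^2. v \<noteq> 0 \<and> p * v $ 1 = q * v $ 1 \<and> r * v $ 2 = q * v $ 2) \<longleftrightarrow> p = q \<or> r = q" for p q r :: real
  proof
    assume "p = q \<or> r = q"
    then show "\<exists>v::real^2. v \<noteq> 0 \<and> p * v $ 1 = q * v $ 1 \<and> r * v $ 2 = q * v $ 2"
    proof
      assume "p = q"
      then show ?thesis by (intro exI[of _ "vector [1, 0]"]) (simp add: vec_eq_iff forall_2)
    next
      assume "r = q"
      then show ?thesis by (intro exI[of _ "vector [0, 1]"]) (simp add: vec_eq_iff forall_2)
    qed
  qed (auto simp: vec_eq_iff forall_2)
  have sq: "x * x = \<sigma>\<^sup>2 \<longleftrightarrow> x = \<sigma>" "y * y = \<sigma>\<^sup>2 \<longleftrightarrow> y = \<sigma>" if "0 \<le> \<sigma>" for \<sigma>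
    using that assms by (simp_all add: power2_eq_square[symmetric])
  show "singular_values (vector [vector [x, 0], vector [0, y]] :: real^2^2) = {x, y}"
    using assms by (auto simp: singular_values_def vec_eq_iff forall_2 matrix_matrix_mult_def matrix_vector_mult_def
        sum_2 transpose_def ex[unfolded vec_eq_iff forall_2, simplified] sq)
  show "singular_values (vector [vector [0, x], vector [y, 0]] :: real^2^2) = {x, y}"
    using assms by (auto simp: singular_values_def vec_eq_iff forall_2 matrix_matrix_mult_def matrix_vector_mult_def
        sum_2 transpose_def ex[unfolded vec_eq_iff forall_2, simplified] sq)
qed

lemma alpha_eq:
  assumes "set u \<subseteq> {1..d}"
  shows "alpha l a b 1 u = max (width u) (height u)" "alpha l a b 2 u = min (width u) (height u)"
  using width_height_pos[OF assms]
  by (auto simp: alpha_def word_matrix_eq singular_values_box)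

lemma ifs_map_nth [simp]:
  "ifs_map l a b t i x $ 1 = a i * (if i < l then x $ 1 else x $ 2) + t i $ 1"
  "ifs_map l a b t i x $ 2 = b i * (if i < l then x $ 2 else x $ 1) + t i $ 2"
  by (auto simp: ifs_map_def ifs_matrix_def matrix_vector_mult_def sum_2)

abbreviation S :: "nat list \<Rightarrow> real^2 \<Rightarrow> real^2" where
  "S u \<equiv> word_map l a b t u"

lemma S_simps [simp]: "S [] x = x" "S (i # u) x = ifs_map l a b t i (S u x)"
  by (auto simp: word_map_def)

lemma S_append: "S (u @ v) x = S u (S v x)"
  by (induction u) auto

lemma S_diff:
  "S u x $ 1 - S u y $ 1 = width u * (if upright u then x $ 1 - y $ 1 else x $ 2 - y $ 2) \<and>
   S u x $ 2 - S u y $ 2 = height u * (if upright u then x $ 2 - y $ 2 else x $ 1 - y $ 1)"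
proof (induction u)
  case (Cons i u)
  then show ?case
    by (simp add: right_diff_distrib[symmetric] split: if_splits)
qed simp

lemma norm_real2: "norm (x::real^2) = sqrt ((x $ 1)\<^sup>2 + (x $ 2)\<^sup>2)"
  by (simp add: norm_vec_def L2_set_def sum_2)

lemma S_dist_bounds:
  assumes "set u \<subseteq> {1..d}"
  shows "min (width u) (height u) * dist x y \<le> dist (S u x) (S u y)"
    and "dist (S u x) (S u y) \<le> max (width u) (height u) * dist x y"
proof -
  define W H where WH: "W = width u" "H = height u"
  have pos: "0 < W" "0 < H" using width_height_pos[OF assms] by (auto simp: WH)
  define p q where "p = (if upright u then x $ 1 - y $ 1 else x $ 2 - y $ 2)"
    and "q = (if upright u then x $ 2 - y $ 2 else x $ 1 - y $ 1)"
  have n1: "dist x y = sqrt (p\<^sup>2 + q\<^sup>2)"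
    by (simp add: dist_norm norm_real2 p_def q_def add.commute)
  have n2: "dist (S u x) (S u y) = sqrt ((W * p)\<^sup>2 + (H * q)\<^sup>2)"
    using S_diff[of u x y] by (simp add: dist_norm norm_real2 p_def q_def WH)
  have "(min W H)\<^sup>2 \<le> W\<^sup>2" "(min W H)\<^sup>2 \<le> H\<^sup>2" "W\<^sup>2 \<le> (max W H)\<^sup>2" "H\<^sup>2 \<le> (max W H)\<^sup>2"
    using pos by (auto intro!: power_mono)
  then have "(min W H)\<^sup>2 * p\<^sup>2 \<le> W\<^sup>2 * p\<^sup>2" "(min W H)\<^sup>2 * q\<^sup>2 \<le> H\<^sup>2 * q\<^sup>2"
    "W\<^sup>2 * p\<^sup>2 \<le> (max W H)\<^sup>2 * p\<^sup>2" "H\<^sup>2 * q\<^sup>2 \<le> (max W H)\<^sup>2 * q\<^sup>2"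
    by (auto intro: mult_right_mono)
  then have "(min W H * dist x y)\<^sup>2 \<le> (dist (S u x) (S u y))\<^sup>2" "(dist (S u x) (S u y))\<^sup>2 \<le> (max W H * dist x y)\<^sup>2"
    unfolding n1 n2 by (auto simp: power_mult_distrib distrib_left)
  then show "min (width u) (height u) * dist x y \<le> dist (S u x) (S u y)"
    "dist (S u x) (S u y) \<le> max (width u) (height u) * dist x y"
    unfolding WH[symmetric] using pos by (auto intro: power2_le_imp_le)
qed

text \<open>
  A single ratio serves for all letters because the alphabet is finite.
\<close>

lemma contraction_ratio:
  "\<exists>c>0. c < 1 \<and> (\<forall>u. set u \<subseteq> {1..d} \<longrightarrow> width u \<le> c ^ length u \<and> height u \<le> c ^ length u)"
proof -
  define c where "c = Max ((a ` {1..d}) \<union> (b ` {1..d}))"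
  have fin: "finite ((a ` {1..d}) \<union> (b ` {1..d}))" by simp
  have ne: "(a ` {1..d}) \<union> (b ` {1..d}) \<noteq> {}" using l_bounds by auto
  have c1: "c < 1" using Max_in[OF fin ne] ab_bounds by (auto simp: c_def)
  have c0: "0 < c" using Max_in[OF fin ne] ab_bounds by (auto simp: c_def)
  have le: "a i \<le> c" "b i \<le> c" if "i \<in> {1..d}" for i
    using that fin by (auto simp: c_def intro!: Max_ge)
  have "width u \<le> c ^ length u \<and> height u \<le> c ^ length u" if "set u \<subseteq> {1..d}" for u
    using that
  proof (induction u)
    case (Cons i u)
    then show ?case
      using le[of i] ab_bounds[of i] width_height_pos[of u] c0
      by (auto intro!: mult_mono)
  qed simp
  with c0 c1 show ?thesis by blast
qed

lemma prefix_letters: "w \<in> full_shift d \<Longrightarrow> set (prefix w n) \<subseteq> {1..d}"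
  by (auto simp: prefix_def full_shift_def)

lemma shift_full: "w \<in> full_shift d \<Longrightarrow> (shift ^^ n) w \<in> full_shift d"
  by (induction n) (auto simp: full_shift_def shift_def)

lemma width_height_append:
  "width (u @ v) = width u * (if upright u then width v else height v) \<and>
   height (u @ v) = height u * (if upright u then height v else width v)"
  by (induction u) auto

end

locale separated_box_like = box_like +
  fixes F :: "(real^2) set"
  assumes F: "attractor d l a b t F" and ssp: "strong_separation d l a b t F"
begin

abbreviation \<Sigma> :: "(nat \<Rightarrow> nat) set" where "\<Sigma> \<equiv> full_shift d"
abbreviation cod :: "(nat \<Rightarrow> nat) \<Rightarrow> real^2" where "cod \<equiv> coding_map l a b t"

lemma F_facts: "F \<noteq> {}" "compact F" "F \<subseteq> unit_square" "F = (\<Union>i\<in>{1..d}. ifs_map l a b t i ` F)"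
  using F by (auto simp: attractor_def)

lemma S_F: "set u \<subseteq> {1..d} \<Longrightarrow> x \<in> F \<Longrightarrow> S u x \<in> F"
proof (induction u)
  case (Cons i u)
  then show ?case by (subst F_facts(4)) auto
qed simp

lemma dist_square: "x \<in> unit_square \<Longrightarrow> y \<in> unit_square \<Longrightarrow> dist x y \<le> 2"
  using norm2_le[of "x - y"] by (auto simp: unit_square_def mem_box_cart dist_norm forall_2)

lemma coding_map_unique:
  assumes w: "w \<in> \<Sigma>" and x: "\<And>k. k \<ge> 1 \<Longrightarrow> x \<in> S (prefix w k) ` unit_square"
  shows "cod w = x"
proof -
  obtain c where c: "0 < c" "c < 1" "\<And>u. set u \<subseteq> {1..d} \<Longrightarrow> width u \<le> c ^ length u \<and> height u \<le> c ^ length u"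
    using contraction_ratio by blast
  have "y = x" if y: "\<And>k. k \<ge> 1 \<Longrightarrow> y \<in> S (prefix w k) ` unit_square" for y
  proof -
    have "dist y x \<le> c ^ k * 2" if k: "k \<ge> 1" for k
    proof -
      obtain x' y' where xy: "x' \<in> unit_square" "y' \<in> unit_square" "x = S (prefix w k) x'" "y = S (prefix w k) y'"
        using x[OF k] y[OF k] by auto
      have "dist y x \<le> max (width (prefix w k)) (height (prefix w k)) * dist y' x'"
        unfolding xy by (rule S_dist_bounds[OF prefix_letters[OF w]])
      also have "\<dots> \<le> c ^ k * 2"
        using c(1) c(3)[OF prefix_letters[OF w, of k]] width_height_pos[OF prefix_letters[OF w, of k]] dist_square[OF xy(2,1)]
        by (intro mult_mono) auto
      finally show ?thesis .
    qed
    note le = this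
    have "(\<lambda>k. c ^ k * 2) \<longlonglongrightarrow> 0 * 2"
      using c by (intro tendsto_intros LIMSEQ_power_zero) auto
    then have "dist y x \<le> 0 * 2"
      by (rule LIMSEQ_le_const) (use le in \<open>auto intro!: exI[of _ 1]\<close>)
    then show ?thesis by simp
  qed
  with x have "(\<Inter>k\<in>{1..}. S (prefix w k) ` unit_square) = {x}" by auto
  then show ?thesis by (simp add: coding_map_def)
qed

lemma coding_map_exists:
  assumes w: "w \<in> \<Sigma>"
  shows "cod w \<in> S (prefix w k) ` F"
proof -
  have cont: "continuous_on F (S u)" for u
  proof (rule continuous_on_subset[OF _ subset_UNIV], induction u)
    case (Cons i u)
    have "continuous_on UNIV (\<lambda>x. ifs_map l a b t i (S u x))"
      unfolding ifs_map_def by (intro continuous_intros matrix_vector_mult_linear_continuous_on[THEN continuous_on_compose2, OF Cons]) auto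
    then show ?case by simp
  qed simp
  have "(\<Inter>k. S (prefix w k) ` F) \<noteq> {}"
  proof (rule compact_nest)
    show "compact (S (prefix w k) ` F)" for k
      by (rule compact_continuous_image[OF cont F_facts(2)])
    show "S (prefix w k) ` F \<noteq> {}" for k using F_facts by auto
    show "S (prefix w n) ` F \<subseteq> S (prefix w m) ` F" if "m \<le> n" for m n
    proof -
      have "prefix w n = prefix w m @ prefix ((shift ^^ m) w) (n - m)"
        using prefix_add[of w m "n - m"] that by simp
      then show ?thesis
        using S_F[OF prefix_letters[OF shift_full[OF w]]] by (auto simp: S_append)
    qed
  qed
  then obtain x where x: "\<And>k. x \<in> S (prefix w k) ` F" by auto
  have "cod w = x"
    by (rule coding_map_unique[OF w]) (use x F_facts(3) in blast)
  with x show ?thesis by simp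
qed

lemma coding_in_F: "w \<in> \<Sigma> \<Longrightarrow> cod w \<in> F"
  using coding_map_exists[of w 0] by simp

lemma coding_map_shift:
  assumes w: "w \<in> \<Sigma>"
  shows "cod w = S (prefix w n) (cod ((shift ^^ n) w))"
proof (rule coding_map_unique[OF w])
  fix k :: nat
  let ?v = "(shift ^^ n) w"
  have "cod ?v \<in> S (prefix ?v k) ` F"
    by (rule coding_map_exists[OF shift_full[OF w]])
  then have "S (prefix w n) (cod ?v) \<in> S (prefix w (n + k)) ` F"
    by (auto simp: prefix_add S_append)
  also have "S (prefix w (n + k)) ` F \<subseteq> S (prefix w k) ` F"
    using S_F[OF prefix_letters[OF shift_full[OF w]]] by (auto simp: prefix_add[of w k n] S_append add.commute[of n k])
  also have "\<dots> \<subseteq> S (prefix w k) ` unit_square" using F_facts(3) by auto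
  finally show "S (prefix w n) (cod ?v) \<in> S (prefix w k) ` unit_square" .
qed

text \<open>
  At the first letter where two sequences differ, the points lie in different pieces of \<open>F\<close>, whose
  distance is bounded below. The map of the common prefix shrinks this distance at most by the
  factor of the shorter side of its rectangle, and the shorter side only decreases along the sequence.
\<close>

lemma separation_constant:
  obtains \<delta> where "0 < \<delta>" "\<delta> \<le> 1"
    "\<And>w w' n. w \<in> \<Sigma> \<Longrightarrow> w' \<in> \<Sigma> \<Longrightarrow>
       dist (cod w) (cod w') < \<delta> * min (width (prefix w n)) (height (prefix w n)) \<Longrightarrow> prefix w' n = prefix w n"
proof -
  have cmp: "compact (ifs_map l a b t i ` F)" for i
    unfolding ifs_map_def
    by (intro compact_continuous_image F_facts continuous_intros matrix_vector_mult_linear_continuous_on)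
  have "\<exists>e>0. \<forall>x\<in>ifs_map l a b t i ` F. \<forall>y\<in>ifs_map l a b t j ` F. e \<le> dist x y"
    if "i \<in> {1..d}" "j \<in> {1..d}" "i \<noteq> j" for i j
    using ssp that by (intro separate_compact_closed cmp compact_imp_closed) (auto simp: strong_separation_def)
  then obtain e where e: "\<And>i j. i \<in> {1..d} \<Longrightarrow> j \<in> {1..d} \<Longrightarrow> i \<noteq> j \<Longrightarrow> 0 < e i j"
    "\<And>i j x y. i \<in> {1..d} \<Longrightarrow> j \<in> {1..d} \<Longrightarrow> i \<noteq> j \<Longrightarrow> x \<in> ifs_map l a b t i ` F \<Longrightarrow> y \<in> ifs_map l a b t j ` F \<Longrightarrow> e i j \<le> dist x y"
    by metis
  define E where "E = insert 1 ((\<lambda>(i, j). e i j) ` {(i, j). i \<in> {1..d} \<and> j \<in> {1..d} \<and> i \<noteq> j})"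
  have finE: "finite E"
    unfolding E_def by (rule finite.insertI, rule finite_imageI, rule finite_subset[of _ "{1..d} \<times> {1..d}"]) auto
  define \<delta> where "\<delta> = Min E"
  have "0 < \<delta>" using finE e(1) by (auto simp: \<delta>_def E_def)
  moreover have "\<delta> \<le> 1" using finE by (auto simp: \<delta>_def E_def)
  moreover have "prefix w' n = prefix w n"
    if w: "w \<in> \<Sigma>" "w' \<in> \<Sigma>" and lt: "dist (cod w) (cod w') < \<delta> * min (width (prefix w n)) (height (prefix w n))" for w w' n
  proof (rule ccontr)
    assume "prefix w' n \<noteq> prefix w n"
    then have ex: "\<exists>k. k < n \<and> w' k \<noteq> w k" by (auto simp: prefix_def)
    define k where "k = (LEAST k. k < n \<and> w' k \<noteq> w k)"
    have k: "k < n" "w' k \<noteq> w k" using LeastI_ex[OF ex] by (auto simp: k_def)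
    have "w' j = w j" if "j < k" for j
      using not_less_Least[of j "\<lambda>k. k < n \<and> w' k \<noteq> w k"] that k(1) by (auto simp: k_def)
    then have pre: "prefix w' k = prefix w k" by (auto simp: prefix_def)
    let ?u = "prefix w k"
    let ?x = "cod ((shift ^^ k) w)" and ?y = "cod ((shift ^^ k) w')"
    have in_piece: "cod ((shift ^^ k) v) \<in> ifs_map l a b t (v k) ` F" if "v \<in> \<Sigma>" for v
      using coding_map_shift[OF shift_full[OF that], of k 1] coding_in_F[OF shift_full[OF shift_full[OF that]], of 1 k]
      by (simp add: prefix_def shift_funpow)
    have rng: "w k \<in> {1..d}" "w' k \<in> {1..d}" using w by (auto simp: full_shift_def)
    have "e (w k) (w' k) \<le> dist ?x ?y"
      using e(2)[OF rng] k(2) in_piece w by auto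
    moreover have "\<delta> \<le> e (w k) (w' k)"
    proof -
      have "e (w k) (w' k) \<in> E" unfolding E_def using rng k(2) by force
      then show ?thesis unfolding \<delta>_def using finE by simp
    qed
    ultimately have "\<delta> \<le> dist ?x ?y" by simp
    moreover have "min (width (prefix w n)) (height (prefix w n)) \<le> min (width ?u) (height ?u)"
    proof -
      have dec: "prefix w n = ?u @ prefix ((shift ^^ k) w) (n - k)"
        using prefix_add[of w k "n - k"] k(1) by simp
      let ?v = "prefix ((shift ^^ k) w) (n - k)"
      have "width ?v \<le> 1 \<and> height ?v \<le> 1"
      proof -
        obtain c where c: "0 < c" "c < 1" "\<And>u. set u \<subseteq> {1..d} \<Longrightarrow> width u \<le> c ^ length u \<and> height u \<le> c ^ length u"
          using contraction_ratio by blast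
        have "c ^ (n - k) \<le> 1" using c by (intro power_le_one) auto
        then show ?thesis using c(3)[OF prefix_letters[OF shift_full[OF w(1)]], of k "n - k"] by auto
      qed
      then show ?thesis
        unfolding dec using width_height_append[of ?u ?v] width_height_pos[OF prefix_letters[OF w(1), of k]]
        by (auto simp: min_def mult_le_cancel_left1)
           (smt (verit) mult_left_le)+
    qed
    ultimately have "\<delta> * min (width (prefix w n)) (height (prefix w n)) \<le> dist ?x ?y * min (width ?u) (height ?u)"
      using \<open>0 < \<delta>\<close> width_height_pos[OF prefix_letters[OF w(1), of n]] by (intro mult_mono) auto
    also have "\<dots> \<le> dist (S ?u ?x) (S ?u ?y)"
      by (subst mult.commute) (rule S_dist_bounds(1)[OF prefix_letters[OF w(1)]])
    also have "\<dots> = dist (cod w) (cod w')"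
      using coding_map_shift[OF w(1), of k] coding_map_shift[OF w(2), of k] pre by simp
    finally show False using lt by simp
  qed
  ultimately show thesis by (rule that)
qed

lemma full_shift_sets [measurable]: "\<Sigma> \<in> sets borel"
proof -
  have "{w::nat \<Rightarrow> nat. w n \<in> {1..d}} \<in> sets borel" for n
  proof -
    have "(\<lambda>w::nat \<Rightarrow> nat. w n) \<in> borel_measurable borel"
      by (rule measurable_product_coordinates[unfolded comp_def])
    from measurable_sets[OF this, of "{1..d}"] show ?thesis
      by (simp add: vimage_def)
  qed
  then have "(\<Inter>n. {w::nat \<Rightarrow> nat. w n \<in> {1..d}}) \<in> sets borel"
    by (intro sets.countable_INT) auto
  moreover have "\<Sigma> = (\<Inter>n. {w. w n \<in> {1..d}})"
    by (auto simp: full_shift_def)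
  ultimately show ?thesis by simp
qed

lemma coding_measurable_on: "cod \<in> borel_measurable (restrict_space borel \<Sigma>)"
proof -
  obtain x0 where x0: "x0 \<in> F" using F_facts by auto
  obtain c where c: "0 < c" "c < 1" "\<And>u. set u \<subseteq> {1..d} \<Longrightarrow> width u \<le> c ^ length u \<and> height u \<le> c ^ length u"
    using contraction_ratio by blast
  show ?thesis
  proof (rule borel_measurable_LIMSEQ_metric)
    show "(\<lambda>w. S (prefix w n) x0) \<in> borel_measurable (restrict_space borel \<Sigma>)" for n
      by (rule measurable_restrict_space1, rule measurable_compose[OF prefix_measurable]) simp
    fix w assume "w \<in> space (restrict_space borel \<Sigma>)"
    then have w: "w \<in> \<Sigma>" by (simp add: space_restrict_space)
    have "dist (S (prefix w n) x0) (cod w) \<le> c ^ n * 2" for n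
    proof -
      have "dist (S (prefix w n) x0) (cod w) \<le> max (width (prefix w n)) (height (prefix w n)) * dist x0 (cod ((shift ^^ n) w))"
        by (subst coding_map_shift[OF w, of n]) (rule S_dist_bounds[OF prefix_letters[OF w]])
      also have "\<dots> \<le> c ^ n * 2"
        using c(1) c(3)[OF prefix_letters[OF w, of n]] width_height_pos[OF prefix_letters[OF w, of n]]
          dist_square[of x0 "cod ((shift ^^ n) w)"] x0 coding_in_F[OF shift_full[OF w]] F_facts(3)
        by (intro mult_mono) auto
      finally show ?thesis .
    qed
    note le = this
    have "(\<lambda>n. c ^ n * 2) \<longlonglongrightarrow> 0"
      using tendsto_mult[OF LIMSEQ_power_zero[of c] tendsto_const[of 2]] c by auto
    then show "(\<lambda>n. S (prefix w n) x0) \<longlonglongrightarrow> cod w"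
      unfolding tendsto_dist_iff[of _ "cod w"]
      by (rule tendsto_sandwich[OF _ _ tendsto_const, rotated 2]) (use le in auto)
  qed
qed

end

section \<open>The associated subshift\<close>

context box_like
begin

lemma upright_append: "upright (u @ v) \<longleftrightarrow> (upright u \<longleftrightarrow> upright v)"
  by (induction u) auto

text \<open>
  The inverse of \<open>\<tau>\<close> on the sequences of the subshift that begin with a symbol at most \<open>d\<close>.
\<close>

definition untau :: "(nat \<Rightarrow> nat) \<Rightarrow> nat \<Rightarrow> nat" where
  "untau z n = (if z n \<le> d then z n else z n - d)"

lemma untau_full: "z \<in> subshift d l \<Longrightarrow> untau z \<in> full_shift d"
proof -
  assume "z \<in> subshift d l"
  then have "1 \<le> z n" "z n \<le> 2 * d" for n by (auto simp: subshift_def full_shift_def)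
  then have "1 \<le> untau z n" "untau z n \<le> d" for n
    by (cases "z n \<le> d", simp_all add: untau_def)
       (metis add_le_imp_le_diff le_diff_conv mult_2)
  then show ?thesis by (auto simp: full_shift_def)
qed

lemma subshift_step:
  assumes "z \<in> subshift d l"
  shows "z (Suc n) \<le> d \<longleftrightarrow> (z n \<le> d \<longleftrightarrow> untau z n < l)"
proof -
  define p q where "p = z n" and "q = z (Suc n)"
  have "transition_matrix d l p q = 1"
    using assms by (simp add: subshift_def p_def q_def)
  then have "p \<in> {1..l - 1} \<union> {d + l..2 * d} \<and> q \<in> {1..d} \<or> p \<in> {l..d + l - 1} \<and> q \<in> {d + 1..2 * d}"
    unfolding transition_matrix_def by presburger
  then consider "1 \<le> p" "p \<le> l - 1" "q \<le> d" | "d + l \<le> p" "q \<le> d" | "l \<le> p" "p \<le> d + l - 1" "d + 1 \<le> q"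
    unfolding Un_iff atLeastAtMost_iff by blast
  then have "q \<le> d \<longleftrightarrow> (p \<le> d \<longleftrightarrow> (if p \<le> d then p else p - d) < l)"
  proof cases
    case 3
    then show ?thesis using l_bounds by (cases "p \<le> d") auto
  qed (use l_bounds in auto)
  then show ?thesis
    by (simp add: untau_def p_def q_def)
qed

text \<open>
  A symbol above \<open>d\<close> marks that the axes are exchanged at this moment; antidiagonal letters toggle the
  mark.
\<close>

lemma subshift_parity:
  assumes "z \<in> subshift d l"
  shows "z n \<le> d \<longleftrightarrow> (z 0 \<le> d \<longleftrightarrow> upright (prefix (untau z) n))"
proof (induction n)
  case (Suc n)
  then show ?case
    using subshift_step[OF assms, of n] by (auto simp: prefix_Suc upright_append)
qed simp

lemma tau_eq: "tau d l w n = (if upright (prefix w n) then w n else w n + d)"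
proof -
  have "card {j. j < n \<and> l \<le> w j} = length (filter (\<lambda>i. l \<le> i) (prefix w n))"
  proof (induction n)
    case (Suc n)
    have "{j. j < Suc n \<and> l \<le> w j} = {j. j < n \<and> l \<le> w j} \<union> (if l \<le> w n then {n} else {})"
      by (auto simp: less_Suc_eq)
    then show ?case using Suc by (auto simp: prefix_Suc card_insert_if)
  qed simp
  then show ?thesis by (simp add: tau_def upright_def)
qed

lemma untau_tau: "w \<in> full_shift d \<Longrightarrow> untau (tau d l w) = w"
proof
  fix n assume "w \<in> full_shift d"
  then have "1 \<le> w n" "w n \<le> d" by (auto simp: full_shift_def)
  then show "untau (tau d l w) n = w n" by (simp add: untau_def tau_eq)
qed

lemma tau_subshift:
  assumes "w \<in> full_shift d"
  shows "tau d l w \<in> subshift d l" "tau d l w 0 \<le> d"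
proof -
  have w: "1 \<le> w n" "w n \<le> d" for n using assms by (auto simp: full_shift_def)
  then show "tau d l w 0 \<le> d" by (simp add: tau_eq)
  have "transition_matrix d l (tau d l w n) (tau d l w (Suc n)) = 1" for n
  proof -
    define p q where "p = w n" and "q = w (Suc n)"
    have pq: "1 \<le> p" "p \<le> d" "1 \<le> q" "q \<le> d" using w by (auto simp: p_def q_def)
    have "transition_matrix d l (if c then p else p + d) (if (c \<longleftrightarrow> p < l) then q else q + d) = 1" for c
      unfolding transition_matrix_def Un_iff atLeastAtMost_iff using pq l_bounds
      by (cases c; cases "p < l"; simp)
    from this[of "upright (prefix w n)"] show ?thesis
      by (simp only: tau_eq prefix_Suc upright_append p_def q_def upright_simps) simp
  qed
  moreover have "tau d l w n \<in> {1..2*d}" for n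
    using w[of n] by (auto simp: tau_eq)
  ultimately show "tau d l w \<in> subshift d l"
    by (auto simp: subshift_def full_shift_def)
qed

lemma tau_untau:
  assumes "z \<in> subshift d l" "z 0 \<le> d"
  shows "tau d l (untau z) = z"
proof
  fix n
  have "z n \<le> d \<longleftrightarrow> upright (prefix (untau z) n)"
    using subshift_parity[OF assms(1), of n] assms(2) by simp
  then show "tau d l (untau z) n = z n"
    by (cases "z n \<le> d") (simp_all add: tau_eq untau_def)
qed

lemma untau_prefix_eq_iff:
  assumes "z \<in> subshift d l" "z 0 \<le> d" "z' \<in> subshift d l" "n \<ge> 1"
  shows "prefix z' n = prefix z n \<longleftrightarrow> z' 0 \<le> d \<and> prefix (untau z') n = prefix (untau z) n"
proof (intro iffI conjI)
  assume eq: "prefix z' n = prefix z n"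
  then have e: "z' i = z i" if "i < n" for i using that by (auto simp: prefix_def)
  show "z' 0 \<le> d" using e[of 0] assms by simp
  show "prefix (untau z') n = prefix (untau z) n" using e by (auto simp: prefix_def untau_def)
next
  assume *: "z' 0 \<le> d \<and> prefix (untau z') n = prefix (untau z) n"
  then have e: "untau z' i = untau z i" if "i < n" for i using that by (auto simp: prefix_def)
  have "prefix (untau z') i = prefix (untau z) i" if "i < n" for i
    using e that by (auto simp: prefix_def)
  then have "tau d l (untau z') i = tau d l (untau z) i" if "i < n" for i
    using e that by (simp add: tau_eq)
  then show "prefix z' n = prefix z n"
    using tau_untau[OF assms(1,2)] tau_untau[OF assms(3)] * by (simp add: prefix_def)
qed

lemma shift_subshift: "z \<in> subshift d l \<Longrightarrow> (shift ^^ n) z \<in> subshift d l"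
  by (auto simp: shift_funpow subshift_def full_shift_def)

lemma untau_shift: "untau ((shift ^^ n) z) = (shift ^^ n) (untau z)"
  by (auto simp: shift_funpow untau_def)

text \<open>
  For \<open>x \<ge> y\<close> this is the singular value function of a matrix with singular values \<open>x\<close>, \<open>y\<close>. At
  the horizontal and the vertical side, in this order, it is the exponential of the Birkhoff sum of the
  potential along a sequence that starts at or below \<open>d\<close>.
\<close>

definition weight :: "real \<Rightarrow> real \<Rightarrow> real \<Rightarrow> real" where
  "weight s x y = (if s < 1 then x powr s else x * y powr (s - 1))"

lemma weight_pos: "0 < x \<Longrightarrow> 0 < y \<Longrightarrow> 0 < weight s x y"
  by (auto simp: weight_def)

lemma weight_mult: "0 < x \<Longrightarrow> 0 < y \<Longrightarrow> 0 < x' \<Longrightarrow> 0 < y' \<Longrightarrow> weight s (x * x') (y * y') = weight s x y * weight s x' y'"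
  by (auto simp: weight_def powr_mult)

lemma weight_mono: "0 < s \<Longrightarrow> 0 < x \<Longrightarrow> x \<le> x' \<Longrightarrow> 0 < y \<Longrightarrow> y \<le> y' \<Longrightarrow> weight s x y \<le> weight s x' y'"
  by (auto simp: weight_def intro!: mult_mono powr_mono2)

lemma sv_function_eq:
  assumes "set u \<subseteq> {1..d}"
  shows "sv_function l a b s u = weight s (max (width u) (height u)) (min (width u) (height u))"
  by (simp only: sv_function_def alpha_eq[OF assms] weight_def)

lemma ln_weight: "0 < x \<Longrightarrow> 0 < y \<Longrightarrow> ln (weight s x y) = (if s < 1 then s * ln x else ln x + (s - 1) * ln y)"
  by (auto simp: weight_def ln_mult ln_powr)

text \<open>
  The weight at \<open>(x, y)\<close> loses a power of \<open>max x y / x\<close> against the singular value function, with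
  positive exponent if \<open>0 < s < 2\<close>. So a comparison of the two weights controls the horizontal side.
\<close>

lemma ln_weight_ordered:
  assumes "0 < x" "0 < y"
  shows "ln (weight s (max x y) (min x y)) - ln (weight s x y) = (if s < 1 then s else 2 - s) * (ln (max x y) - ln x)"
  using assms by (auto simp: ln_weight max_def min_def algebra_simps)

lemma weight_le_ordered:
  assumes "0 < s" "s < 2" "0 < x" "0 < y"
  shows "weight s x y \<le> weight s (max x y) (min x y)"
proof -
  have "0 \<le> (if s < 1 then s else 2 - s) * (ln (max x y) - ln x)"
    using assms by (intro mult_nonneg_nonneg) auto
  then have "ln (weight s x y) \<le> ln (weight s (max x y) (min x y))"
    using ln_weight_ordered[OF assms(3,4), of s] by linarith
  then show ?thesis
    using assms by (simp add: weight_pos min_def max_def split: if_splits)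
qed

text \<open>
  Sequences that start above \<open>d\<close> have to be included: the shift of a sequence that starts with an
  antidiagonal letter is of this type.
\<close>

lemma exp_potential_sum:
  assumes "z \<in> subshift d l"
  shows "exp (\<Sum>k<n. potential1 d a b s ((shift ^^ k) z)) =
    (if z 0 \<le> d then weight s (width (prefix (untau z) n)) (height (prefix (untau z) n))
     else weight s (height (prefix (untau z) n)) (width (prefix (untau z) n)))"
  using assms
proof (induction n arbitrary: z)
  case 0
  show ?case by (simp add: weight_def)
next
  case (Suc n)
  let ?z' = "shift z"
  let ?v = "prefix (untau ?z') n"
  have z': "?z' \<in> subshift d l" using shift_subshift[OF Suc.prems, of 1] by simp
  have i: "untau z 0 \<in> {1..d}" using untau_full[OF Suc.prems] by (auto simp: full_shift_def)
  note ab = ab_bounds[OF i]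
  have v: "0 < width ?v" "0 < height ?v"
    using width_height_pos[OF prefix_letters[OF untau_full[OF z']], of n] by auto
  have pre: "prefix (untau z) (Suc n) = untau z 0 # ?v"
    using untau_shift[of 1 z] by (simp add: prefix_Cons)
  have "(\<Sum>k<Suc n. potential1 d a b s ((shift ^^ k) z)) =
      potential1 d a b s z + (\<Sum>k<n. potential1 d a b s ((shift ^^ k) ?z'))"
    by (subst sum.lessThan_Suc_shift) (simp add: funpow_Suc_right del: funpow.simps)
  moreover have "exp (potential1 d a b s z) =
      (if z 0 \<le> d then weight s (a (untau z 0)) (b (untau z 0)) else weight s (b (untau z 0)) (a (untau z 0)))"
  proof (cases "z 0 \<le> d")
    case True
    then have "untau z 0 = z 0" by (simp add: untau_def)
    with True ab show ?thesis by (simp add: potential1_def weight_def powr_def exp_add Let_def)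
  next
    case False
    then have "untau z 0 = z 0 - d" by (simp add: untau_def)
    with False ab show ?thesis by (simp add: potential1_def weight_def powr_def exp_add Let_def)
  qed
  moreover have "?z' 0 \<le> d \<longleftrightarrow> (z 0 \<le> d \<longleftrightarrow> untau z 0 < l)"
    using subshift_step[OF Suc.prems, of 0] by (simp add: shift_def)
  ultimately show ?case
    unfolding pre using v ab by (simp add: exp_add Suc.IH[OF z'] weight_mult)
qed

end

section \<open>Kaenmaki measure and Gibbs measure on the full shift\<close>

lemma cylinder_eq: "cylinder X u = cyl u \<inter> X"
  by (auto simp: cylinder_def cyl_def)

lemma borel_prob_on_measurable:
  assumes "borel_prob_on X m" "f \<in> measurable borel N"
  shows "f \<in> measurable m N"
proof -
  have "sets m = sets (restrict_space borel X)" using assms(1) by (simp add: borel_prob_on_def)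
  then show ?thesis
    using measurable_restrict_space1[OF assms(2), of X] by (simp cong: measurable_cong_sets)
qed

lemma borel_prob_on_sets:
  assumes "borel_prob_on X m" "X \<in> sets borel"
  shows "A \<in> sets m \<longleftrightarrow> A \<subseteq> X \<and> A \<in> sets borel"
proof -
  have "sets m = sets (restrict_space borel X)" using assms(1) by (simp add: borel_prob_on_def)
  then show ?thesis using assms(2) by (simp add: sets_restrict_space_iff)
qed


lemma exp_growth_nonneg:
  fixes K x :: real
  assumes "\<And>n. n \<ge> (1::nat) \<Longrightarrow> 1 \<le> K * exp (x * real n)"
  shows "0 \<le> x"
proof (rule ccontr)
  assume "\<not> 0 \<le> x"
  then have "(\<lambda>n. K * exp x ^ n) \<longlonglongrightarrow> K * 0"
    by (intro tendsto_intros LIMSEQ_power_zero) auto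
  then have "1 \<le> K * 0"
    by (rule LIMSEQ_le_const) (use assms in \<open>auto intro!: exI[of _ 1] simp: exp_of_nat_mult[symmetric] mult.commute\<close>)
  then show False by simp
qed


locale kaenmaki_gibbs = separated_box_like +
  fixes s :: real and m m1 :: "(nat \<Rightarrow> nat) measure"
  assumes s: "0 < s" "s < 2"
    and m: "kaenmaki_measure d l a b s m"
    and m1: "gibbs_measure (subshift d l) (potential1 d a b s) m1"
begin

abbreviation \<Sigma>\<^sub>A :: "(nat \<Rightarrow> nat) set" where "\<Sigma>\<^sub>A \<equiv> subshift d l"

lemma subshift_sets [measurable]: "\<Sigma>\<^sub>A \<in> sets borel"
proof -
  have 1: "{w::nat \<Rightarrow> nat. w n \<in> {1..2*d}} \<in> sets borel" for n
    using measurable_sets[OF letter_measurable[of n], of "{1..2*d}"] by (simp add: vimage_def)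
  have 2: "{w::nat \<Rightarrow> nat. transition_matrix d l (w n) (w (Suc n)) = 1} \<in> sets borel" for n
  proof -
    have "(\<lambda>w::nat \<Rightarrow> nat. (w n, w (Suc n))) \<in> measurable borel (count_space UNIV)"
      by measurable
    from measurable_sets[OF this, of "{(i, j). transition_matrix d l i j = 1}"]
    show ?thesis by (simp add: vimage_def)
  qed
  have "\<Sigma>\<^sub>A = (\<Inter>n. {w. w n \<in> {1..2*d}}) \<inter> (\<Inter>n. {w. transition_matrix d l (w n) (w (Suc n)) = 1})"
    by (auto simp: subshift_def full_shift_def)
  then show ?thesis
    using sets.countable_INT[of "\<lambda>n. {w. w n \<in> {1..2*d}}" UNIV] 1
      sets.countable_INT[of "\<lambda>n. {w. transition_matrix d l (w n) (w (Suc n)) = 1}" UNIV] 2 by auto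
qed

lemma m_prob: "borel_prob_on \<Sigma> m" and m_ergodic: "shift_ergodic m"
  using m by (auto simp: kaenmaki_measure_def)

lemma m1_prob: "borel_prob_on \<Sigma>\<^sub>A m1" and m1_invariant: "shift_invariant m1"
  using m1 by (auto simp: gibbs_measure_def)

sublocale m: prob_space m
  using m_prob by (simp add: borel_prob_on_def)

sublocale m1: prob_space m1
  using m1_prob by (simp add: borel_prob_on_def)

lemma space_m: "space m = \<Sigma>" "space m1 = \<Sigma>\<^sub>A"
  using m_prob m1_prob by (auto simp: borel_prob_on_def)

lemma sets_m_iff: "A \<in> sets m \<longleftrightarrow> A \<subseteq> \<Sigma> \<and> A \<in> sets borel"
  by (rule borel_prob_on_sets[OF m_prob full_shift_sets])

lemma sets_m1_iff: "A \<in> sets m1 \<longleftrightarrow> A \<subseteq> \<Sigma>\<^sub>A \<and> A \<in> sets borel"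
  by (rule borel_prob_on_sets[OF m1_prob subshift_sets])

lemma untau_measurable [measurable]: "untau \<in> borel_measurable borel"
  unfolding untau_def using letterwise_measurable[of "\<lambda>n i. if i \<le> d then i else i - d" "\<lambda>n. n"] by simp

text \<open>
  The Kaenmaki measure and the pullback of \<open>m\<^sub>1\<close> under \<open>\<tau>\<close>, both as measures on the space of all
  sequences.
\<close>

definition Kaen :: "(nat \<Rightarrow> nat) measure" where
  "Kaen = distr m borel (\<lambda>w. w)"

definition Gibbs :: "(nat \<Rightarrow> nat) measure" where
  "Gibbs = distr (restrict_space m1 {z \<in> \<Sigma>\<^sub>A. z 0 \<le> d}) borel untau"

lemma sets_Kaen [simp, measurable_cong]: "sets Kaen = sets borel" "space Kaen = UNIV"
  by (auto simp: Kaen_def)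

lemma sets_Gibbs [simp, measurable_cong]: "sets Gibbs = sets borel" "space Gibbs = UNIV"
  by (auto simp: Gibbs_def)

lemma id_measurable_m: "(\<lambda>w. w) \<in> measurable m borel"
  by (rule borel_prob_on_measurable[OF m_prob]) simp

sublocale Kaen: prob_space Kaen
  unfolding Kaen_def by (rule m.prob_space_distr[OF id_measurable_m])

lemma emeasure_Kaen: "E \<in> sets borel \<Longrightarrow> emeasure Kaen E = emeasure m (E \<inter> \<Sigma>)"
  by (simp add: Kaen_def emeasure_distr[OF id_measurable_m] space_m)

lemma measure_Kaen: "E \<in> sets borel \<Longrightarrow> measure Kaen E = measure m (E \<inter> \<Sigma>)"
  by (simp add: measure_def emeasure_Kaen)

lemma first_type_sets: "{z \<in> \<Sigma>\<^sub>A. z 0 \<le> d} \<in> sets borel" "{z \<in> \<Sigma>\<^sub>A. z 0 \<le> d} \<in> sets m1"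
proof -
  have "{z::nat \<Rightarrow> nat. z 0 \<le> d} \<in> sets borel"
    using measurable_sets[OF letter_measurable[of 0], of "{..d}"] by (simp add: vimage_def)
  then have "\<Sigma>\<^sub>A \<inter> {z. z 0 \<le> d} \<in> sets borel" by (intro sets.Int subshift_sets)
  then show "{z \<in> \<Sigma>\<^sub>A. z 0 \<le> d} \<in> sets borel" by (simp add: Int_def)
  then show "{z \<in> \<Sigma>\<^sub>A. z 0 \<le> d} \<in> sets m1" by (auto simp: sets_m1_iff)
qed

lemma untau_measurable_first: "untau \<in> measurable (restrict_space m1 {z \<in> \<Sigma>\<^sub>A. z 0 \<le> d}) borel"
  by (rule measurable_restrict_space1, rule borel_prob_on_measurable[OF m1_prob untau_measurable])

lemma emeasure_Gibbs:
  assumes "E \<in> sets borel"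
  shows "emeasure Gibbs E = emeasure m1 {z \<in> \<Sigma>\<^sub>A. z 0 \<le> d \<and> untau z \<in> E}"
    and "{z \<in> \<Sigma>\<^sub>A. z 0 \<le> d \<and> untau z \<in> E} \<in> sets m1"
proof -
  let ?T = "{z \<in> \<Sigma>\<^sub>A. z 0 \<le> d}"
  have eq: "untau -` E \<inter> ?T = {z \<in> \<Sigma>\<^sub>A. z 0 \<le> d \<and> untau z \<in> E}" by auto
  have "emeasure Gibbs E = emeasure (restrict_space m1 ?T) (untau -` E \<inter> ?T)"
  proof -
    have "?T \<inter> \<Sigma>\<^sub>A = ?T" by auto
    then show ?thesis
      using assms by (simp add: Gibbs_def emeasure_distr[OF untau_measurable_first] space_restrict_space space_m)
  qed
  also have "\<dots> = emeasure m1 (untau -` E \<inter> ?T)"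
  proof (rule emeasure_restrict_space)
    have "?T \<inter> \<Sigma>\<^sub>A = ?T" by auto
    then show "?T \<inter> space m1 \<in> sets m1" using first_type_sets(2) by (simp add: space_m)
  qed auto
  finally show "emeasure Gibbs E = emeasure m1 {z \<in> \<Sigma>\<^sub>A. z 0 \<le> d \<and> untau z \<in> E}" unfolding eq .
  have "untau -` E \<in> sets borel" using measurable_sets[OF untau_measurable assms] by simp
  then have "untau -` E \<inter> ?T \<in> sets borel" using first_type_sets(1) by (rule sets.Int)
  then show "{z \<in> \<Sigma>\<^sub>A. z 0 \<le> d \<and> untau z \<in> E} \<in> sets m1" unfolding eq[symmetric] by (auto simp: sets_m1_iff)
qed

lemma measure_Gibbs: "E \<in> sets borel \<Longrightarrow> measure Gibbs E = measure m1 {z \<in> \<Sigma>\<^sub>A. z 0 \<le> d \<and> untau z \<in> E}"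
  by (simp add: measure_def emeasure_Gibbs)

sublocale Gibbs: finite_measure Gibbs
proof
  show "emeasure Gibbs (space Gibbs) \<noteq> \<infinity>"
    using emeasure_Gibbs(1)[of UNIV] by simp
qed

lemma null_outside: "emeasure Kaen (- \<Sigma>) = 0" "emeasure Gibbs (- \<Sigma>) = 0"
proof -
  show "emeasure Kaen (- \<Sigma>) = 0" by (subst emeasure_Kaen) auto
  have "{z \<in> \<Sigma>\<^sub>A. z 0 \<le> d \<and> untau z \<in> - \<Sigma>} = {}" using untau_full by auto
  moreover have "emeasure Gibbs (- \<Sigma>) = emeasure m1 {z \<in> \<Sigma>\<^sub>A. z 0 \<le> d \<and> untau z \<in> - \<Sigma>}"
    by (rule emeasure_Gibbs(1)) auto
  ultimately show "emeasure Gibbs (- \<Sigma>) = 0" by (simp only: emeasure_empty)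
qed

lemma AE_Gibbs_full: "AE w in Gibbs. w \<in> \<Sigma>"
  by (rule AE_I[OF _ null_outside(2)]) auto

lemma words_cylinder:
  assumes "u \<in> words d n"
  obtains w where "w \<in> \<Sigma>" "prefix w n = u"
proof -
  have u: "length u = n" "set u \<subseteq> {1..d}" using assms by (auto simp: words_def)
  let ?w = "\<lambda>k. if k < n then u ! k else 1"
  have "?w \<in> \<Sigma>"
    using u l_bounds by (auto simp: full_shift_def dest!: nth_mem)
  moreover have "prefix ?w n = u"
    using u by (auto simp: prefix_def intro: nth_equalityI)
  ultimately show thesis by (rule that)
qed

lemma finite_words: "finite (words d n)"
proof -
  have "words d n = {u. set u \<subseteq> {1..d} \<and> length u = n}" by (auto simp: words_def)
  then show ?thesis using finite_lists_length_eq[of "{1..d}" n] by (simp only: finite_atLeastAtMost)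
qed

lemma prefix_in_words: "w \<in> \<Sigma> \<Longrightarrow> prefix w n \<in> words d n"
  using prefix_letters by (auto simp: words_def)

lemma sum_cylinders:
  assumes "finite_measure Q" "sets Q = sets borel" "emeasure Q (- \<Sigma>) = 0"
  shows "(\<Sum>u\<in>words d n. measure Q (cyl u)) = measure Q UNIV"
proof -
  interpret finite_measure Q by fact
  have "(\<Sum>u\<in>words d n. measure Q (cyl u)) = measure Q (\<Union>u\<in>words d n. cyl u)"
    by (rule finite_measure_finite_Union[symmetric])
       (rule finite_words, auto simp: assms(2) disjoint_family_on_def cyl_def words_def)
  also have "\<dots> = measure Q UNIV"
  proof (rule finite_measure_eq_AE)
    have "AE w in Q. w \<in> \<Sigma>"
      by (rule AE_I[OF _ assms(3)]) (auto simp: assms(2))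
    then show "AE w in Q. (w \<in> (\<Union>u\<in>words d n. cyl u)) = (w \<in> UNIV)"
    proof eventually_elim
      case (elim w)
      then have "prefix w n \<in> words d n" "w \<in> cyl (prefix w n)"
        by (auto simp: prefix_in_words cyl_def)
      then show ?case by auto
    qed
  qed (auto simp: assms(2) intro!: sets.finite_UN finite_words)
  finally show ?thesis .
qed

lemma cyl_outside_words: "set u \<subseteq> {1..d} \<or> cyl u \<inter> \<Sigma> = {}"
proof (cases "cyl u \<inter> \<Sigma> = {}")
  case False
  then obtain w where "w \<in> \<Sigma>" "prefix w (length u) = u" by (auto simp: cyl_def)
  then show ?thesis using prefix_letters[of w "length u"] by simp
qed simp

lemma Gibbs_cyl:
  assumes "w \<in> \<Sigma>" "n \<ge> 1"
  shows "measure Gibbs (cyl (prefix w n)) = measure m1 (cylinder \<Sigma>\<^sub>A (prefix (tau d l w) n))"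
proof -
  have "{z \<in> \<Sigma>\<^sub>A. z 0 \<le> d \<and> untau z \<in> cyl (prefix w n)} = cylinder \<Sigma>\<^sub>A (prefix (tau d l w) n)"
    using untau_prefix_eq_iff[OF tau_subshift[OF assms(1)] _ assms(2)]
    by (auto simp: cylinder_def cyl_def untau_tau[OF assms(1)])
  then show ?thesis by (subst measure_Gibbs) auto
qed

lemma Gibbs_cylinder_bounds:
  "\<exists>P. \<exists>C\<ge>1. \<forall>n\<ge>1. \<forall>u\<in>words d n.
     inverse C * (exp (- P * real n) * weight s (width u) (height u)) \<le> measure Gibbs (cyl u) \<and>
     measure Gibbs (cyl u) \<le> C * (exp (- P * real n) * weight s (width u) (height u))"
proof -
  obtain P C where C: "C \<ge> 1" and PC: "\<And>w n. w \<in> \<Sigma>\<^sub>A \<Longrightarrow> n \<ge> 1 \<Longrightarrow>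
        inverse C * exp (- P * real n + (\<Sum>k<n. potential1 d a b s ((shift ^^ k) w)))
          \<le> measure m1 (cylinder \<Sigma>\<^sub>A (prefix w n)) \<and>
        measure m1 (cylinder \<Sigma>\<^sub>A (prefix w n))
          \<le> C * exp (- P * real n + (\<Sum>k<n. potential1 d a b s ((shift ^^ k) w)))"
    using m1 unfolding gibbs_measure_def by blast
  have "inverse C * (exp (- P * real n) * weight s (width u) (height u)) \<le> measure Gibbs (cyl u) \<and>
     measure Gibbs (cyl u) \<le> C * (exp (- P * real n) * weight s (width u) (height u))"
    if n: "n \<ge> 1" and u: "u \<in> words d n" for n u
  proof -
    obtain w where w: "w \<in> \<Sigma>" "prefix w n = u" using words_cylinder[OF u] .
    note z = tau_subshift[OF w(1)]
    have "exp (- P * real n + (\<Sum>k<n. potential1 d a b s ((shift ^^ k) (tau d l w))))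
        = exp (- P * real n) * weight s (width u) (height u)"
      unfolding exp_add exp_potential_sum[OF z(1)] untau_tau[OF w(1)] w(2) using z(2) by simp
    with PC[OF z(1) n] Gibbs_cyl[OF w(1) n] w(2) show ?thesis by simp
  qed
  with C show ?thesis by blast
qed

lemma weight_ordered_sv: "set u \<subseteq> {1..d} \<Longrightarrow> weight s (width u) (height u) \<le> sv_function l a b s u"
  unfolding sv_function_eq using width_height_pos s by (intro weight_le_ordered) auto

lemma sv_le_weights:
  assumes "set u \<subseteq> {1..d}"
  shows "sv_function l a b s u \<le> weight s (width u) (height u) + weight s (height u) (width u)"
  unfolding sv_function_eq[OF assms] using width_height_pos[OF assms] weight_pos
  by (auto simp: max_def min_def less_imp_le)

lemma Kaen_kaenmaki:
  "\<exists>C\<ge>1. \<forall>n\<ge>1. \<forall>u\<in>words d n.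
     inverse C * (exp (- pressure d l a b s * real n) * sv_function l a b s u) \<le> measure Kaen (cyl u) \<and>
     measure Kaen (cyl u) \<le> C * (exp (- pressure d l a b s * real n) * sv_function l a b s u)"
proof -
  have "measure Kaen (cyl u) = measure m (cylinder \<Sigma> u)" for u
    by (simp add: measure_Kaen cylinder_eq)
  then show ?thesis
    using m unfolding kaenmaki_measure_def by (simp add: mult.assoc)
qed

lemma Gibbs_pos: "0 < measure Gibbs UNIV"
proof -
  obtain P C where C: "C \<ge> 1" and PC: "\<And>n u. n \<ge> 1 \<Longrightarrow> u \<in> words d n \<Longrightarrow>
     inverse C * (exp (- P * real n) * weight s (width u) (height u)) \<le> measure Gibbs (cyl u)"
    using Gibbs_cylinder_bounds by meson
  have u: "[1] \<in> words d 1" using l_bounds by (auto simp: words_def)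
  have "0 < weight s (width [1]) (height [1])"
    using width_height_pos[of "[1]"] u by (intro weight_pos) (auto simp: words_def)
  then have "0 < inverse C * (exp (- P * real 1) * weight s (width [1]) (height [1]))"
    using C by simp
  also have "\<dots> \<le> measure Gibbs (cyl [1])" using PC[OF _ u] by simp
  also have "\<dots> \<le> measure Gibbs UNIV" by (rule Gibbs.finite_measure_mono) auto
  finally show ?thesis .
qed

text \<open>
  Both measures have bounded total mass, so either pressure is the growth rate of a sum of weights over
  words of length \<open>n\<close>. The weight \<open>weight s (width u) (height u)\<close> is at most the singular value function,
  which in turn is at most this weight plus the one with exchanged sides; prepending the antidiagonal
  letter \<open>d\<close> bounds the latter sum by the original sum at length \<open>n + 1\<close>.
\<close>

lemma Gibbs_pressure_eq:
  assumes C: "C \<ge> 1" and PC: "\<And>n u. n \<ge> 1 \<Longrightarrow> u \<in> words d n \<Longrightarrow>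
     inverse C * (exp (- P * real n) * weight s (width u) (height u)) \<le> measure Gibbs (cyl u) \<and>
     measure Gibbs (cyl u) \<le> C * (exp (- P * real n) * weight s (width u) (height u))"
  shows "P = pressure d l a b s"
proof -
  define Q where "Q = pressure d l a b s"
  obtain B where B: "B \<ge> 1" and QB: "\<And>n u. n \<ge> 1 \<Longrightarrow> u \<in> words d n \<Longrightarrow>
     inverse B * (exp (- Q * real n) * sv_function l a b s u) \<le> measure Kaen (cyl u) \<and>
     measure Kaen (cyl u) \<le> B * (exp (- Q * real n) * sv_function l a b s u)"
    using Kaen_kaenmaki unfolding Q_def by meson
  define p where "p = measure Gibbs UNIV"
  have p: "0 < p" by (simp add: p_def Gibbs_pos)
  define Z where "Z n = (\<Sum>u\<in>words d n. weight s (width u) (height u))" for n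
  have sumF: "(\<Sum>u\<in>words d n. measure Gibbs (cyl u)) = p" for n
    unfolding p_def by (rule sum_cylinders[OF Gibbs.finite_measure_axioms _ null_outside(2)]) simp
  have sumM: "(\<Sum>u\<in>words d n. measure Kaen (cyl u)) = 1" for n
    using sum_cylinders[OF Kaen.finite_measure_axioms _ null_outside(1)] Kaen.prob_space by simp
  have Z_up: "Z n \<le> C * exp (P * real n) * p" if n: "n \<ge> 1" for n
  proof -
    have "inverse C * exp (- P * real n) * Z n \<le> p"
      unfolding sumF[of n, symmetric] Z_def sum_distrib_left
      using PC[OF n] by (intro sum_mono) (simp add: mult.assoc)
    then have "(C * exp (P * real n)) * (inverse C * exp (- P * real n) * Z n) \<le> (C * exp (P * real n)) * p"
      using C by (intro mult_left_mono) auto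
    then show ?thesis using C by (simp add: exp_minus field_simps)
  qed
  have Z_low: "p \<le> C * exp (- P * real n) * Z n" if n: "n \<ge> 1" for n
    unfolding sumF[of n, symmetric] Z_def sum_distrib_left
    using PC[OF n] by (intro sum_mono) (simp add: mult.assoc)
  have "1 \<le> (B * C / p) * exp ((Q - P) * real n)" if n: "n \<ge> 1" for n
  proof -
    have "inverse B * exp (- Q * real n) * Z n \<le> (\<Sum>u\<in>words d n. measure Kaen (cyl u))"
      unfolding Z_def sum_distrib_left
    proof (rule sum_mono)
      fix u assume u: "u \<in> words d n"
      have "inverse B * exp (- Q * real n) * weight s (width u) (height u) \<le> inverse B * exp (- Q * real n) * sv_function l a b s u"
        using B u by (intro mult_left_mono weight_ordered_sv) (auto simp: words_def)
      also have "\<dots> \<le> measure Kaen (cyl u)" using QB[OF n u] by (simp add: mult.assoc)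
      finally show "inverse B * exp (- Q * real n) * weight s (width u) (height u) \<le> measure Kaen (cyl u)" .
    qed
    then have Zle: "Z n \<le> B * exp (Q * real n)"
      unfolding sumM using B by (simp add: exp_minus field_simps)
    have "p \<le> C * exp (- P * real n) * (B * exp (Q * real n))"
      using Z_low[OF n] Zle C by (smt (verit) exp_gt_zero mult_left_mono mult_pos_pos)
    also have "\<dots> = B * C * (exp (- P * real n) * exp (Q * real n))"
      by (simp only: mult_ac)
    also have "exp (- P * real n) * exp (Q * real n) = exp ((Q - P) * real n)"
      by (simp add: exp_add[symmetric] algebra_simps)
    finally show ?thesis using p by (simp add: field_simps)
  qed
  then have "0 \<le> Q - P" by (rule exp_growth_nonneg)
  moreover have "0 \<le> P - Q"
  proof -
    have dd: "d \<in> {1..d}" "\<not> d < l" using l_bounds by auto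
    define \<omega> where "\<omega> = weight s (a d) (b d)"
    have om: "0 < \<omega>" unfolding \<omega>_def using ab_bounds[OF dd(1)] by (intro weight_pos)
    have swap: "\<omega> * (\<Sum>u\<in>words d n. weight s (height u) (width u)) \<le> Z (Suc n)" for n
    proof -
      have "\<omega> * (\<Sum>u\<in>words d n. weight s (height u) (width u)) = (\<Sum>u\<in>words d n. weight s (width (d # u)) (height (d # u)))"
        unfolding sum_distrib_left
      proof (rule sum.cong[OF refl])
        fix u assume "u \<in> words d n"
        then have "0 < width u" "0 < height u" using width_height_pos by (auto simp: words_def)
        then show "\<omega> * weight s (height u) (width u) = weight s (width (d # u)) (height (d # u))"
          using dd ab_bounds[OF dd(1)] by (simp add: \<omega>_def weight_mult)
      qed
      also have "\<dots> = (\<Sum>v\<in>(#) d ` words d n. weight s (width v) (height v))"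
        by (subst sum.reindex) auto
      also have "\<dots> \<le> Z (Suc n)"
        unfolding Z_def using finite_words dd(1) width_height_pos weight_pos
        by (intro sum_mono2) (auto simp: words_def less_imp_le)
      finally show ?thesis .
    qed
    have "1 \<le> (B * C * p * (1 + exp P / \<omega>)) * exp ((P - Q) * real n)" if n: "n \<ge> 1" for n
    proof -
      have "1 \<le> (\<Sum>u\<in>words d n. B * exp (- Q * real n) * (weight s (width u) (height u) + weight s (height u) (width u)))"
        unfolding sumM[of n, symmetric]
      proof (rule sum_mono)
        fix u assume u: "u \<in> words d n"
        have "measure Kaen (cyl u) \<le> B * exp (- Q * real n) * sv_function l a b s u" using QB[OF n u] by (simp add: mult.assoc)
        also have "\<dots> \<le> B * exp (- Q * real n) * (weight s (width u) (height u) + weight s (height u) (width u))"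
          using B u by (intro mult_left_mono sv_le_weights) (auto simp: words_def)
        finally show "measure Kaen (cyl u) \<le> B * exp (- Q * real n) * (weight s (width u) (height u) + weight s (height u) (width u))" .
      qed
      also have "\<dots> = B * exp (- Q * real n) * (Z n + (\<Sum>u\<in>words d n. weight s (height u) (width u)))"
        by (simp add: sum_distrib_left[symmetric] sum.distrib Z_def)
      also have "\<dots> \<le> B * exp (- Q * real n) * (C * exp (P * real n) * p + (C * exp (P * real (Suc n)) * p) / \<omega>)"
      proof (intro mult_left_mono add_mono Z_up n)
        have "\<omega> * (\<Sum>u\<in>words d n. weight s (height u) (width u)) \<le> C * exp (P * real (Suc n)) * p"
          using swap[of n] Z_up[of "Suc n"] by simp
        then show "(\<Sum>u\<in>words d n. weight s (height u) (width u)) \<le> (C * exp (P * real (Suc n)) * p) / \<omega>"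
          using om by (simp add: pos_le_divide_eq mult.commute)
      qed (use B in auto)
      also have "exp (P * real (Suc n)) = exp (P * real n) * exp P"
        by (simp add: exp_add[symmetric] algebra_simps)
      also have "B * exp (- Q * real n) * (C * exp (P * real n) * p + (C * (exp (P * real n) * exp P) * p) / \<omega>)
          = (B * C * p * (1 + exp P / \<omega>)) * (exp (P * real n) * exp (- Q * real n))"
        by (simp add: algebra_simps)
      also have "exp (P * real n) * exp (- Q * real n) = exp ((P - Q) * real n)"
        by (simp add: exp_add[symmetric] algebra_simps)
      finally show ?thesis .
    qed
    then show ?thesis by (rule exp_growth_nonneg)
  qed
  ultimately show ?thesis by (simp add: Q_def)
qed

definition gweight :: "nat list \<Rightarrow> real" where
  "gweight u = exp (- pressure d l a b s * real (length u)) * weight s (width u) (height u)"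

definition kweight :: "nat list \<Rightarrow> real" where
  "kweight u = exp (- pressure d l a b s * real (length u)) * sv_function l a b s u"

lemma gweight_pos: "set u \<subseteq> {1..d} \<Longrightarrow> 0 < gweight u"
  using width_height_pos weight_pos by (simp add: gweight_def)

lemma gweight_append:
  assumes "upright u" "set u \<subseteq> {1..d}" "set v \<subseteq> {1..d}"
  shows "gweight (u @ v) = gweight u * gweight v"
  using assms width_height_append[of u v] width_height_pos[of u] width_height_pos[of v]
  by (simp add: gweight_def weight_mult exp_add[symmetric] algebra_simps)

lemma gweight_le_kweight: "set u \<subseteq> {1..d} \<Longrightarrow> gweight u \<le> kweight u"
  unfolding gweight_def kweight_def by (intro mult_left_mono weight_ordered_sv) auto

text \<open>
  A common Gibbs constant \<open>G\<close> for both measures avoids existential quantifiers later.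
\<close>

definition cylinder_const :: "real \<Rightarrow> bool" where
  "cylinder_const C \<longleftrightarrow> C \<ge> 1 \<and> (\<forall>u. u \<noteq> [] \<longrightarrow> set u \<subseteq> {1..d} \<longrightarrow>
     gweight u \<le> C * measure Gibbs (cyl u) \<and> measure Gibbs (cyl u) \<le> C * gweight u \<and>
     kweight u \<le> C * measure Kaen (cyl u) \<and> measure Kaen (cyl u) \<le> C * kweight u)"

lemma cylinder_const_exists: "\<exists>C. cylinder_const C"
proof -
  obtain P B where B: "B \<ge> 1" and PB: "\<And>n u. n \<ge> 1 \<Longrightarrow> u \<in> words d n \<Longrightarrow>
     inverse B * (exp (- P * real n) * weight s (width u) (height u)) \<le> measure Gibbs (cyl u) \<and>
     measure Gibbs (cyl u) \<le> B * (exp (- P * real n) * weight s (width u) (height u))"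
    using Gibbs_cylinder_bounds by meson
  have P: "P = pressure d l a b s" using Gibbs_pressure_eq[OF B PB] by simp
  obtain B' where B': "B' \<ge> 1" and QB: "\<And>n u. n \<ge> 1 \<Longrightarrow> u \<in> words d n \<Longrightarrow>
     inverse B' * (exp (- pressure d l a b s * real n) * sv_function l a b s u) \<le> measure Kaen (cyl u) \<and>
     measure Kaen (cyl u) \<le> B' * (exp (- pressure d l a b s * real n) * sv_function l a b s u)"
    using Kaen_kaenmaki by meson
  define C where "C = max B B'"
  have C: "C \<ge> 1" "B \<le> C" "B' \<le> C" using B B' by (auto simp: C_def)
  have swap: "q \<le> c * M" if "inverse c * q \<le> M" "1 \<le> c" for c q M :: real
    using that by (simp add: field_simps)
  have "gweight u \<le> C * measure Gibbs (cyl u) \<and> measure Gibbs (cyl u) \<le> C * gweight u \<and>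
     kweight u \<le> C * measure Kaen (cyl u) \<and> measure Kaen (cyl u) \<le> C * kweight u"
    if u: "u \<noteq> []" "set u \<subseteq> {1..d}" for u
  proof -
    have len: "length u \<ge> 1" "u \<in> words d (length u)" using u by (auto simp: words_def Suc_le_eq)
    have pos: "0 \<le> gweight u" "0 \<le> kweight u"
      using gweight_pos[OF u(2)] gweight_le_kweight[OF u(2)] by auto
    have B1: "gweight u \<le> B * measure Gibbs (cyl u)" "measure Gibbs (cyl u) \<le> B * gweight u"
      using PB[OF len] swap[OF _ B] unfolding P gweight_def by blast+
    have B2: "kweight u \<le> B' * measure Kaen (cyl u)" "measure Kaen (cyl u) \<le> B' * kweight u"
      using QB[OF len] swap[OF _ B'] unfolding kweight_def by blast+
    have "B * gweight u \<le> C * gweight u" "B' * kweight u \<le> C * kweight u"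
      "B * measure Gibbs (cyl u) \<le> C * measure Gibbs (cyl u)" "B' * measure Kaen (cyl u) \<le> C * measure Kaen (cyl u)"
      using C pos by (auto intro: mult_right_mono)
    with B1 B2 show ?thesis by linarith
  qed
  with C(1) show ?thesis unfolding cylinder_const_def by blast
qed

definition G :: real where "G = (SOME C. cylinder_const C)"

lemma G: "G \<ge> 1"
  and Gibbs_ge: "u \<noteq> [] \<Longrightarrow> set u \<subseteq> {1..d} \<Longrightarrow> gweight u \<le> G * measure Gibbs (cyl u)"
  and Gibbs_le: "u \<noteq> [] \<Longrightarrow> set u \<subseteq> {1..d} \<Longrightarrow> measure Gibbs (cyl u) \<le> G * gweight u"
  and Kaen_ge: "u \<noteq> [] \<Longrightarrow> set u \<subseteq> {1..d} \<Longrightarrow> kweight u \<le> G * measure Kaen (cyl u)"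
  and Kaen_le: "u \<noteq> [] \<Longrightarrow> set u \<subseteq> {1..d} \<Longrightarrow> measure Kaen (cyl u) \<le> G * kweight u"
  using someI_ex[OF cylinder_const_exists] unfolding G_def cylinder_const_def by blast+

lemma Gibbs_pos_cyl: "u \<noteq> [] \<Longrightarrow> set u \<subseteq> {1..d} \<Longrightarrow> 0 < measure Gibbs (cyl u)"
  using Gibbs_ge[of u] gweight_pos[of u] G
  by (metis less_le_trans linorder_not_le mult_zero_right order_le_less zero_less_measure_iff)

lemma null_cyl: "\<not> set u \<subseteq> {1..d} \<Longrightarrow> measure Gibbs (cyl u) = 0" "\<not> set u \<subseteq> {1..d} \<Longrightarrow> measure Kaen (cyl u) = 0"
proof -
  assume "\<not> set u \<subseteq> {1..d}"
  then have sub: "cyl u \<subseteq> - \<Sigma>" using cyl_outside_words[of u] by auto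
  have "emeasure Gibbs (cyl u) \<le> emeasure Gibbs (- \<Sigma>)" "emeasure Kaen (cyl u) \<le> emeasure Kaen (- \<Sigma>)"
    using sub by (auto intro!: emeasure_mono)
  then show "measure Gibbs (cyl u) = 0" "measure Kaen (cyl u) = 0"
    by (simp_all add: null_outside measure_def)
qed

text \<open>
  The pressures agree and the weight of the Gibbs measure is the smaller one, hence it is dominated on
  cylinders.
\<close>

lemma Gibbs_le_Kaen:
  assumes "E \<in> sets borel"
  shows "emeasure Gibbs E \<le> ennreal (G * G) * emeasure Kaen E"
proof (rule emeasure_le_of_cylinders[OF Gibbs.finite_measure_axioms _ Kaen.finite_measure_axioms _ _ _ assms])
  fix u :: "nat list" assume u: "u \<noteq> []"
  show "measure Gibbs (cyl u) \<le> G * G * measure Kaen (cyl u)"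
  proof (cases "set u \<subseteq> {1..d}")
    case True
    have "measure Gibbs (cyl u) \<le> G * gweight u" by (rule Gibbs_le[OF u True])
    also have "\<dots> \<le> G * (G * measure Kaen (cyl u))"
      using G Kaen_ge[OF u True] gweight_le_kweight[OF True] by (intro mult_left_mono) auto
    finally show ?thesis by (simp add: mult.assoc)
  qed (simp add: null_cyl)
qed (use G in auto)

lemma AE_Gibbs_of_m:
  assumes "AE w in m. P w"
  shows "AE w in Gibbs. P w"
proof -
  obtain N where N: "N \<in> null_sets m" "{w \<in> space m. \<not> P w} \<subseteq> N"
    using assms by (auto elim!: AE_E simp: null_sets_def)
  have Nb: "N \<in> sets borel" "N \<subseteq> \<Sigma>" using N(1) sets_m_iff by (auto simp: null_sets_def)
  have "emeasure Gibbs N \<le> ennreal (G * G) * emeasure Kaen N" by (rule Gibbs_le_Kaen[OF Nb(1)])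
  also have "\<dots> = 0" using null_setsD1[OF N(1)] Nb by (simp add: emeasure_Kaen Int_absorb2)
  finally have "N \<in> null_sets Gibbs" using Nb by (auto simp: null_sets_def)
  then have "AE w in Gibbs. w \<notin> N" by (rule AE_not_in)
  with AE_Gibbs_full show ?thesis
    by eventually_elim (use N(2) in \<open>auto simp: space_m\<close>)
qed

text \<open>
  The sides are multiplicative, \<open>width (u @ v) = width u * width v\<close>, only if \<open>u\<close> is upright;
  otherwise the axes of \<open>v\<close> are exchanged.
\<close>

lemma
  assumes u: "u \<noteq> []" "set u \<subseteq> {1..d}" "upright u" and E: "E \<in> sets borel"
  shows Gibbs_product_le: "measure Gibbs (cyl u \<inter> (shift ^^ length u) -` E) \<le> G^3 * measure Gibbs (cyl u) * measure Gibbs E"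
    and Gibbs_product_ge: "measure Gibbs (cyl u) * measure Gibbs E \<le> G^3 * measure Gibbs (cyl u \<inter> (shift ^^ length u) -` E)"
proof -
  note pos = Gibbs_pos_cyl[OF u(1,2)]
  have G0: "0 < G" using G by simp
  show "measure Gibbs (cyl u \<inter> (shift ^^ length u) -` E) \<le> G^3 * measure Gibbs (cyl u) * measure Gibbs E"
  proof (rule measure_after_prefix_le[OF Gibbs.finite_measure_axioms _ _ E])
    fix v :: "nat list" assume v: "v \<noteq> []"
    show "measure Gibbs (cyl (u @ v)) \<le> G^3 * measure Gibbs (cyl u) * measure Gibbs (cyl v)"
    proof (cases "set v \<subseteq> {1..d}")
      case True
      have "measure Gibbs (cyl (u @ v)) \<le> G * gweight (u @ v)" using u v True by (intro Gibbs_le) auto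
      also have "\<dots> = G * (gweight u * gweight v)" using gweight_append[OF u(3,2) True] by simp
      also have "\<dots> \<le> G * ((G * measure Gibbs (cyl u)) * (G * measure Gibbs (cyl v)))"
        using G0 gweight_pos[OF u(2)] gweight_pos[OF True] Gibbs_ge[OF u(1,2)] Gibbs_ge[OF v True]
        by (intro mult_left_mono mult_mono) auto
      finally show ?thesis by (simp add: power3_eq_cube algebra_simps)
    qed (simp add: null_cyl)
  qed (use G0 in auto)
  have "measure Gibbs E \<le> G^3 / measure Gibbs (cyl u) * measure Gibbs (cyl u \<inter> (shift ^^ length u) -` E)"
  proof (rule measure_after_prefix_ge[OF Gibbs.finite_measure_axioms _ _ E])
    fix v :: "nat list" assume v: "v \<noteq> []"
    have "measure Gibbs (cyl u) * measure Gibbs (cyl v) \<le> G^3 * measure Gibbs (cyl (u @ v))"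
    proof (cases "set v \<subseteq> {1..d}")
      case True
      have "measure Gibbs (cyl u) * measure Gibbs (cyl v) \<le> (G * gweight u) * (G * gweight v)"
        using G0 gweight_pos[OF u(2)] Gibbs_le[OF u(1,2)] Gibbs_le[OF v True] by (intro mult_mono) auto
      also have "\<dots> = G * G * gweight (u @ v)" using gweight_append[OF u(3,2) True] by simp
      also have "\<dots> \<le> G * G * (G * measure Gibbs (cyl (u @ v)))"
        using G0 u v True by (intro mult_left_mono Gibbs_ge) auto
      finally show ?thesis by (simp add: power3_eq_cube algebra_simps)
    qed (use G0 in \<open>simp add: null_cyl\<close>)
    then show "measure Gibbs (cyl v) \<le> G^3 / measure Gibbs (cyl u) * measure Gibbs (cyl (u @ v))"
      using pos by (simp add: field_simps)
  qed (use G0 pos in auto)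
  then show "measure Gibbs (cyl u) * measure Gibbs E \<le> G^3 * measure Gibbs (cyl u \<inter> (shift ^^ length u) -` E)"
    using pos by (simp add: field_simps)
qed

text \<open>
  The value outside the full shift is a dummy, chosen only to obtain a Borel function on all sequences.
\<close>

definition code :: "(nat \<Rightarrow> nat) \<Rightarrow> real^2" where
  "code w = (if w \<in> \<Sigma> then cod w else 0)"

lemma code_measurable [measurable]: "code \<in> borel_measurable borel"
proof -
  have "(\<lambda>w. if w \<in> \<Sigma> then cod w else 0) \<in> borel_measurable borel"
    using coding_measurable_on by (subst (asm) measurable_restrict_space_iff[where c = 0]) auto
  then show ?thesis by (simp add: code_def[abs_def])
qed

lemma mu1_eq: "mu1 d l a b t m1 = distr Gibbs borel code"
proof -
  have "mu1 d l a b t m1 = measure_of UNIV (sets borel) (emeasure (distr Gibbs borel code))"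
    unfolding mu1_def
  proof (rule measure_of_eq)
    fix E :: "(real^2) set" assume "E \<in> sigma_sets UNIV (sets borel)"
    then have E: "E \<in> sets borel" using sets.sigma_sets_eq[of "borel :: (real^2) measure"] by simp
    have "tau d l ` (cod -` E \<inter> \<Sigma>) = {z \<in> \<Sigma>\<^sub>A. z 0 \<le> d \<and> untau z \<in> code -` E}"
    proof (intro equalityI subsetI)
      fix z assume "z \<in> tau d l ` (cod -` E \<inter> \<Sigma>)"
      then show "z \<in> {z \<in> \<Sigma>\<^sub>A. z 0 \<le> d \<and> untau z \<in> code -` E}"
        using tau_subshift by (auto simp: untau_tau code_def)
    next
      fix z assume "z \<in> {z \<in> \<Sigma>\<^sub>A. z 0 \<le> d \<and> untau z \<in> code -` E}"
      then show "z \<in> tau d l ` (cod -` E \<inter> \<Sigma>)"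
        using untau_full[of z] tau_untau[of z]
        by (intro image_eqI[of _ _ "untau z"]) (auto simp: code_def)
    qed
    moreover have "code -` E \<in> sets borel" using measurable_sets[OF code_measurable E] by simp
    ultimately show "emeasure m1 (tau d l ` (cod -` E \<inter> \<Sigma>)) = emeasure (distr Gibbs borel code) E"
      using E by (simp add: emeasure_distr emeasure_Gibbs(1))
  qed auto
  also have "\<dots> = distr Gibbs borel code"
    using measure_of_of_measure[of "distr Gibbs borel code"] by simp
  finally show ?thesis .
qed

lemma kaenmaki_projection_eq: "kaenmaki_projection l a b t m = distr Kaen borel code"
proof -
  have "distr Kaen borel code = distr m borel (code \<circ> (\<lambda>w. w))"
    unfolding Kaen_def by (rule distr_distr[OF code_measurable id_measurable_m])
  also have "\<dots> = distr m borel cod"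
    by (rule distr_cong) (auto simp: space_m code_def)
  finally show ?thesis by (simp add: kaenmaki_projection_def)
qed

lemma upright_prefix_measurable [measurable]: "Measurable.pred borel (\<lambda>w. upright (prefix w k))"
  by (rule measurable_compose[OF prefix_measurable]) simp

text \<open>
  The pullback of \<open>m\<^sub>1\<close> is not invariant under the shift, but \<open>m\<^sub>1\<close> is. A return of \<open>m\<^sub>1\<close>-orbits to the
  sequences that start at or below \<open>d\<close> is exactly a time with an upright prefix.
\<close>

lemma Gibbs_return_gaps:
  assumes K: "K \<in> sets borel" and q: "0 < q"
  shows "AE w in Gibbs. w \<in> K \<longrightarrow> eventually (\<lambda>n. \<exists>k k'. k \<le> n \<and> n < k' \<and> k' \<le> k + k div q \<and>
     upright (prefix w k) \<and> (shift ^^ k) w \<in> K \<and> upright (prefix w k') \<and> (shift ^^ k') w \<in> K) sequentially"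
proof -
  note [measurable] = K
  let ?P = "\<lambda>w. w \<in> K \<longrightarrow> eventually (\<lambda>n. \<exists>k k'. k \<le> n \<and> n < k' \<and> k' \<le> k + k div q \<and>
     upright (prefix w k) \<and> (shift ^^ k) w \<in> K \<and> upright (prefix w k') \<and> (shift ^^ k') w \<in> K) sequentially"
  let ?T = "{z \<in> \<Sigma>\<^sub>A. z 0 \<le> d}"
  let ?K = "{z \<in> \<Sigma>\<^sub>A. z 0 \<le> d \<and> untau z \<in> K}"
  have shift_m1: "shift \<in> measurable m1 m1"
  proof (rule measurableI)
    show "shift z \<in> space m1" if "z \<in> space m1" for z
      using shift_subshift[of z 1] that by (simp add: space_m)
    show "shift -` A \<inter> space m1 \<in> sets m1" if "A \<in> sets m1" for A
      using m1_invariant that by (simp add: shift_invariant_def)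
  qed
  have "AE z in m1. z \<in> ?K \<longrightarrow> eventually (\<lambda>n. \<exists>k k'. k \<le> n \<and> n < k' \<and> k' \<le> k + k div q \<and>
            (shift ^^ k) z \<in> ?K \<and> (shift ^^ k') z \<in> ?K) sequentially"
    using m1_invariant emeasure_Gibbs(2)[OF K]
    by (intro AE_return_gaps[OF m1.finite_measure_axioms shift_m1 _ _ q]) (auto simp: shift_invariant_def)
  then have "AE z in restrict_space m1 ?T. z \<in> ?K \<longrightarrow> eventually (\<lambda>n. \<exists>k k'. k \<le> n \<and> n < k' \<and> k' \<le> k + k div q \<and>
            (shift ^^ k) z \<in> ?K \<and> (shift ^^ k') z \<in> ?K) sequentially"
  proof (subst AE_restrict_space_iff)
    have "?T \<inter> \<Sigma>\<^sub>A = ?T" by auto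
    then show "?T \<inter> space m1 \<in> sets m1" using first_type_sets(2) by (simp add: space_m)
  qed auto
  then have "AE z in restrict_space m1 ?T. ?P (untau z)"
    using AE_space
  proof eventually_elim
    case (elim z)
    then have z: "z \<in> \<Sigma>\<^sub>A" "z 0 \<le> d" by (auto simp: space_restrict_space space_m)
    have *: "(shift ^^ k) z \<in> ?K \<longleftrightarrow> upright (prefix (untau z) k) \<and> (shift ^^ k) (untau z) \<in> K" for k
      using subshift_parity[OF z(1), of k] z shift_subshift[OF z(1), of k]
      by (simp add: untau_shift) (simp add: shift_funpow)
    from elim(1)[unfolded *] z show ?case by simp
  qed
  moreover have meas: "{w \<in> space borel. ?P w} \<in> sets borel"
    unfolding eventually_sequentially by measurable
  ultimately show ?thesis
    unfolding Gibbs_def AE_distr_iff[OF untau_measurable_first meas] by blast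
qed

end

section \<open>Typical points\<close>

locale kaenmaki_exponents = kaenmaki_gibbs +
  fixes h chi1 chi2 D :: real
  assumes exp1: "lyapunov_exponent l a b m 1 chi1"
    and exp2: "lyapunov_exponent l a b m 2 chi2"
    and h: "has_entropy m h"
    and dim_proj: "has_exact_dimension (distr (mu1 d l a b t m1) borel (\<lambda>x. x $ 1)) D"
begin

abbreviation W :: "(nat \<Rightarrow> nat) \<Rightarrow> nat \<Rightarrow> real" where "W w n \<equiv> width (prefix w n)"
abbreviation H :: "(nat \<Rightarrow> nat) \<Rightarrow> nat \<Rightarrow> real" where "H w n \<equiv> height (prefix w n)"

lemma AE_Gibbs_exists:
  assumes "AE w in Gibbs. P w" shows "\<exists>w. P w"
proof (rule ccontr)
  assume "\<nexists>w. P w"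
  with assms have "AE w in Gibbs. False" by simp
  then have "emeasure Gibbs (space Gibbs) = 0"
    using ae_filter_eq_bot_iff[of Gibbs] trivial_limit_def by blast
  then show False using Gibbs_pos by (simp add: measure_def)
qed

lemma AE_Gibbs_exponents:
  "AE w in Gibbs. w \<in> \<Sigma> \<and>
     (\<lambda>n. - ln (max (W w n) (H w n)) / real n) \<longlonglongrightarrow> chi1 \<and>
     (\<lambda>n. - ln (min (W w n) (H w n)) / real n) \<longlonglongrightarrow> chi2 \<and>
     (\<lambda>n. - ln (measure Kaen (cyl (prefix w n))) / real n) \<longlonglongrightarrow> h"
proof -
  have e1: "AE w in Gibbs. (\<lambda>n. - (ln (alpha l a b 1 (prefix w n)) / real n)) \<longlonglongrightarrow> chi1"
    using exp1 unfolding lyapunov_exponent_def by (rule AE_Gibbs_of_m)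
  have e2: "AE w in Gibbs. (\<lambda>n. - (ln (alpha l a b 2 (prefix w n)) / real n)) \<longlonglongrightarrow> chi2"
    using exp2 unfolding lyapunov_exponent_def by (rule AE_Gibbs_of_m)
  have e3: "AE w in Gibbs. (\<lambda>n. - (ln (measure m (cylinder (space m) (prefix w n))) / real n)) \<longlonglongrightarrow> h"
    using h unfolding has_entropy_def by (rule AE_Gibbs_of_m)
  from e1 e2 e3 AE_Gibbs_full show ?thesis
  proof eventually_elim
    case (elim w)
    note alpha = alpha_eq[OF prefix_letters[OF elim(4)]]
    have "measure m (cylinder (space m) (prefix w n)) = measure Kaen (cyl (prefix w n))" for n
      by (simp add: measure_Kaen cylinder_eq space_m)
    with elim(3) have "(\<lambda>n. - ln (measure Kaen (cyl (prefix w n))) / real n) \<longlonglongrightarrow> h" by simp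
    with elim(1,2,4) show ?case unfolding alpha by simp
  qed
qed

lemma exponent_facts: "0 < chi1" "chi1 \<le> chi2" "0 \<le> h"
proof -
  obtain w where w: "w \<in> \<Sigma>" and l1: "(\<lambda>n. - ln (max (W w n) (H w n)) / real n) \<longlonglongrightarrow> chi1"
    and l2: "(\<lambda>n. - ln (min (W w n) (H w n)) / real n) \<longlonglongrightarrow> chi2"
    and l3: "(\<lambda>n. - ln (measure Kaen (cyl (prefix w n))) / real n) \<longlonglongrightarrow> h"
    using AE_Gibbs_exists[OF AE_Gibbs_exponents] by blast
  have pos: "0 < W w n" "0 < H w n" for n using width_height_pos[OF prefix_letters[OF w]] by auto
  obtain c where c: "0 < c" "c < 1" "\<And>u. set u \<subseteq> {1..d} \<Longrightarrow> width u \<le> c ^ length u \<and> height u \<le> c ^ length u"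
    using contraction_ratio by blast
  have "- ln c \<le> - ln (max (W w n) (H w n)) / real n" if "n \<ge> 1" for n
  proof -
    have "max (W w n) (H w n) \<le> c ^ n" using c(3)[OF prefix_letters[OF w, of n]] by simp
    then have "ln (max (W w n) (H w n)) \<le> ln (c ^ n)" using pos c by (subst ln_le_cancel_iff) (auto simp: less_max_iff_disj)
    also have "\<dots> = real n * ln c" using c by (simp add: ln_realpow)
    finally show ?thesis using that by (simp add: field_simps)
  qed
  then have "- ln c \<le> chi1" by (intro LIMSEQ_le_const[OF l1]) auto
  then show "0 < chi1" using c by (smt (verit) ln_less_zero)
  show "chi1 \<le> chi2"
  proof (rule LIMSEQ_le[OF l1 l2], intro exI[of _ 0] allI impI divide_right_mono)
    fix n show "- ln (max (W w n) (H w n)) \<le> - ln (min (W w n) (H w n))"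
      using pos[of n] by simp
  qed simp
  show "0 \<le> h"
  proof (rule LIMSEQ_le_const[OF l3], intro exI[of _ 1] allI impI divide_nonneg_nonneg)
    fix n :: nat assume "1 \<le> n"
    then have u: "prefix w n \<noteq> []" "set (prefix w n) \<subseteq> {1..d}"
      using prefix_letters[OF w] by (auto simp: prefix_def)
    have "0 < G * measure Kaen (cyl (prefix w n))"
      using Kaen_ge[OF u] gweight_pos[OF u(2)] gweight_le_kweight[OF u(2)] by linarith
    then have "0 < measure Kaen (cyl (prefix w n))" using G by (simp add: zero_less_mult_iff)
    then show "0 \<le> - ln (measure Kaen (cyl (prefix w n)))" by simp
  qed simp
qed

text \<open>
  Almost everywhere the masses of cylinders under both measures agree up to subexponential factors,
  which gives the entropy of the Gibbs measure. Both masses are weights of the same rectangle, and by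
  \<open>ln_weight_ordered\<close> the longer side exceeds the horizontal one by a subexponential factor only.
  Therefore the horizontal side decays at rate \<open>chi1\<close>, and the vertical side at rate \<open>chi2\<close>.
\<close>

lemma AE_Gibbs_typical:
  "AE w in Gibbs. w \<in> \<Sigma> \<and>
     (\<lambda>n. - ln (W w n) / real n) \<longlonglongrightarrow> chi1 \<and>
     (\<lambda>n. - ln (H w n) / real n) \<longlonglongrightarrow> chi2 \<and>
     (\<lambda>n. - ln (min (W w n) (H w n)) / real n) \<longlonglongrightarrow> chi2 \<and>
     (\<lambda>n. - ln (measure Gibbs (cyl (prefix w n))) / real n) \<longlonglongrightarrow> h"
proof -
  have "AE w in Gibbs. \<forall>j::nat. eventually (\<lambda>n. exp (- (1 / real (Suc j)) * real n) * measure Kaen (cyl (prefix w n))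
            \<le> measure Gibbs (cyl (prefix w n))) sequentially"
    by (subst AE_all_countable, intro allI AE_cylinder_ratio[OF Kaen.finite_measure_axioms _ Gibbs.finite_measure_axioms]) auto
  with AE_Gibbs_exponents show ?thesis
  proof eventually_elim
    case (elim w)
    have w: "w \<in> \<Sigma>" and l1: "(\<lambda>n. - ln (max (W w n) (H w n)) / real n) \<longlonglongrightarrow> chi1"
      and l2: "(\<lambda>n. - ln (min (W w n) (H w n)) / real n) \<longlonglongrightarrow> chi2"
      and l3: "(\<lambda>n. - ln (measure Kaen (cyl (prefix w n))) / real n) \<longlonglongrightarrow> h"
      using elim(1) by auto
    have G0: "0 < G" "0 \<le> ln G" using G by auto
    have pos: "0 < W w n" "0 < H w n" for n using width_height_pos[OF prefix_letters[OF w]] by auto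
    define x where "x n = (if n = 0 then 0 else ln (measure Gibbs (cyl (prefix w n))))" for n
    define y where "y n = (if n = 0 then 0 else ln (measure Kaen (cyl (prefix w n))))" for n
    have bounds: "\<bar>x n - ln (gweight (prefix w n))\<bar> \<le> ln G" "\<bar>y n - ln (kweight (prefix w n))\<bar> \<le> ln G"
      "0 < measure Gibbs (cyl (prefix w n))" "0 < measure Kaen (cyl (prefix w n))"
      if n: "n \<ge> 1" for n
    proof -
      have u: "prefix w n \<noteq> []" "set (prefix w n) \<subseteq> {1..d}"
        using n prefix_letters[OF w] by (auto simp: prefix_def)
      have gp: "0 < gweight (prefix w n)" "0 < kweight (prefix w n)"
        using gweight_pos[OF u(2)] gweight_le_kweight[OF u(2)] by auto
      have key: "0 < M \<and> \<bar>ln M - ln q\<bar> \<le> ln G" if "q \<le> G * M" "M \<le> G * q" "0 < q" for q M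
      proof -
        have "0 < G * M" using that by linarith
        then have M: "0 < M" using G0 by (simp add: zero_less_mult_iff)
        have "ln q \<le> ln G + ln M" "ln M \<le> ln G + ln q"
          using that M G0 ln_mono[of q "G * M"] ln_mono[of M "G * q"] by (simp_all add: ln_mult)
        with M show ?thesis by linarith
      qed
      show "\<bar>x n - ln (gweight (prefix w n))\<bar> \<le> ln G" "0 < measure Gibbs (cyl (prefix w n))"
        using key[OF Gibbs_ge[OF u] Gibbs_le[OF u] gp(1)] n by (auto simp: x_def)
      show "\<bar>y n - ln (kweight (prefix w n))\<bar> \<le> ln G" "0 < measure Kaen (cyl (prefix w n))"
        using key[OF Kaen_ge[OF u] Kaen_le[OF u] gp(2)] n by (auto simp: y_def)
    qed
    define \<sigma> where "\<sigma> = (if s < 1 then s else 2 - s)"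
    have sig: "0 < \<sigma>" using s by (auto simp: \<sigma>_def)
    \<comment> \<open>by how much the horizontal side falls short of the longer side\<close>
    define \<Delta> where "\<Delta> n = ln (max (W w n) (H w n)) - ln (W w n)" for n
    have wt: "ln (kweight (prefix w n)) - ln (gweight (prefix w n)) = \<sigma> * \<Delta> n" for n
    proof -
      have u: "set (prefix w n) \<subseteq> {1..d}" using prefix_letters[OF w] .
      have wp: "0 < weight s (max (W w n) (H w n)) (min (W w n) (H w n))" "0 < weight s (W w n) (H w n)"
        using pos[of n] by (auto intro!: weight_pos simp: less_max_iff_disj)
      have "ln (kweight (prefix w n)) - ln (gweight (prefix w n)) =
        ln (weight s (max (W w n) (H w n)) (min (W w n) (H w n))) - ln (weight s (W w n) (H w n))"
        using wp by (simp add: kweight_def gweight_def sv_function_eq[OF u] ln_mult)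
      also have "\<dots> = \<sigma> * \<Delta> n"
        unfolding \<sigma>_def \<Delta>_def by (rule ln_weight_ordered[OF pos])
      finally show ?thesis .
    qed
    have D0: "0 \<le> \<Delta> n" for n using pos[of n] by (simp add: \<Delta>_def)
    have x_y: "(\<lambda>n. (x n - y n) / real n) \<longlonglongrightarrow> 0"
    proof (rule sublinear_limit)
      show "x n - y n \<le> 2 * ln G" for n
      proof (cases "n = 0")
        case False
        then have "0 \<le> \<sigma> * \<Delta> n" "\<bar>x n - ln (gweight (prefix w n))\<bar> \<le> ln G" "\<bar>y n - ln (kweight (prefix w n))\<bar> \<le> ln G"
          using sig D0 bounds[of n] by auto
        then show ?thesis using wt[of n] by linarith
      qed (use G0 in \<open>simp add: x_def y_def\<close>)
      show "eventually (\<lambda>n. - (1 / real (Suc j) * real n) \<le> x n - y n) sequentially" for j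
        using elim(2)[rule_format, of j] eventually_ge_at_top[of 1]
      proof eventually_elim
        case (elim n)
        note b = bounds(3,4)[OF elim(2)]
        have "ln (exp (- (1 / real (Suc j)) * real n) * measure Kaen (cyl (prefix w n))) \<le> ln (measure Gibbs (cyl (prefix w n)))"
          using elim(1) b by (subst ln_le_cancel_iff) auto
        then show ?case using b elim(2) by (simp add: ln_mult x_def y_def)
      qed
    qed
    have "(\<lambda>n. - y n / real n) \<longlonglongrightarrow> h"
      by (rule Lim_transform_eventually[OF l3]) (auto intro!: eventually_mono[OF eventually_ge_at_top[of 1]] simp: y_def)
    from tendsto_diff[OF this x_y] have "(\<lambda>n. - x n / real n) \<longlonglongrightarrow> h"
      by (simp add: diff_divide_distrib)
    then have lh: "(\<lambda>n. - ln (measure Gibbs (cyl (prefix w n))) / real n) \<longlonglongrightarrow> h"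
      by (rule Lim_transform_eventually) (auto intro!: eventually_mono[OF eventually_ge_at_top[of 1]] simp: x_def)
    have "(\<lambda>n. \<Delta> n / real n) \<longlonglongrightarrow> 0"
    proof (rule tendsto_sandwich[OF _ _ tendsto_const])
      show "eventually (\<lambda>n. 0 \<le> \<Delta> n / real n) sequentially" using D0 by simp
      show "eventually (\<lambda>n. \<Delta> n / real n \<le> (2 * ln G / real n - (x n - y n) / real n) / \<sigma>) sequentially"
        using eventually_ge_at_top[of 1]
      proof eventually_elim
        case (elim n)
        have "\<sigma> * \<Delta> n \<le> 2 * ln G - (x n - y n)" using wt[of n] bounds(1,2)[OF elim] by linarith
        then have "\<Delta> n \<le> (2 * ln G - (x n - y n)) / \<sigma>" using sig by (simp add: pos_le_divide_eq mult.commute)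
        then have "\<Delta> n / real n \<le> (2 * ln G - (x n - y n)) / \<sigma> / real n" by (rule divide_right_mono) simp
        then show ?case by (simp add: diff_divide_distrib mult.commute)
      qed
      have "(\<lambda>n. (2 * ln G / real n - (x n - y n) / real n) / \<sigma>) \<longlonglongrightarrow> (0 - 0) / \<sigma>"
        using sig by (intro tendsto_intros x_y lim_const_over_n) auto
      then show "(\<lambda>n. (2 * ln G / real n - (x n - y n) / real n) / \<sigma>) \<longlonglongrightarrow> 0" by simp
    qed
    note lD = this
    have "(\<lambda>n. - ln (max (W w n) (H w n)) / real n + \<Delta> n / real n) \<longlonglongrightarrow> chi1 + 0"
      by (intro tendsto_add l1 lD)
    moreover have "- ln (max (W w n) (H w n)) / real n + \<Delta> n / real n = - ln (W w n) / real n" for n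
      by (simp add: \<Delta>_def diff_divide_distrib)
    ultimately have lW: "(\<lambda>n. - ln (W w n) / real n) \<longlonglongrightarrow> chi1" by simp
    have "(\<lambda>n. - ln (min (W w n) (H w n)) / real n - \<Delta> n / real n) \<longlonglongrightarrow> chi2 - 0"
      by (intro tendsto_diff l2 lD)
    moreover have "- ln (min (W w n) (H w n)) / real n - \<Delta> n / real n = - ln (H w n) / real n" for n
      by (simp add: \<Delta>_def diff_divide_distrib min_def max_def)
    ultimately have lH: "(\<lambda>n. - ln (H w n) / real n) \<longlonglongrightarrow> chi2" by simp
    from w lW lH l2 lh show ?case by blast
  qed
qed

definition \<nu> :: "real measure" where "\<nu> = distr Gibbs borel (\<lambda>w. code w $ 1)"

lemma code1_measurable [measurable]: "(\<lambda>w. code w $ 1) \<in> borel_measurable borel"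
  by (rule measurable_compose[OF code_measurable]) (intro borel_measurable_continuous_onI continuous_intros)

lemma nu_eq: "distr (mu1 d l a b t m1) borel (\<lambda>x. x $ 1) = \<nu>"
  unfolding mu1_eq \<nu>_def
  by (subst distr_distr) (auto simp: comp_def intro!: borel_measurable_continuous_onI continuous_intros)

lemma nu_finite: "finite_measure \<nu>" "sets \<nu> = sets borel"
  unfolding \<nu>_def by (auto intro!: Gibbs.finite_measure_distr)

lemma measure_nu_ball: "measure \<nu> (ball y r) = measure Gibbs {w. \<bar>code w $ 1 - y\<bar> < r}"
proof -
  have "measure \<nu> (ball y r) = measure Gibbs ((\<lambda>w. code w $ 1) -` ball y r \<inter> space Gibbs)"
    unfolding \<nu>_def by (rule measure_distr) auto
  also have "(\<lambda>w. code w $ 1) -` ball y r \<inter> space Gibbs = {w. \<bar>code w $ 1 - y\<bar> < r}"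
    by (auto simp: dist_real_def abs_minus_commute)
  finally show ?thesis .
qed

lemma code_dist_small:
  assumes "0 < r"
  shows "\<exists>n\<ge>1. \<forall>w\<in>\<Sigma>. \<forall>w'\<in>\<Sigma>. prefix w' n = prefix w n \<longrightarrow> dist (code w) (code w') < r"
proof -
  obtain c where c: "0 < c" "c < 1" "\<And>u. set u \<subseteq> {1..d} \<Longrightarrow> width u \<le> c ^ length u \<and> height u \<le> c ^ length u"
    using contraction_ratio by blast
  obtain n0 where n0: "c ^ n0 < r / 2" using real_arch_pow_inv[of "r / 2" c] assms c by auto
  define n where "n = Suc n0"
  have n: "n \<ge> 1" "c ^ n < r / 2"
    using n0 c by (auto simp: n_def) (smt (verit) mult_left_le_one_le zero_less_power)
  have "dist (code w) (code w') < r" if w: "w \<in> \<Sigma>" "w' \<in> \<Sigma>" "prefix w' n = prefix w n" for w w'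
  proof -
    let ?x = "cod ((shift ^^ n) w)" and ?y = "cod ((shift ^^ n) w')"
    have "dist (code w) (code w') = dist (S (prefix w n) ?x) (S (prefix w n) ?y)"
      using coding_map_shift[OF w(1), of n] coding_map_shift[OF w(2), of n] w by (simp add: code_def)
    also have "\<dots> \<le> max (W w n) (H w n) * dist ?x ?y" by (rule S_dist_bounds(2)[OF prefix_letters[OF w(1)]])
    also have "\<dots> \<le> c ^ n * 2"
      using c(1) c(3)[OF prefix_letters[OF w(1), of n]] width_height_pos[OF prefix_letters[OF w(1), of n]]
        dist_square[of ?x ?y] coding_in_F[OF shift_full] w F_facts(3)
      by (intro mult_mono) auto
    also have "\<dots> < r" using n by simp
    finally show ?thesis .
  qed
  with n(1) show ?thesis by blast
qed

lemma code_ball_sets: "{v. dist x (code v) < r} \<in> sets borel"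
  using measurable_sets[OF code_measurable, of "ball x r"] by (simp add: vimage_def)

lemma Gibbs_ball_pos:
  assumes "w \<in> \<Sigma>" "0 < r"
  shows "0 < measure Gibbs {v. dist (code w) (code v) < r}"
proof -
  obtain n where n: "n \<ge> 1" "\<And>w w'. w \<in> \<Sigma> \<Longrightarrow> w' \<in> \<Sigma> \<Longrightarrow> prefix w' n = prefix w n \<Longrightarrow> dist (code w) (code w') < r"
    using code_dist_small[OF assms(2)] by blast
  have "0 < measure Gibbs (cyl (prefix w n))"
    using prefix_letters[OF assms(1), of n] n(1) by (intro Gibbs_pos_cyl) (auto simp: prefix_def)
  also have "\<dots> \<le> measure Gibbs {v. dist (code w) (code v) < r}"
  proof (rule Gibbs.finite_measure_mono_AE)
    show "AE v in Gibbs. v \<in> cyl (prefix w n) \<longrightarrow> v \<in> {v. dist (code w) (code v) < r}"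
      using AE_Gibbs_full by eventually_elim (use n(2)[OF assms(1)] in \<open>auto simp: cyl_def\<close>)
  qed (simp add: code_ball_sets)
  finally show ?thesis .
qed

lemma comp1_dist: "\<bar>(x::real^2) $ 1 - y $ 1\<bar> \<le> dist y x"
  using component_le_norm_cart[of "x - y" 1] by (simp add: dist_norm norm_minus_commute)

lemma nu_ball_sets: "{v. \<bar>code v $ 1 - y\<bar> < r} \<in> sets borel"
proof -
  have "(\<lambda>v. code v $ 1) -` ball y r \<inter> space borel \<in> sets borel"
    by (rule measurable_sets[OF code1_measurable]) simp
  then show ?thesis by (simp add: vimage_def dist_real_def abs_minus_commute)
qed

lemma nu_pos:
  assumes "w \<in> \<Sigma>" "0 < r"
  shows "0 < measure \<nu> (ball (code w $ 1) r)"
proof -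
  have "measure Gibbs {v. dist (code w) (code v) < r} \<le> measure Gibbs {v. \<bar>code v $ 1 - code w $ 1\<bar> < r}"
    by (rule Gibbs.finite_measure_mono) (use comp1_dist in \<open>auto simp: nu_ball_sets intro: le_less_trans\<close>)
  then show ?thesis using Gibbs_ball_pos[OF assms] by (simp add: measure_nu_ball)
qed

end

section \<open>Local dimension via vertical strips\<close>

context kaenmaki_exponents
begin

lemma code_shift: "w \<in> \<Sigma> \<Longrightarrow> code w = S (prefix w n) (code ((shift ^^ n) w))"
  using coding_map_shift[of w n] shift_full[of w n] by (simp add: code_def)

lemma code_square: "w \<in> \<Sigma> \<Longrightarrow> code w \<in> unit_square"
  using coding_in_F F_facts(3) by (auto simp: code_def)

lemma upright_code_diff:
  assumes "w \<in> \<Sigma>" "v \<in> \<Sigma>" "prefix v n = prefix w n" "upright (prefix w n)"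
  shows "code v $ 1 - code w $ 1 = W w n * (code ((shift ^^ n) v) $ 1 - code ((shift ^^ n) w) $ 1)"
    and "code v $ 2 - code w $ 2 = H w n * (code ((shift ^^ n) v) $ 2 - code ((shift ^^ n) w) $ 2)"
  using S_diff[of "prefix w n" "code ((shift ^^ n) v)" "code ((shift ^^ n) w)"] assms
    code_shift[OF assms(1), of n] code_shift[OF assms(2), of n] by simp_all

text \<open>
  By separation the ball sees only the cylinder of \<open>w\<close>. There the distance of the first coordinates is
  \<open>W w n\<close> times the distance before applying \<open>S\<^sub>u\<close>, and forgetting the second coordinate enlarges
  the set to a vertical strip.
\<close>

lemma ball_le_strip:
  assumes sep: "\<And>w w' n. w \<in> \<Sigma> \<Longrightarrow> w' \<in> \<Sigma> \<Longrightarrow> dist (cod w) (cod w') < \<delta> * min (W w n) (H w n) \<Longrightarrow> prefix w' n = prefix w n"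
    and w: "w \<in> \<Sigma>" and n: "n \<ge> 1" and up: "upright (prefix w n)"
  shows "measure Gibbs {v. dist (code w) (code v) < \<delta> * min (W w n) (H w n)}
     \<le> G^3 * measure Gibbs (cyl (prefix w n)) * measure \<nu> (ball (code ((shift ^^ n) w) $ 1) (\<delta> * min (W w n) (H w n) / W w n))"
proof -
  let ?u = "prefix w n" and ?y = "code ((shift ^^ n) w) $ 1" and ?r = "\<delta> * min (W w n) (H w n)"
  let ?E = "{v. \<bar>code v $ 1 - ?y\<bar> < ?r / W w n}"
  have u: "?u \<noteq> []" "set ?u \<subseteq> {1..d}" using n prefix_letters[OF w] by (auto simp: prefix_def)
  have pos: "0 < W w n" using width_height_pos[OF u(2)] by simp
  have "measure Gibbs {v. dist (code w) (code v) < ?r} \<le> measure Gibbs (cyl ?u \<inter> (shift ^^ length ?u) -` ?E)"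
  proof (rule Gibbs.finite_measure_mono_AE)
    show "AE v in Gibbs. v \<in> {v. dist (code w) (code v) < ?r} \<longrightarrow> v \<in> cyl ?u \<inter> (shift ^^ length ?u) -` ?E"
      using AE_Gibbs_full
    proof eventually_elim
      case (elim v)
      show ?case
      proof
        assume "v \<in> {v. dist (code w) (code v) < ?r}"
        then have lt: "dist (code w) (code v) < ?r" by simp
        then have pre: "prefix v n = ?u" using sep[OF w elim, of n] w elim by (simp add: code_def)
        have "W w n * \<bar>code ((shift ^^ n) v) $ 1 - ?y\<bar> = \<bar>code v $ 1 - code w $ 1\<bar>"
          using upright_code_diff(1)[OF w elim pre up] pos by (simp add: abs_mult)
        also have "\<dots> < ?r" using comp1_dist lt by (rule le_less_trans)
        finally have "\<bar>code ((shift ^^ n) v) $ 1 - ?y\<bar> < ?r / W w n" using pos by (simp add: field_simps)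
        with pre show "v \<in> cyl ?u \<inter> (shift ^^ length ?u) -` ?E" by (simp add: cyl_def)
      qed
    qed
    show "cyl ?u \<inter> (shift ^^ length ?u) -` ?E \<in> sets Gibbs"
      using measurable_sets[OF shift_funpow_measurable nu_ball_sets, of n ?y "?r / W w n"] by auto
  qed
  also have "\<dots> \<le> G^3 * measure Gibbs (cyl ?u) * measure Gibbs ?E"
    by (rule Gibbs_product_le[OF u up nu_ball_sets])
  finally show ?thesis by (simp only: measure_nu_ball)
qed

text \<open>
  The radius is twice the vertical side because the second coordinates of points in the rectangle
  differ by at most \<open>H w n\<close>; the strip is so narrow that the first coordinates differ by less.
\<close>

lemma strip_le_ball:
  assumes w: "w \<in> \<Sigma>" and n: "n \<ge> 1" and up: "upright (prefix w n)"
  shows "measure Gibbs (cyl (prefix w n)) * measure \<nu> (ball (code ((shift ^^ n) w) $ 1) (min (W w n) (H w n) / W w n))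
     \<le> G^3 * measure Gibbs {v. dist (code w) (code v) < 2 * H w n}"
proof -
  let ?u = "prefix w n" and ?y = "code ((shift ^^ n) w) $ 1" and ?r = "min (W w n) (H w n)"
  let ?E = "{v. \<bar>code v $ 1 - ?y\<bar> < ?r / W w n}"
  have u: "?u \<noteq> []" "set ?u \<subseteq> {1..d}" using n prefix_letters[OF w] by (auto simp: prefix_def)
  have pos: "0 < W w n" "0 < H w n" using width_height_pos[OF u(2)] by simp_all
  have G0: "0 \<le> G^3" using G by simp
  have "measure Gibbs (cyl ?u) * measure Gibbs ?E \<le> G^3 * measure Gibbs (cyl ?u \<inter> (shift ^^ length ?u) -` ?E)"
    by (rule Gibbs_product_ge[OF u up nu_ball_sets])
  also have "\<dots> \<le> G^3 * measure Gibbs {v. dist (code w) (code v) < 2 * H w n}"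
  proof (rule mult_left_mono[OF Gibbs.finite_measure_mono_AE G0])
    show "AE v in Gibbs. v \<in> cyl ?u \<inter> (shift ^^ length ?u) -` ?E \<longrightarrow> v \<in> {v. dist (code w) (code v) < 2 * H w n}"
      using AE_Gibbs_full
    proof eventually_elim
      case (elim v)
      show ?case
      proof
        assume "v \<in> cyl ?u \<inter> (shift ^^ length ?u) -` ?E"
        then have pre: "prefix v n = ?u" and lt: "\<bar>code ((shift ^^ n) v) $ 1 - ?y\<bar> < ?r / W w n" by (auto simp: cyl_def)
        have "\<bar>code v $ 1 - code w $ 1\<bar> = W w n * \<bar>code ((shift ^^ n) v) $ 1 - ?y\<bar>"
          using upright_code_diff(1)[OF w elim pre up] pos by (simp add: abs_mult)
        also have "\<dots> < ?r" using lt pos by (simp add: field_simps)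
        finally have 1: "\<bar>code v $ 1 - code w $ 1\<bar> < H w n" by simp
        have "\<bar>code v $ 2 - code w $ 2\<bar> = H w n * \<bar>code ((shift ^^ n) v) $ 2 - code ((shift ^^ n) w) $ 2\<bar>"
          using upright_code_diff(2)[OF w elim pre up] pos by (simp add: abs_mult)
        also have "\<dots> \<le> H w n * 1"
        proof (rule mult_left_mono)
          show "\<bar>code ((shift ^^ n) v) $ 2 - code ((shift ^^ n) w) $ 2\<bar> \<le> 1"
            using code_square[OF shift_full[OF elim, of n]] code_square[OF shift_full[OF w, of n]]
            by (auto simp: unit_square_def mem_box_cart forall_2)
        qed (use pos in simp)
        finally have 2: "\<bar>code v $ 2 - code w $ 2\<bar> \<le> H w n" by simp
        have "dist (code w) (code v) \<le> \<bar>code v $ 1 - code w $ 1\<bar> + \<bar>code v $ 2 - code w $ 2\<bar>"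
          using norm2_le[of "code v - code w"] by (simp add: dist_norm norm_minus_commute)
        with 1 2 show "v \<in> {v. dist (code w) (code v) < 2 * H w n}" by simp
      qed
    qed
  qed (simp add: code_ball_sets)
  finally show ?thesis by (simp only: measure_nu_ball)
qed

lemma AE_nu_local_dim:
  "AE w in Gibbs. ((\<lambda>r. - ln (measure \<nu> (ball (code w $ 1) r)) / (- ln r)) \<longlongrightarrow> D) (at_right 0)"
proof -
  have "AE y in \<nu>. ((\<lambda>r. ln (measure \<nu> (ball y r)) / ln r) \<longlongrightarrow> D) (at_right 0)"
    using dim_proj unfolding nu_eq has_exact_dimension_def by simp
  then have "AE w in Gibbs. ((\<lambda>r. ln (measure \<nu> (ball (code w $ 1) r)) / ln r) \<longlongrightarrow> D) (at_right 0)"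
    unfolding \<nu>_def[symmetric] by (subst (asm) \<nu>_def) (rule AE_distrD, auto)
  then show ?thesis by simp
qed

lemma D_nonneg: "0 \<le> D"
proof -
  have "AE w in Gibbs. w \<in> \<Sigma> \<and> ((\<lambda>r. - ln (measure \<nu> (ball (code w $ 1) r)) / (- ln r)) \<longlongrightarrow> D) (at_right 0)"
    using AE_Gibbs_full AE_nu_local_dim by eventually_elim simp
  then obtain w where w: "w \<in> \<Sigma>" "((\<lambda>r. - ln (measure \<nu> (ball (code w $ 1) r)) / (- ln r)) \<longlongrightarrow> D) (at_right 0)"
    using AE_Gibbs_exists by blast
  note lim = dyadic_limit_of_local_limit[OF w(2)]
  have "(\<lambda>n. - ln (measure \<nu> (ball (code w $ 1) 2)) / real n) \<longlonglongrightarrow> 0" by (rule lim_const_over_n)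
  then have "0 \<le> D * ln 2"
  proof (rule LIMSEQ_le[OF _ lim], intro exI[of _ 0] allI impI divide_right_mono)
    fix n :: nat
    show "- ln (measure \<nu> (ball (code w $ 1) 2)) \<le> - ln (measure \<nu> (ball (code w $ 1) (2 * (1/2) ^ n)))"
      by (rule ln_measure_ball_antimono[OF nu_finite nu_pos[OF w(1)]]) (auto simp: power_le_one)
  qed simp
  then show ?thesis by (simp add: zero_le_mult_iff)
qed

text \<open>
  The points at which the projected measure has dimension \<open>D\<close> with errors bounded explicitly at every
  dyadic scale: the slope of the error is \<open>\<epsilon>\<close>, its initial value \<open>j\<close>.
\<close>

definition K :: "real \<Rightarrow> nat \<Rightarrow> (nat \<Rightarrow> nat) set" where
  "K \<epsilon> j = {w \<in> \<Sigma>. \<forall>k. \<bar>- ln (measure \<nu> (ball (code w $ 1) (2 * (1/2) ^ k))) - D * ln 2 * real k\<bar> \<le> \<epsilon> * real k + real j}"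

lemma K_sets: "K \<epsilon> j \<in> sets borel"
proof -
  have [measurable]: "(\<lambda>w. measure \<nu> (ball (code w $ 1) r)) \<in> borel_measurable borel" for r
    by (rule measurable_compose[OF code1_measurable measure_ball_measurable[OF nu_finite]])
  have "K \<epsilon> j = \<Sigma> \<inter> {w \<in> space borel. \<forall>k. \<bar>- ln (measure \<nu> (ball (code w $ 1) (2 * (1/2) ^ k))) - D * ln 2 * real k\<bar> \<le> \<epsilon> * real k + real j}"
    by (auto simp: K_def)
  also have "\<dots> \<in> sets borel" by measurable
  finally show ?thesis .
qed

lemma AE_in_K:
  assumes "0 < \<epsilon>"
  shows "AE w in Gibbs. \<exists>j. w \<in> K \<epsilon> j"
  using AE_Gibbs_full AE_nu_local_dim
proof eventually_elim
  case (elim w)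
  define f where "f k = \<bar>- ln (measure \<nu> (ball (code w $ 1) (2 * (1/2) ^ k))) - D * ln 2 * real k\<bar>" for k
  note lim = dyadic_limit_of_local_limit[OF elim(2)]
  have "eventually (\<lambda>k. \<bar>- ln (measure \<nu> (ball (code w $ 1) (2 * (1/2) ^ k))) / real k - D * ln 2\<bar> < \<epsilon>) sequentially"
    using tendstoD[OF lim assms] by (simp add: dist_real_def)
  then have "eventually (\<lambda>k. f k \<le> \<epsilon> * real k) sequentially"
    using eventually_gt_at_top[of 0]
  proof eventually_elim
    case (elim k)
    have "f k = \<bar>- ln (measure \<nu> (ball (code w $ 1) (2 * (1/2) ^ k))) / real k - D * ln 2\<bar> * \<bar>real k\<bar>"
      unfolding f_def abs_mult[symmetric] using elim(2) by (simp add: left_diff_distrib)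
    also have "\<dots> \<le> \<epsilon> * real k" using elim by (simp add: mult_right_mono)
    finally show ?case .
  qed
  then obtain k0 where k0: "\<And>k. k \<ge> k0 \<Longrightarrow> f k \<le> \<epsilon> * real k" by (auto simp: eventually_sequentially)
  define j where "j = nat \<lceil>\<Sum>k<k0. f k\<rceil>"
  have f0: "0 \<le> f k" for k by (simp add: f_def)
  have "f k \<le> \<epsilon> * real k + real j" for k
  proof (cases "k < k0")
    case True
    have "f k \<le> (\<Sum>k<k0. f k)" using True f0 by (intro member_le_sum) auto
    also have "\<dots> \<le> real j" unfolding j_def by linarith
    finally show ?thesis using assms by (smt (verit) mult_nonneg_nonneg of_nat_0_le_iff)
  qed (use k0 in \<open>smt (verit) of_nat_0_le_iff not_less\<close>)
  then show ?case using elim(1) by (auto simp: K_def f_def)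
qed

text \<open>
  A radius \<open>r\<close> lies between two consecutive dyadic radii, at which the defining inequality is used;
  the factor \<open>2\<close> in front of \<open>\<epsilon>\<close> comes from \<open>1 / ln 2 \<le> 2\<close>.
\<close>

lemma K_bound:
  assumes w: "w \<in> K \<epsilon> j" and eps: "0 < \<epsilon>" and r: "0 < r" "r \<le> 1"
  shows "\<bar>- ln (measure \<nu> (ball (code w $ 1) r)) - D * (- ln r)\<bar> \<le> 2 * \<epsilon> * (- ln r) + (2 * D * ln 2 + 2 * \<epsilon> + real j)"
proof -
  have w\<Sigma>: "w \<in> \<Sigma>" using w by (simp add: K_def)
  define T where "T = - ln r"
  have T: "0 \<le> T" using r by (simp add: T_def)
  define k0 where "k0 = nat \<lfloor>T / ln 2\<rfloor>"
  have "0 \<le> T / ln 2" using T by simp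
  then have k0: "real k0 \<le> T / ln 2" "T / ln 2 \<le> real k0 + 1" unfolding k0_def by linarith+
  have l2: "1/2 \<le> ln (2::real)" using ln2_ge_two_thirds by simp
  have "T / ln 2 \<le> T / (1/2)" using l2 T by (intro divide_left_mono) auto
  then have k0T: "real k0 \<le> 2 * T" using k0 by simp
  have lo: "real k0 * ln 2 \<le> T" and hi: "T \<le> (real k0 + 1) * ln 2"
    using k0 by (simp_all add: field_simps)
  let ?g = "\<lambda>r. - ln (measure \<nu> (ball (code w $ 1) r))"
  let ?R = "\<lambda>k::nat. 2 * (1/2::real) ^ k"
  have lnR: "ln (?R k) = ln 2 - real k * ln 2" for k
    by (simp add: ln_mult ln_realpow ln_div)
  have "ln r \<le> ln (?R (k0 + 1))" unfolding lnR using lo by (simp add: T_def algebra_simps)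
  then have "r \<le> ?R (k0 + 1)" using r by (subst (asm) ln_le_cancel_iff) auto
  then have up: "?g (?R (k0 + 1)) \<le> ?g r"
    by (rule ln_measure_ball_antimono[OF nu_finite nu_pos[OF w\<Sigma> r(1)]])
  have "ln (?R (k0 + 2)) \<le> ln r" unfolding lnR using hi by (simp add: T_def algebra_simps)
  then have "?R (k0 + 2) \<le> r" using r by (subst (asm) ln_le_cancel_iff) auto
  then have dn: "?g r \<le> ?g (?R (k0 + 2))"
    by (intro ln_measure_ball_antimono[OF nu_finite nu_pos[OF w\<Sigma>]]) simp_all
  have K1: "\<bar>?g (?R k) - D * ln 2 * real k\<bar> \<le> \<epsilon> * real k + real j" for k
    using w by (simp add: K_def)
  have e: "\<epsilon> * real k0 \<le> \<epsilon> * (2 * T)" using k0T eps by (intro mult_left_mono) auto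
  have eqs: "\<epsilon> * real (k0 + 1) = \<epsilon> * real k0 + \<epsilon>" "\<epsilon> * real (k0 + 2) = \<epsilon> * real k0 + 2 * \<epsilon>"
    "D * ln 2 * real (k0 + 1) = D * ((real k0 + 1) * ln 2)" "D * ln 2 * real (k0 + 2) = D * (real k0 * ln 2) + 2 * D * ln 2"
    "\<epsilon> * (2 * T) = 2 * \<epsilon> * T"
    by (simp_all add: algebra_simps)
  have Dl: "0 \<le> 2 * D * ln 2" using D_nonneg by simp
  have "D * T \<le> D * ((real k0 + 1) * ln 2)" using hi D_nonneg by (rule mult_left_mono)
  then have "D * T - (2 * \<epsilon> * T + (2 * D * ln 2 + 2 * \<epsilon> + real j)) \<le> ?g r"
    using up K1[of "k0 + 1"] e eps Dl unfolding eqs by linarith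
  moreover have "D * (real k0 * ln 2) \<le> D * T" using lo D_nonneg by (rule mult_left_mono)
  then have "?g r \<le> D * T + (2 * \<epsilon> * T + (2 * D * ln 2 + 2 * \<epsilon> + real j))"
    using dn K1[of "k0 + 2"] e eps unfolding eqs by linarith
  ultimately have "\<bar>?g r - D * T\<bar> \<le> 2 * \<epsilon> * T + (2 * D * ln 2 + 2 * \<epsilon> + real j)" by linarith
  then show ?thesis by (simp only: T_def)
qed

text \<open>
  The exponential rate at which the mass of balls of radius about \<open>exp (- n chi2)\<close> decays.
\<close>

definition \<kappa> :: real where "\<kappa> = h + D * (chi2 - chi1)"

abbreviation \<mu>\<^sub>1 :: "(real^2) measure" where "\<mu>\<^sub>1 \<equiv> distr Gibbs borel code"
abbreviation \<mu> :: "(real^2) measure" where "\<mu> \<equiv> distr Kaen borel code"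

lemma mu_finite: "finite_measure \<mu>\<^sub>1" "sets \<mu>\<^sub>1 = sets borel" "finite_measure \<mu>" "sets \<mu> = sets borel"
  by (auto intro!: Gibbs.finite_measure_distr Kaen.finite_measure_distr)

lemma measure_mu_ball:
  "measure \<mu>\<^sub>1 (ball x r) = measure Gibbs {v. dist x (code v) < r}"
  "measure \<mu> (ball x r) = measure Kaen {v. dist x (code v) < r}"
  by (subst measure_distr, auto intro!: arg_cong[where f = "measure _"])+

text \<open>
  At times \<open>n\<close> with an upright prefix and \<open>\<sigma>\<^sup>n w \<in> K \<epsilon> j\<close>, the two strip lemmas and \<open>K_bound\<close> bound the
  mass of balls of radius comparable to \<open>exp (- n chi2)\<close> from both sides by \<open>exp (- n \<kappa>)\<close>, up to
  an error in the exponent that is a small multiple of \<open>n\<close>. Such times have no long gaps.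
\<close>

lemma AE_local_dim_mu1: "AE w in Gibbs. local_dim \<mu>\<^sub>1 (code w) (\<kappa> / chi2)"
proof -
  obtain \<delta> where \<delta>: "0 < \<delta>" "\<delta> \<le> 1" and
    sep: "\<And>w w' n. w \<in> \<Sigma> \<Longrightarrow> w' \<in> \<Sigma> \<Longrightarrow> dist (cod w) (cod w') < \<delta> * min (W w n) (H w n) \<Longrightarrow> prefix w' n = prefix w n"
    by (rule separation_constant) blast
  have "AE w in Gibbs. \<forall>i. \<exists>j. w \<in> K (1 / real (Suc i)) j"
    by (subst AE_all_countable, intro allI AE_in_K) simp
  moreover have "AE w in Gibbs. \<forall>i j q. w \<in> K (1 / real (Suc i)) j \<longrightarrow>
      eventually (\<lambda>n. \<exists>k k'. k \<le> n \<and> n < k' \<and> k' \<le> k + k div Suc q \<and>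
        upright (prefix w k) \<and> (shift ^^ k) w \<in> K (1 / real (Suc i)) j \<and>
        upright (prefix w k') \<and> (shift ^^ k') w \<in> K (1 / real (Suc i)) j) sequentially"
    unfolding AE_all_countable by (intro allI Gibbs_return_gaps K_sets) simp
  ultimately show ?thesis
    using AE_Gibbs_typical
  proof eventually_elim
    case (elim w)
    have w: "w \<in> \<Sigma>" and lW: "(\<lambda>n. - ln (W w n) / real n) \<longlonglongrightarrow> chi1"
      and lH: "(\<lambda>n. - ln (H w n) / real n) \<longlonglongrightarrow> chi2"
      and lm: "(\<lambda>n. - ln (min (W w n) (H w n)) / real n) \<longlonglongrightarrow> chi2"
      and lF: "(\<lambda>n. - ln (measure Gibbs (cyl (prefix w n))) / real n) \<longlonglongrightarrow> h"
      using elim(3) by auto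
    have pos: "0 < W w n" "0 < H w n" "0 < min (W w n) (H w n)" for n
      using width_height_pos[OF prefix_letters[OF w]] by auto
    have ball_pos: "0 < measure \<mu>\<^sub>1 (ball (code w) r)" if "0 < r" for r
      using Gibbs_ball_pos[OF w that] by (simp add: measure_mu_ball)
    define g where "g r = - ln (measure \<mu>\<^sub>1 (ball (code w) r))" for r
    have "((\<lambda>r. g r / (- ln r)) \<longlongrightarrow> \<kappa> / chi2) (at_right 0)"
    proof (rule limit_along_sparse_scales[where ?R1.0 = "\<lambda>n. \<delta> * min (W w n) (H w n)" and ?R2.0 = "\<lambda>n. 2 * H w n"])
      show "g r' \<le> g r" if "0 < r" "r \<le> r'" for r r'
        unfolding g_def by (rule ln_measure_ball_antimono[OF mu_finite(1,2) ball_pos[OF that(1)] that(2)])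
      show "0 < \<delta> * min (W w n) (H w n)" for n using \<delta> pos[of n] by simp
      show "0 < 2 * H w n" for n using pos[of n] by simp
      show "0 < chi2" using exponent_facts by simp
      show "0 \<le> \<kappa>" using exponent_facts D_nonneg by (simp add: \<kappa>_def)
      have "(\<lambda>n. - ln \<delta> / real n + - ln (min (W w n) (H w n)) / real n) \<longlonglongrightarrow> 0 + chi2"
        by (intro tendsto_add lim_const_over_n lm)
      then show "(\<lambda>n. - ln (\<delta> * min (W w n) (H w n)) / real n) \<longlonglongrightarrow> chi2"
        using \<delta> pos by (simp add: ln_mult_pos add_divide_distrib diff_divide_distrib)
      have "(\<lambda>n. - ln 2 / real n + - ln (H w n) / real n) \<longlonglongrightarrow> 0 + chi2"
        by (intro tendsto_add lim_const_over_n lH)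
      then show "(\<lambda>n. - ln (2 * H w n) / real n) \<longlonglongrightarrow> chi2"
        using pos by (simp add: ln_mult_pos add_divide_distrib diff_divide_distrib)
      fix \<epsilon>0 :: real assume e0: "0 < \<epsilon>0"
      define gap where "gap = chi2 - chi1"
      have gap: "0 \<le> gap" using exponent_facts by (simp add: gap_def)
      obtain i where i: "1 / real (Suc i) < \<epsilon>0 / (2 * gap + 1)"
        using nat_approx_posE[of "\<epsilon>0 / (2 * gap + 1)"] e0 gap by (auto simp: inverse_eq_divide)
      obtain q where q: "1 / real (Suc q) < \<epsilon>0" using nat_approx_posE[OF e0] by (auto simp: inverse_eq_divide)
      define \<epsilon> where "\<epsilon> = 1 / real (Suc i)"
      have eps: "0 < \<epsilon>" "2 * \<epsilon> * gap < \<epsilon>0"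
      proof -
        show "0 < \<epsilon>" by (simp add: \<epsilon>_def)
        have "\<epsilon> * (2 * gap + 1) < \<epsilon>0" using i gap by (simp add: \<epsilon>_def pos_less_divide_eq)
        then show "2 * \<epsilon> * gap < \<epsilon>0" using \<open>0 < \<epsilon>\<close> by (simp add: algebra_simps)
      qed
      obtain j where j: "w \<in> K \<epsilon> j" using elim(1) by (auto simp: \<epsilon>_def)
      define V where "V = {k. upright (prefix w k) \<and> (shift ^^ k) w \<in> K \<epsilon> j}"
      have visits: "eventually (\<lambda>n. \<exists>k k'. k \<le> n \<and> n < k' \<and> k' \<le> k + k div Suc q \<and> k \<in> V \<and> k' \<in> V) sequentially"
        using elim(2)[rule_format, of i j q] j unfolding \<epsilon>_def V_def by (simp add: conj_ac)
      have V1: "eventually (\<lambda>n. \<exists>k\<in>V. \<exists>k'\<in>V. k \<le> n \<and> n < k' \<and> real k' \<le> (1 + \<epsilon>0) * real k) sequentially"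
        using visits
      proof eventually_elim
        case (elim n)
        then obtain k k' where k: "k \<le> n" "n < k'" "k' \<le> k + k div Suc q" "k \<in> V" "k' \<in> V" by blast
        have "real k' \<le> real k + real (k div Suc q)" using k(3) by linarith
        also have "real (k div Suc q) \<le> real k / real (Suc q)" by (rule of_nat_div_le_of_nat)
        also have "real k / real (Suc q) = 1 / real (Suc q) * real k" by simp
        also have "1 / real (Suc q) * real k \<le> \<epsilon>0 * real k" using q by (intro mult_right_mono) auto
        finally have "real k' \<le> (1 + \<epsilon>0) * real k" by (simp add: algebra_simps)
        with k show ?case by blast
      qed
      define F where "F n = measure Gibbs (cyl (prefix w n))" for n
      \<comment> \<open>minus the logarithms of the relative widths of the strips in the upper and the lower bound\<close>
      define T1 where "T1 n = - ln \<delta> - ln (min (W w n) (H w n)) + ln (W w n)" for n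
      define T2 where "T2 n = - ln (min (W w n) (H w n)) + ln (W w n)" for n
      define c where "c = 2 * D * ln 2 + 2 * \<epsilon> + real j"
      define LB where "LB n = - 3 * ln G - ln (F n) + D * T1 n - 2 * \<epsilon> * T1 n - c" for n
      define UB where "UB n = 3 * ln G - ln (F n) + D * T2 n + 2 * \<epsilon> * T2 n + c" for n
      have lT2: "(\<lambda>n. T2 n / real n) \<longlonglongrightarrow> gap"
        using tendsto_diff[OF lm lW] by (simp add: T2_def gap_def add_divide_distrib diff_divide_distrib)
      have lT1: "(\<lambda>n. T1 n / real n) \<longlonglongrightarrow> gap"
      proof -
        have "(\<lambda>n. - ln \<delta> / real n + T2 n / real n) \<longlonglongrightarrow> 0 + gap"
          by (intro tendsto_add lim_const_over_n lT2)
        moreover have "- ln \<delta> / real n + T2 n / real n = T1 n / real n" for n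
          by (simp add: T1_def T2_def add_divide_distrib diff_divide_distrib)
        ultimately show ?thesis by simp
      qed
      have lF': "(\<lambda>n. - ln (F n) / real n) \<longlonglongrightarrow> h" using lF by (simp add: F_def)
      have "(\<lambda>n. (- 3 * ln G - c) / real n + - ln (F n) / real n + (D - 2 * \<epsilon>) * (T1 n / real n)) \<longlonglongrightarrow> 0 + h + (D - 2 * \<epsilon>) * gap"
        by (intro tendsto_add tendsto_mult tendsto_const lim_const_over_n lF' lT1)
      moreover have "(- 3 * ln G - c) / real n + - ln (F n) / real n + (D - 2 * \<epsilon>) * (T1 n / real n) = LB n / real n" for n
        by (simp add: LB_def add_divide_distrib diff_divide_distrib left_diff_distrib)
      ultimately have "(\<lambda>n. LB n / real n) \<longlonglongrightarrow> h + (D - 2 * \<epsilon>) * gap" by simp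
      moreover have "\<kappa> - \<epsilon>0 < h + (D - 2 * \<epsilon>) * gap"
        using eps by (simp add: \<kappa>_def gap_def[symmetric] left_diff_distrib)
      ultimately have LBev: "eventually (\<lambda>n. \<kappa> - \<epsilon>0 < LB n / real n) sequentially"
        by (rule order_tendstoD(1))
      have "(\<lambda>n. (3 * ln G + c) / real n + - ln (F n) / real n + (D + 2 * \<epsilon>) * (T2 n / real n)) \<longlonglongrightarrow> 0 + h + (D + 2 * \<epsilon>) * gap"
        by (intro tendsto_add tendsto_mult tendsto_const lim_const_over_n lF' lT2)
      moreover have "(3 * ln G + c) / real n + - ln (F n) / real n + (D + 2 * \<epsilon>) * (T2 n / real n) = UB n / real n" for n
        by (simp add: UB_def add_divide_distrib diff_divide_distrib distrib_right)
      ultimately have "(\<lambda>n. UB n / real n) \<longlonglongrightarrow> h + (D + 2 * \<epsilon>) * gap" by simp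
      moreover have "h + (D + 2 * \<epsilon>) * gap < \<kappa> + \<epsilon>0"
        using eps by (simp add: \<kappa>_def gap_def[symmetric] distrib_right)
      ultimately have UBev: "eventually (\<lambda>n. UB n / real n < \<kappa> + \<epsilon>0) sequentially"
        by (rule order_tendstoD(2))
      have V2: "LB n \<le> g (\<delta> * min (W w n) (H w n)) \<and> g (2 * H w n) \<le> UB n" if n: "n \<ge> 1" "n \<in> V" for n
      proof
        have up: "upright (prefix w n)" and Kn: "(shift ^^ n) w \<in> K \<epsilon> j" using n by (auto simp: V_def)
        let ?y = "code ((shift ^^ n) w) $ 1"
        have Fp: "0 < F n" unfolding F_def
          using prefix_letters[OF w, of n] n(1) by (intro Gibbs_pos_cyl) (auto simp: prefix_def)
        have G0: "0 < G" "0 < G^3" using G by auto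
        have lnG: "ln (G^3) = 3 * ln G" using G0 by (simp add: ln_realpow)
        define r1 where "r1 = \<delta> * min (W w n) (H w n) / W w n"
        define r2 where "r2 = min (W w n) (H w n) / W w n"
        have r2: "0 < r2" "r2 \<le> 1" using pos[of n] by (auto simp: r2_def)
        have r1_eq: "r1 = \<delta> * r2" by (simp add: r1_def r2_def)
        have r1: "0 < r1" "r1 \<le> 1" using \<delta> r2 by (auto simp: r1_eq intro: mult_le_one)
        have T12: "- ln r1 = T1 n" "- ln r2 = T2 n"
        proof -
          have "ln (x * y / z) = ln x + ln y - ln z" "ln (y / z) = ln y - ln z" if "0 < x" "0 < y" "0 < z" for x y z :: real
            using that by (simp_all add: ln_div ln_mult_pos)
          from this[OF \<delta>(1) pos(3,1)] show "- ln r1 = T1 n" "- ln r2 = T2 n"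
            by (simp_all add: r1_def r2_def T1_def T2_def)
        qed
        have nup: "0 < measure \<nu> (ball ?y r)" if "0 < r" for r
          by (rule nu_pos[OF shift_full[OF w] that])
        have "measure \<mu>\<^sub>1 (ball (code w) (\<delta> * min (W w n) (H w n))) \<le> G^3 * F n * measure \<nu> (ball ?y r1)"
          unfolding measure_mu_ball F_def r1_def by (rule ball_le_strip[OF sep w n(1) up])
        then have "ln (measure \<mu>\<^sub>1 (ball (code w) (\<delta> * min (W w n) (H w n)))) \<le> ln (G^3 * F n * measure \<nu> (ball ?y r1))"
          using ball_pos[of "\<delta> * min (W w n) (H w n)"] \<delta> pos[of n] nup[OF r1(1)] Fp G0 by (subst ln_le_cancel_iff) auto
        also have "\<dots> = 3 * ln G + ln (F n) + ln (measure \<nu> (ball ?y r1))"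
          using nup[OF r1(1)] Fp G0 lnG by (simp add: ln_mult_pos)
        finally show "LB n \<le> g (\<delta> * min (W w n) (H w n))"
          using K_bound[OF Kn eps(1) r1] unfolding T12 LB_def g_def c_def[symmetric] by linarith
        have "F n * measure \<nu> (ball ?y r2) \<le> G^3 * measure \<mu>\<^sub>1 (ball (code w) (2 * H w n))"
          unfolding measure_mu_ball F_def r2_def by (rule strip_le_ball[OF w n(1) up])
        then have "ln (F n * measure \<nu> (ball ?y r2)) \<le> ln (G^3 * measure \<mu>\<^sub>1 (ball (code w) (2 * H w n)))"
          using ball_pos[of "2 * H w n"] pos[of n] nup[OF r2(1)] Fp G0 by (subst ln_le_cancel_iff) auto
        then have "ln (F n) + ln (measure \<nu> (ball ?y r2)) \<le> 3 * ln G + ln (measure \<mu>\<^sub>1 (ball (code w) (2 * H w n)))"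
          using ball_pos[of "2 * H w n"] pos[of n] nup[OF r2(1)] Fp G0 lnG by (simp add: ln_mult_pos)
        then show "g (2 * H w n) \<le> UB n"
          using K_bound[OF Kn eps(1) r2] unfolding T12 UB_def g_def c_def[symmetric] by linarith
      qed
      have "eventually (\<lambda>n. n \<in> V \<longrightarrow> (\<kappa> - \<epsilon>0) * real n \<le> g (\<delta> * min (W w n) (H w n)) \<and> g (2 * H w n) \<le> (\<kappa> + \<epsilon>0) * real n) sequentially"
        using LBev UBev eventually_ge_at_top[of 1]
      proof eventually_elim
        case (elim n)
        have "(\<kappa> - \<epsilon>0) * real n \<le> LB n" "UB n \<le> (\<kappa> + \<epsilon>0) * real n"
          using elim by (simp_all add: pos_less_divide_eq pos_divide_less_eq)
        then show ?case using V2[OF elim(3)] by force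
      qed
      with V1 show "\<exists>V. eventually (\<lambda>n. \<exists>k\<in>V. \<exists>k'\<in>V. k \<le> n \<and> n < k' \<and> real k' \<le> (1 + \<epsilon>0) * real k) sequentially \<and>
        eventually (\<lambda>n. n \<in> V \<longrightarrow> (\<kappa> - \<epsilon>0) * real n \<le> g (\<delta> * min (W w n) (H w n)) \<and> g (2 * H w n) \<le> (\<kappa> + \<epsilon>0) * real n) sequentially"
        by blast
    qed
    then show ?case using ball_pos by (simp add: local_dim_def g_def)
  qed
qed

lemma mu1_le_mu: "measure \<mu>\<^sub>1 (ball x r) \<le> G * G * measure \<mu> (ball x r)"
proof -
  from Gibbs_le_Kaen[OF code_ball_sets] show ?thesis
    using G by (simp add: measure_mu_ball Gibbs.emeasure_eq_measure Kaen.emeasure_eq_measure ennreal_mult[symmetric])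
qed

lemma AE_Gibbs_local_dim_mu: "AE w in Gibbs. local_dim \<mu> (code w) (\<kappa> / chi2)"
proof -
  have code1: "code \<in> measurable Gibbs borel" by measurable
  have "AE x in \<mu>\<^sub>1. local_dim \<mu>\<^sub>1 x (\<kappa> / chi2)"
    using AE_local_dim_mu1 local_dim_sets[OF mu_finite(1,2)] by (subst AE_distr_iff[OF code1]) auto
  then have "AE x in \<mu>\<^sub>1. local_dim \<mu> x (\<kappa> / chi2)"
    using G by (intro AE_local_dim_dominated[OF mu_finite(3,4,1,2) _ mu1_le_mu]) auto
  then show ?thesis by (rule AE_distrD[OF code1])
qed

end

section \<open>From the Gibbs measure to the Kaenmaki measure\<close>

context kaenmaki_gibbs
begin

text \<open>
  One additional letter multiplies each singular value by a number between \<open>min (a i) (b i)\<close> and \<open>1\<close>,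
  whether or not it exchanges the axes.
\<close>

lemma kweight_Cons:
  assumes i: "i \<in> {1..d}" and v: "set v \<subseteq> {1..d}"
  shows "kweight (i # v) \<le> exp (- pressure d l a b s) * kweight v"
    and "exp (- pressure d l a b s) * weight s (min (a i) (b i)) (min (a i) (b i)) * kweight v \<le> kweight (i # v)"
proof -
  define p q where "p = max (width v) (height v)" and "q = min (width v) (height v)"
  define p' q' where "p' = max (width (i # v)) (height (i # v))" and "q' = min (width (i # v)) (height (i # v))"
  define \<rho> where "\<rho> = min (a i) (b i)"
  note ab = ab_bounds[OF i]
  have iv: "set (i # v) \<subseteq> {1..d}" using i v by auto
  have wv: "0 < width v" "0 < height v" using width_height_pos[OF v] by auto
  have pos: "0 < p" "0 < q" "0 < p'" "0 < q'" "0 < \<rho>"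
    using wv width_height_pos[OF iv] ab by (auto simp: p_def q_def p'_def q'_def \<rho>_def less_max_iff_disj)
  have stretch: "\<rho> * max x y \<le> max (a i * x) (b i * y)" "\<rho> * min x y \<le> min (a i * x) (b i * y)"
    "max (a i * x) (b i * y) \<le> max x y" "min (a i * x) (b i * y) \<le> min x y" if "0 < x" "0 < y" for x y
  proof -
    have le: "\<rho> * x \<le> a i * x" "\<rho> * y \<le> b i * y" "a i * x \<le> x" "b i * y \<le> y"
      using that ab by (auto simp: \<rho>_def intro!: mult_right_mono)
    have dist: "\<rho> * max x y = max (\<rho> * x) (\<rho> * y)" "\<rho> * min x y = min (\<rho> * x) (\<rho> * y)"
      using pos(5) by (simp_all add: max_mult_distrib_left min_mult_distrib_left)
    show "\<rho> * max x y \<le> max (a i * x) (b i * y)" "\<rho> * min x y \<le> min (a i * x) (b i * y)"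
      unfolding dist by (intro max.mono min.mono le)+
    show "max (a i * x) (b i * y) \<le> max x y" "min (a i * x) (b i * y) \<le> min x y"
      by (intro max.mono min.mono le)+
  qed
  have "\<rho> * p \<le> p'" "\<rho> * q \<le> q'" "p' \<le> p" "q' \<le> q"
    unfolding p_def q_def p'_def q'_def
    using stretch[OF wv] stretch[OF wv(2,1)] by (simp_all add: max.commute min.commute)
  then have "weight s p' q' \<le> weight s p q" "weight s (\<rho> * p) (\<rho> * q) \<le> weight s p' q'"
    using pos s by (auto intro!: weight_mono)
  moreover have "weight s (\<rho> * p) (\<rho> * q) = weight s \<rho> \<rho> * weight s p q"
    using pos by (intro weight_mult)
  moreover have "kweight v = exp (- pressure d l a b s * real (length v)) * weight s p q"
    by (simp add: kweight_def sv_function_eq[OF v] p_def q_def)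
  moreover have "kweight (i # v) = exp (- pressure d l a b s) * exp (- pressure d l a b s * real (length v)) * weight s p' q'"
    unfolding kweight_def sv_function_eq[OF iv] p'_def q'_def
    by (simp add: exp_add[symmetric] algebra_simps)
  ultimately show "kweight (i # v) \<le> exp (- pressure d l a b s) * kweight v"
    and "exp (- pressure d l a b s) * weight s (min (a i) (b i)) (min (a i) (b i)) * kweight v \<le> kweight (i # v)"
    by (simp_all add: \<rho>_def mult.assoc)
qed

lemma Kaen_shift_comparison:
  assumes i: "i \<in> {1..d}"
  shows "\<exists>C>0. \<forall>E\<in>sets borel. measure Kaen (cyl [i] \<inter> shift -` E) \<le> C * measure Kaen E \<and>
      measure Kaen E \<le> C * measure Kaen (cyl [i] \<inter> shift -` E)"
proof -
  define e where "e = exp (- pressure d l a b s)"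
  define \<omega> where "\<omega> = weight s (min (a i) (b i)) (min (a i) (b i))"
  have e: "0 < e" by (simp add: e_def)
  have om: "0 < \<omega>" unfolding \<omega>_def using ab_bounds[OF i] by (intro weight_pos) auto
  have G0: "0 < G" using G by simp
  define C where "C = max (G * G * e) (G * G / (e * \<omega>))"
  have C: "0 < C" "G * G * e \<le> C" "G * G / (e * \<omega>) \<le> C" using G0 e om by (auto simp: C_def less_max_iff_disj)
  have up: "measure Kaen (cyl ([i] @ v)) \<le> C * measure Kaen (cyl v)" if v: "v \<noteq> []" for v
  proof (cases "set v \<subseteq> {1..d}")
    case True
    have "measure Kaen (cyl (i # v)) \<le> G * kweight (i # v)" using i True by (intro Kaen_le) auto
    also have "\<dots> \<le> G * (e * (G * measure Kaen (cyl v)))"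
    proof (rule mult_left_mono)
      have "kweight (i # v) \<le> e * kweight v" unfolding e_def by (rule kweight_Cons(1)[OF i True])
      also have "\<dots> \<le> e * (G * measure Kaen (cyl v))" using e Kaen_ge[OF v True] by (intro mult_left_mono) auto
      finally show "kweight (i # v) \<le> e * (G * measure Kaen (cyl v))" .
    qed (use G0 in simp)
    also have "\<dots> = G * G * e * measure Kaen (cyl v)" by (simp add: algebra_simps)
    also have "\<dots> \<le> C * measure Kaen (cyl v)" using C(2) by (rule mult_right_mono) simp
    finally show ?thesis by simp
  qed (simp add: null_cyl)
  have low: "measure Kaen (cyl v) \<le> C * measure Kaen (cyl ([i] @ v))" if v: "v \<noteq> []" for v
  proof (cases "set v \<subseteq> {1..d}")
    case True
    have "measure Kaen (cyl v) \<le> G * kweight v" by (rule Kaen_le[OF v True])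
    also have "kweight v \<le> kweight (i # v) / (e * \<omega>)"
      using kweight_Cons(2)[OF i True] e om unfolding e_def[symmetric] \<omega>_def[symmetric] by (simp add: pos_le_divide_eq mult.commute)
    also have "kweight (i # v) / (e * \<omega>) \<le> G * measure Kaen (cyl (i # v)) / (e * \<omega>)"
      using i True e om by (intro divide_right_mono Kaen_ge) auto
    finally have "measure Kaen (cyl v) \<le> G * G / (e * \<omega>) * measure Kaen (cyl (i # v))"
      using G0 by (simp add: mult_left_mono algebra_simps)
    also have "\<dots> \<le> C * measure Kaen (cyl (i # v))" using C(3) by (rule mult_right_mono) simp
    finally show ?thesis by simp
  qed (use C(1) in \<open>simp add: null_cyl\<close>)
  have "measure Kaen (cyl [i] \<inter> shift -` E) \<le> C * measure Kaen E \<and>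
      measure Kaen E \<le> C * measure Kaen (cyl [i] \<inter> shift -` E)" if E: "E \<in> sets borel" for E
    using measure_after_prefix_le[OF Kaen.finite_measure_axioms _ _ E up]
      measure_after_prefix_ge[OF Kaen.finite_measure_axioms _ _ E low] C(1) by simp
  with C(1) show ?thesis by blast
qed

text \<open>
  The Gibbs measure is dominated by the Kaenmaki measure, so the property holds on a set of positive
  Kaenmaki measure. By assumption it holds at every point whose orbit meets this set, and by ergodicity
  almost every orbit does.
\<close>

lemma ergodic_backward_closed:
  assumes closed: "\<And>w. w \<in> \<Sigma> \<Longrightarrow> P (shift w) \<Longrightarrow> P w" and AE: "AE w in Gibbs. P w"
  shows "AE w in m. P w"
proof -
  obtain N where N: "{w \<in> space Gibbs. \<not> P w} \<subseteq> N" "emeasure Gibbs N = 0" "N \<in> sets Gibbs"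
    using AE by (rule AE_E)
  define E0 where "E0 = \<Sigma> - N"
  have E0: "E0 \<in> sets borel" "E0 \<subseteq> \<Sigma>" using N(3) full_shift_sets by (auto simp: E0_def)
  have P0: "P w" if "w \<in> E0" for w using that N(1) by (auto simp: E0_def)
  have posE: "0 < measure m E0"
  proof -
    have "measure Gibbs UNIV \<le> measure Gibbs E0"
      by (rule Gibbs.finite_measure_mono_AE)
         (use AE_Gibbs_full AE_not_in[of N Gibbs] N E0 in \<open>auto simp: E0_def null_sets_def\<close>)
    moreover have "emeasure Gibbs E0 \<le> ennreal (G * G) * emeasure Kaen E0" by (rule Gibbs_le_Kaen[OF E0(1)])
    then have "measure Gibbs E0 \<le> G * G * measure Kaen E0"
      using G by (simp add: Gibbs.emeasure_eq_measure Kaen.emeasure_eq_measure ennreal_mult[symmetric])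
    ultimately have "0 < G * G * measure Kaen E0" using Gibbs_pos by linarith
    moreover have "measure Kaen E0 = measure m E0" using E0 by (simp add: measure_Kaen Int_absorb2)
    ultimately have "0 < G * G * measure m E0" by (simp only:)
    then show ?thesis using G by (simp add: zero_less_mult_iff)
  qed
  define A where "A k = (shift ^^ k) -` E0 \<inter> \<Sigma>" for k
  have A_sets: "A k \<in> sets m" for k
    using measurable_sets[OF shift_funpow_measurable E0(1), of k] full_shift_sets by (auto simp: sets_m_iff A_def)
  have A_Suc: "A (Suc k) = shift -` A k \<inter> \<Sigma>" for k
    using shift_full[of _ 1] by (auto simp: A_def funpow_Suc_right simp del: funpow.simps)
  have A_meas: "measure m (A k) = measure m E0" for k
  proof (induction k)
    case 0
    show ?case using E0 by (simp add: A_def Int_absorb2)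
  next
    case (Suc k)
    have "emeasure m (shift -` A k \<inter> space m) = emeasure m (A k)"
      using m_ergodic A_sets[of k] by (simp add: shift_ergodic_def shift_invariant_def)
    then show ?case using Suc by (simp add: A_Suc measure_def space_m)
  qed
  \<comment> \<open>Orbits that meet the set infinitely often form an exactly invariant set, as ergodicity requires;
     orbits that meet it once form a set that is only invariant up to null sets.\<close>
  define U where "U j = (\<Union>k\<in>{j..}. A k)" for j
  have U_sets: "U j \<in> sets m" for j unfolding U_def by (rule sets.countable_UN'') (auto simp: A_sets)
  have U_dec: "decseq U" unfolding decseq_def U_def by (intro allI impI UN_mono) auto
  define E where "E = (\<Inter>j. U j)"
  have E_sets: "E \<in> sets m" unfolding E_def by (rule sets.countable_INT) (use U_sets in auto)
  have "(\<lambda>j. measure m (U j)) \<longlonglongrightarrow> measure m E"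
    unfolding E_def using U_sets U_dec by (intro m.finite_Lim_measure_decseq) auto
  moreover have "measure m E0 \<le> measure m (U j)" for j
    unfolding A_meas[of j, symmetric] using U_sets by (intro m.finite_measure_mono) (auto simp: U_def)
  ultimately have "measure m E0 \<le> measure m E" by (intro LIMSEQ_le_const) auto
  moreover have "shift -` E \<inter> space m = E"
  proof -
    have U_Suc: "shift -` U j \<inter> \<Sigma> = U (Suc j)" for j
    proof -
      have "shift -` U j \<inter> \<Sigma> = (\<Union>k\<in>{j..}. A (Suc k))" by (auto simp: U_def A_Suc)
      also have "\<dots> = (\<Union>k\<in>Suc ` {j..}. A k)" by simp
      also have "Suc ` {j..} = {Suc j..}"
      proof (intro equalityI subsetI)
        fix x assume "x \<in> {Suc j..}"
        then show "x \<in> Suc ` {j..}" by (intro image_eqI[of _ _ "x - 1"]) auto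
      qed auto
      finally show ?thesis by (simp only: U_def)
    qed
    have "shift -` E \<inter> \<Sigma> = (\<Inter>j. U (Suc j))" by (auto simp: E_def U_Suc[symmetric])
    also have "\<dots> = E"
      using U_dec by (auto simp: E_def decseq_Suc_iff)
    finally show ?thesis by (simp add: space_m)
  qed
  ultimately have "measure m E = 1"
    using m_ergodic E_sets posE unfolding shift_ergodic_def by fastforce
  then have "AE w in m. w \<in> E" using m.prob_eq_1[OF E_sets] by simp
  then show ?thesis
  proof eventually_elim
    case (elim w)
    then obtain k where "w \<in> A k" by (auto simp: E_def U_def)
    then have k: "w \<in> \<Sigma>" "P ((shift ^^ k) w)" using P0 by (auto simp: A_def)
    then show ?case
    proof (induction k arbitrary: w)
      case (Suc k)
      have "P (shift w)"
        using Suc.IH[of "shift w"] Suc.prems shift_full[of w 1]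
        by (simp add: funpow_Suc_right del: funpow.simps)
      then show ?case using closed Suc.prems by blast
    qed simp
  qed
qed

end

context kaenmaki_exponents
begin

lemma AE_Kaen_full: "AE w in Kaen. w \<in> \<Sigma>"
  by (rule AE_I[OF _ null_outside(1)]) auto

text \<open>
  Small balls around a point of \<open>S\<^sub>i(F)\<close> meet no other piece, so they are images of sets squeezed between
  two balls with radii in bounded ratio, and the Kaenmaki measure is comparable with its image under
  prepending \<open>i\<close>.
\<close>

lemma local_dim_shift:
  assumes w: "w \<in> \<Sigma>" and dim: "local_dim \<mu> (code (shift w)) \<delta>"
  shows "local_dim \<mu> (code w) \<delta>"
proof -
  define i where "i = w 0"
  have i: "i \<in> {1..d}" using w by (auto simp: i_def full_shift_def)
  note ab = ab_bounds[OF i]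
  define \<rho> where "\<rho> = min (a i) (b i)"
  have \<rho>: "0 < \<rho>" using ab by (simp add: \<rho>_def)
  obtain \<epsilon> where \<epsilon>: "0 < \<epsilon>" "\<epsilon> \<le> 1" and
    sep: "\<And>w w' n. w \<in> \<Sigma> \<Longrightarrow> w' \<in> \<Sigma> \<Longrightarrow> dist (cod w) (cod w') < \<epsilon> * min (W w n) (H w n) \<Longrightarrow> prefix w' n = prefix w n"
    by (rule separation_constant) blast
  obtain C where C: "0 < C" "\<And>E. E \<in> sets borel \<Longrightarrow> measure Kaen (cyl [i] \<inter> shift -` E) \<le> C * measure Kaen E"
    "\<And>E. E \<in> sets borel \<Longrightarrow> measure Kaen E \<le> C * measure Kaen (cyl [i] \<inter> shift -` E)"
    using Kaen_shift_comparison[OF i] by blast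
  have pre1: "prefix v 1 = [v 0]" for v :: "nat \<Rightarrow> nat" by (simp add: prefix_def)
  have sides: "W w 1 = a i" "H w 1 = b i" unfolding pre1 i_def by simp_all
  have code_i: "code v = S [i] (code (shift v))" if "v \<in> \<Sigma>" "v 0 = i" for v
    using code_shift[OF that(1), of 1] unfolding pre1 that(2) by simp
  have dists: "\<rho> * dist x y \<le> dist (S [i] x) (S [i] y)" "dist (S [i] x) (S [i] y) \<le> dist x y" for x y
  proof -
    show "\<rho> * dist x y \<le> dist (S [i] x) (S [i] y)"
      using S_dist_bounds(1)[of "[i]" x y] i by (cases "i < l") (simp_all add: \<rho>_def)
    have "dist (S [i] x) (S [i] y) \<le> max (a i) (b i) * dist x y"
      using S_dist_bounds(2)[of "[i]" x y] i by (cases "i < l") simp_all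
    also have "\<dots> \<le> 1 * dist x y" using ab by (intro mult_right_mono) auto
    finally show "dist (S [i] x) (S [i] y) \<le> dist x y" by simp
  qed
  let ?y = "code (shift w)"
  have cw: "code w = S [i] ?y" using code_i[OF w] by (simp add: i_def)
  have up: "measure \<mu> (ball ?y r) \<le> C * measure \<mu> (ball (code w) r)" for r
  proof -
    have "measure Kaen {v. dist ?y (code v) < r} \<le> C * measure Kaen (cyl [i] \<inter> shift -` {v. dist ?y (code v) < r})"
      by (rule C(3)[OF code_ball_sets])
    also have "\<dots> \<le> C * measure Kaen {v. dist (code w) (code v) < r}"
    proof (rule mult_left_mono[OF Kaen.finite_measure_mono_AE])
      show "AE v in Kaen. v \<in> cyl [i] \<inter> shift -` {v. dist ?y (code v) < r} \<longrightarrow> v \<in> {v. dist (code w) (code v) < r}"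
        using AE_Kaen_full
      proof eventually_elim
        case (elim v)
        have "code v = S [i] (code (shift v))" if "v \<in> cyl [i]"
          using that elim by (intro code_i) (auto simp: cyl_def pre1[simplified])
        then show ?case using dists(2)[of ?y "code (shift v)"] by (auto simp: cw intro: le_less_trans)
      qed
    qed (use C(1) in \<open>auto simp: code_ball_sets\<close>)
    finally show ?thesis by (simp only: measure_mu_ball)
  qed
  have low: "measure \<mu> (ball (code w) r) \<le> C * measure \<mu> (ball ?y (r / \<rho>))" if "r < \<epsilon> * \<rho>" for r
  proof -
    have "measure Kaen {v. dist (code w) (code v) < r} \<le> measure Kaen (cyl [i] \<inter> shift -` {v. dist ?y (code v) < r / \<rho>})"
    proof (rule Kaen.finite_measure_mono_AE)
      show "AE v in Kaen. v \<in> {v. dist (code w) (code v) < r} \<longrightarrow> v \<in> cyl [i] \<inter> shift -` {v. dist ?y (code v) < r / \<rho>}"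
        using AE_Kaen_full
      proof eventually_elim
        case (elim v)
        show ?case
        proof
          assume "v \<in> {v. dist (code w) (code v) < r}"
          then have lt: "dist (code w) (code v) < r" by simp
          also note that
          finally have "dist (cod w) (cod v) < \<epsilon> * min (W w 1) (H w 1)" unfolding sides \<rho>_def code_def using w elim by simp
          then have "prefix v 1 = prefix w 1" by (rule sep[OF w elim])
          then have v0: "v 0 = i" by (simp add: prefix_def i_def)
          have "\<rho> * dist ?y (code (shift v)) < r"
            using dists(1)[of ?y "code (shift v)"] lt code_i[OF elim v0] cw by simp
          then have "dist ?y (code (shift v)) < r / \<rho>" using \<rho> by (simp add: pos_less_divide_eq mult.commute)
          then show "v \<in> cyl [i] \<inter> shift -` {v. dist ?y (code v) < r / \<rho>}"
            using v0 by (simp add: cyl_def pre1[simplified])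
        qed
      qed
      show "cyl [i] \<inter> shift -` {v. dist ?y (code v) < r / \<rho>} \<in> sets Kaen"
        using measurable_sets[OF shift_funpow_measurable[of 1] code_ball_sets] by auto
    qed
    also have "\<dots> \<le> C * measure Kaen {v. dist ?y (code v) < r / \<rho>}" by (rule C(2)[OF code_ball_sets])
    finally show ?thesis by (simp only: measure_mu_ball)
  qed
  have py: "0 < measure \<mu> (ball ?y r)" if "0 < r" for r using dim that by (simp add: local_dim_def)
  have pw: "0 < measure \<mu> (ball (code w) r)" if "0 < r" for r
  proof -
    have "0 < C * measure \<mu> (ball (code w) r)" using up[of r] py[OF that] by linarith
    then show ?thesis using C(1) by (simp add: zero_less_mult_iff)
  qed
  let ?f = "\<lambda>r. - ln (measure \<mu> (ball (code w) r))" and ?g = "\<lambda>r. - ln (measure \<mu> (ball ?y r))"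
  have "((\<lambda>r. ?f r / (- ln r)) \<longlongrightarrow> \<delta>) (at_right 0)"
  proof (rule local_dim_of_comparison[where g = ?g and c = "ln C" and ?r0.0 = "\<epsilon> * \<rho>" and \<rho> = \<rho>])
    fix r :: real assume r: "0 < r"
    have "ln (measure \<mu> (ball ?y r)) \<le> ln (C * measure \<mu> (ball (code w) r))"
      using up[of r] py[OF r] pw[OF r] C(1) by (subst ln_le_cancel_iff) auto
    then show "?f r \<le> ?g r + ln C" using pw[OF r] C(1) by (simp add: ln_mult_pos)
    assume r0: "r < \<epsilon> * \<rho>"
    have pr: "0 < measure \<mu> (ball ?y (r / \<rho>))" using r \<rho> by (intro py) simp
    have "ln (measure \<mu> (ball (code w) r)) \<le> ln (C * measure \<mu> (ball ?y (r / \<rho>)))"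
      using low[OF r0] pw[OF r] pr C(1) by (subst ln_le_cancel_iff) auto
    then show "?g (r / \<rho>) - ln C \<le> ?f r" using pr C(1) by (simp add: ln_mult_pos)
  qed (use \<epsilon> \<rho> dim in \<open>auto simp: local_dim_def\<close>)
  then show ?thesis using pw by (simp add: local_dim_def)
qed

text \<open>
  The Ledrappier-Young formula, for an arbitrary dimension \<open>D\<close> of the projected measure.
\<close>

theorem ledrappier_young:
  "has_exact_dimension (kaenmaki_projection l a b t m) ((h + D * (chi2 - chi1)) / chi2)"
proof -
  have "AE w in m. local_dim \<mu> (code w) (\<kappa> / chi2)"
    by (rule ergodic_backward_closed[OF local_dim_shift AE_Gibbs_local_dim_mu])
  moreover have code_m: "code \<in> measurable m borel" by (rule borel_prob_on_measurable[OF m_prob code_measurable])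
  ultimately have "AE x in distr m borel code. local_dim \<mu> x (\<kappa> / chi2)"
    using local_dim_sets[OF mu_finite(3,4), of "\<kappa> / chi2"] by (subst AE_distr_iff[OF code_m]) auto
  moreover have "distr m borel code = \<mu>"
    unfolding Kaen_def by (subst distr_distr[OF code_measurable id_measurable_m]) (simp add: comp_def)
  ultimately have "AE x in \<mu>. local_dim \<mu> x (\<kappa> / chi2)" by (simp only:)
  then have "AE x in \<mu>. ((\<lambda>r. ln (measure \<mu> (ball x r)) / ln r) \<longlongrightarrow> \<kappa> / chi2) (at_right 0)"
    by eventually_elim (simp add: local_dim_def)
  moreover have "emeasure \<mu> (space \<mu>) \<noteq> 0"
    using prob_space.emeasure_space_1[OF Kaen.prob_space_distr[of code borel]] by simp
  ultimately show ?thesis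
    unfolding has_exact_dimension_def kaenmaki_projection_eq \<kappa>_def[symmetric] using mu_finite(3,4) by blast
qed

end

theorem corollary2p2:
  fixes d l :: nat
    and a b :: "nat \<Rightarrow> real"
    and t :: "nat \<Rightarrow> real^2"
    and F :: "(real^2) set"
    and s h chi1 chi2 :: real
    and m m1 :: "(nat \<Rightarrow> nat) measure"
    and \<mu> \<mu>1 :: "(real^2) measure"
  assumes ifs: "box_like_ifs d l a b t"
    and F: "attractor d l a b t F"
    and ssp: "strong_separation d l a b t F"
    and s: "0 < s" "s < 2"
    and m: "kaenmaki_measure d l a b s m"
    and mu: "\<mu> = kaenmaki_projection l a b t m"
    and exp1: "lyapunov_exponent l a b m 1 chi1"
    and exp2: "lyapunov_exponent l a b m 2 chi2"
    and h: "has_entropy m h"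
    and m1: "gibbs_measure (subshift d l) (potential1 d a b s) m1"
    and mu1: "\<mu>1 = mu1 d l a b t m1"
    and dim_proj: "has_exact_dimension (distr \<mu>1 borel (\<lambda>x. x $ 1)) (min (h / chi1) 1)"
  shows "has_exact_dimension \<mu> (if h \<le> chi1 then h / chi1 else 1 + (h - chi1) / chi2)"
proof -
  interpret kaenmaki_exponents d l a b t F s m m1 h chi1 chi2 "min (h / chi1) 1"
    using assms by unfold_locales auto
  have chi: "0 < chi1" "0 < chi2" using exponent_facts by auto
  have "(h + min (h / chi1) 1 * (chi2 - chi1)) / chi2 = (if h \<le> chi1 then h / chi1 else 1 + (h - chi1) / chi2)"
  proof (cases "h \<le> chi1")
    case True
    then have "min (h / chi1) 1 = h / chi1" using chi by simp
    then show ?thesis using True chi by (simp add: field_simps)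
  next
    case False
    then have "min (h / chi1) 1 = 1" using chi by simp
    then show ?thesis using False chi by (simp add: field_simps)
  qed
  then show ?thesis using ledrappier_young by (simp add: mu)
qed

end
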